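(* Let $0<p<1$, $q=1-p$, $r=1/q$, $s>0$, and $a>0$. Let $\tau_1,\tau_2,\dots$ be i.i.d. with $P(\tau_1=k)=p q^{k-1}$, $k=1,2,\dots$, let $T_k=\tau_1+\cdots+\tau_k$ and $X_k=s r^{\tau_k-1}$, and for $0<\gamma<1$ put $$V(\gamma)=\sum_{k=1}^{\infty}\gamma^{T_k}X_k .$$ For $n\ge1$ let $N=r^n$ and $\gamma=\gamma_n=\exp\{-ap/N\}$. Then, as $n\to\infty$ through the positive integers, $$\frac1N V(\gamma_n)-\frac{spn}{a}\ \xrightarrow{d}\ \int_0^\infty e^{-au}\,dZ(u),$$ where $\{Z(u)\}_{u\ge0}$ is the Lévy process with characteristic function $E\,e^{itZ(u)}=e^{u g(t)}$, $t\in\mathbb{R}$, and $$g(t)=\sum_{k=-\infty}^{\infty}\big(e^{its r^k}-1-its r^k c_k\big)\,p q^k,\qquad c_k=0\text{ for }k\ge0,\quad c_k=1\text{ for }k<0 .$$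
   Context: $\xrightarrow{d}$ denotes convergence in distribution. The integral $\int_0^\infty e^{-au}\,dZ(u)$ is the (Wiener-type) stochastic integral of a deterministic function with respect to the Lévy process $Z$, i.e. the limit of $\int_0^A e^{-au}\,dZ(u)$ as $A\to\infty$. *)

theory Defs
  imports "HOL-Probability.Probability"
begin

section \<open>Convergence in probability\<close>

definition conv_in_prob ::
  "'b measure \<Rightarrow> ('i \<Rightarrow> 'b \<Rightarrow> real) \<Rightarrow> ('b \<Rightarrow> real) \<Rightarrow> 'i filter \<Rightarrow> bool" where
  "conv_in_prob M X Y F \<longleftrightarrow>
     (\<forall>e>0. ((\<lambda>i. \<P>(\<omega> in M. \<bar>X i \<omega> - Y \<omega>\<bar> > e)) \<longlongrightarrow> 0) F)"


section \<open>Levy processes\<close>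

text \<open>
  Path regularity is not part of the definition: a process with the properties below has a
  modification with right-continuous paths having left limits, and a process with such paths is
  covered in particular. In the independence clause, every finite sequence of times is an initial
  segment of some nondecreasing \<open>t\<close>.
\<close>

locale levy_process = prob_space M for M :: "'b measure" +
  fixes Z :: "real \<Rightarrow> 'b \<Rightarrow> real"
  assumes rv: "\<And>u. 0 \<le> u \<Longrightarrow> random_variable borel (Z u)"
    and start: "AE \<omega> in M. Z 0 \<omega> = 0"
    and indep_increments: "\<And>(t :: nat \<Rightarrow> real) n. 0 \<le> t 0 \<Longrightarrow> incseq t \<Longrightarrow>
          indep_vars (\<lambda>_. borel) (\<lambda>i \<omega>. Z (t (Suc i)) \<omega> - Z (t i) \<omega>) {..<n}"
    and stationary_increments: "\<And>u h. 0 \<le> u \<Longrightarrow> 0 \<le> h \<Longrightarrow>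
          distr M borel (\<lambda>\<omega>. Z (u + h) \<omega> - Z u \<omega>) = distr M borel (Z h)"
    and stochastically_continuous: "\<And>u. 0 \<le> u \<Longrightarrow> conv_in_prob M Z (Z u) (at u within {0..})"


section \<open>Integrals of deterministic functions\<close>

text \<open>
  The integral of \<open>f\<close> over \<open>[A, B]\<close> is the limit in probability of the Riemann--Stieltjes sums as
  the mesh tends to \<open>0\<close>. This is the Wiener-type integral for continuous \<open>f\<close>, the only case used.
  The integral over \<open>[0, \<infinity>)\<close> is the limit in probability of the integrals over \<open>[0, A]\<close>.
  Such limits are unique only up to almost sure equality, hence the relational form.
\<close>

definition mesh_filter :: "real \<Rightarrow> real \<Rightarrow> (real \<times> real set) set filter" where
  "mesh_filter A B = (INF d\<in>{0<..}.
     principal {D. D tagged_division_of {A..B} \<and> (\<lambda>x. ball x d) fine D})"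

definition has_wiener_integral ::
  "'b measure \<Rightarrow> (real \<Rightarrow> 'b \<Rightarrow> real) \<Rightarrow> (real \<Rightarrow> real) \<Rightarrow> real \<Rightarrow> real \<Rightarrow> ('b \<Rightarrow> real) \<Rightarrow> bool" where
  "has_wiener_integral M Z f A B I \<longleftrightarrow>
     I \<in> borel_measurable M \<and>
     conv_in_prob M (\<lambda>D \<omega>. \<Sum>(x, K)\<in>D. f x * (Z (Sup K) \<omega> - Z (Inf K) \<omega>)) I (mesh_filter A B)"

definition has_wiener_integral_0_infty ::
  "'b measure \<Rightarrow> (real \<Rightarrow> 'b \<Rightarrow> real) \<Rightarrow> (real \<Rightarrow> real) \<Rightarrow> ('b \<Rightarrow> real) \<Rightarrow> bool" where
  "has_wiener_integral_0_infty M Z f I \<longleftrightarrow>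
     I \<in> borel_measurable M \<and>
     (\<exists>J. (\<forall>A>0. has_wiener_integral M Z f 0 A (J A)) \<and> conv_in_prob M J I at_top)"


section \<open>The discounted sum and the limiting exponent\<close>

text \<open>
  Indices \<open>k\<close> and \<open>j\<close> start at \<open>1\<close>; \<open>\<tau> 0\<close> is never used. The truncated subtraction in
  \<open>payoff\<close> matters only on the null event \<open>\<tau> k = 0\<close>.
\<close>

definition arrival_time :: "(nat \<Rightarrow> 'a \<Rightarrow> nat) \<Rightarrow> nat \<Rightarrow> 'a \<Rightarrow> nat" where
  "arrival_time \<tau> k \<omega> = (\<Sum>j=1..k. \<tau> j \<omega>)"

definition payoff :: "real \<Rightarrow> real \<Rightarrow> (nat \<Rightarrow> 'a \<Rightarrow> nat) \<Rightarrow> nat \<Rightarrow> 'a \<Rightarrow> real" where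
  "payoff s r \<tau> k \<omega> = s * r ^ (\<tau> k \<omega> - 1)"

definition discounted_term ::
  "real \<Rightarrow> real \<Rightarrow> (nat \<Rightarrow> 'a \<Rightarrow> nat) \<Rightarrow> real \<Rightarrow> nat \<Rightarrow> 'a \<Rightarrow> real" where
  "discounted_term s r \<tau> \<gamma> k \<omega> = \<gamma> ^ arrival_time \<tau> k \<omega> * payoff s r \<tau> k \<omega>"

definition discounted_sum :: "real \<Rightarrow> real \<Rightarrow> (nat \<Rightarrow> 'a \<Rightarrow> nat) \<Rightarrow> real \<Rightarrow> 'a \<Rightarrow> real" where
  "discounted_sum s r \<tau> \<gamma> \<omega> = (\<Sum>k. discounted_term s r \<tau> \<gamma> (Suc k) \<omega>)"

text \<open>
  For \<open>0 < p < 1\<close>, \<open>q = 1 - p\<close> and \<open>r = 1 / q\<close> the series converges absolutely: the terms are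
  \<open>O(q ^ k)\<close> as \<open>k \<rightarrow> \<infinity>\<close> and \<open>O(r ^ k)\<close> as \<open>k \<rightarrow> -\<infinity>\<close>.
\<close>

definition levy_exponent :: "real \<Rightarrow> real \<Rightarrow> real \<Rightarrow> real \<Rightarrow> real \<Rightarrow> complex" where
  "levy_exponent p q r s t =
     (\<Sum>\<^sub>\<infinity>k\<in>(UNIV :: int set).
        (exp (\<i> * complex_of_real (t * s * r powi k)) - 1
           - \<i> * complex_of_real (t * s * r powi k * (if k < 0 then 1 else 0)))
        * complex_of_real (p * q powi k))"

end

theory Submission
  imports Defs
begin

text \<open>
  Put \<open>N = r ^ n\<close>. The centered sum is self-similar: conditioning on the first waiting time \<open>\<tau>\<close>
  expresses its characteristic function \<open>h n\<close> at \<open>t\<close> as an average, over the geometric law of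
  \<open>\<tau>\<close>, of values of \<open>h n\<close> at the contracted points \<open>\<gamma>\<^sup>\<tau> t\<close>, multiplied by explicit unimodular
  factors. On the other hand \<open>H t\<close>, the integral of \<open>g (t * exp (- a * u))\<close> over \<open>u > 0\<close>, satisfies
  \<open>H t - H (t * exp (- a * c)) \<approx> c * g t\<close>, and the relation \<open>g (q * t) = q * (g t + \<i> * t * s * p)\<close>
  (shift the index in the series) shows that \<open>exp (H t)\<close> solves the same recursion up to an error
  \<open>O(n\<^sup>2 N powr (- 3/2)) * \<bar>t\<bar> powr (3/4)\<close>. A step contracts \<open>\<bar>t\<bar> powr (3/4)\<close> by a factor
  \<open>1 - const / N\<close>, so a maximum principle bounds \<open>\<bar>h n t - exp (H t)\<bar>\<close> by
  \<open>O(n\<^sup>2 N powr (- 1/2)) * \<bar>t\<bar> powr (3/4)\<close>.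

  For the stochastic integral, the Riemann--Stieltjes sums of two tagged divisions are compared on
  a common refinement. The characteristic function of their difference is explicit and tends to
  \<open>1\<close>, so the sums are Cauchy in probability.
\<close>

section \<open>Elementary estimates\<close>

text \<open>The index \<open>k\<close> in \<open>g\<close> stands for a waiting time
  \<open>\<tau> = n + 1 + k\<close>: then \<open>X / N = s * r ^ k\<close>, and such payoffs occur
  with intensity \<open>N * p * q ^ (\<tau> - 1) = p * q ^ k\<close> per unit of rescaled time,
  since about \<open>N\<close> renewals fill one unit. So the compensated indices
  \<open>k < 0\<close> are the payoffs with \<open>\<tau> \<le> n\<close>. Their truncated mean is
  \<open>s * p * n\<close>; the waiting times have mean \<open>1 / p\<close>, so the discount
  factors add up to about \<open>N / a\<close>, and together this explains the centering
  \<open>s * p * n / a\<close>.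

  Two obstacles shape the argument. The payoffs have infinite mean, so no first-order Taylor
  expansion of a characteristic function is available. Moreover a payoff depends on the discount
  factor that multiplies it, so the sum is not a weighted sum of i.i.d. variables. A recursion in
  \<open>t\<close> copes with both, provided that the error of one renewal is of smaller order than
  \<open>1 / N\<close>. Since discounting only shrinks \<open>t\<close>, a bound
  \<open>\<bar>t\<bar> \<le> T\<close> is inherited by all points that the recursion visits; hence
  all constants may depend on \<open>T\<close>.\<close>

text \<open>
  The exponent \<open>3/4\<close> could be any number strictly between \<open>1/2\<close> and \<open>1\<close>: below \<open>1\<close> the payoffs
  have a finite moment of this order, and above \<open>1/2\<close> the error made in replacing the discounted
  payoff \<open>\<gamma>\<^sup>\<tau> X / N\<close> by \<open>X / N\<close> is of smaller order than \<open>1/N\<close>.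
\<close>

lemma min_two_le_powr:
  fixes c x :: real
  assumes "c \<le> 2" "c \<le> x" "0 \<le> x"
  shows "c \<le> 2 * x powr (3/4)"
proof (cases "x \<ge> 1")
  case True
  then have "1 \<le> x powr (3/4)" by (simp add: ge_one_powr_ge_zero)
  with assms show ?thesis by simp
next
  case False
  have "x \<le> x powr (3/4)"
  proof (cases "x = 0")
    case False
    then have "x powr 1 \<le> x powr (3/4)"
      using \<open>\<not> 1 \<le> x\<close> assms by (intro powr_mono') auto
    then show ?thesis using assms False by simp
  qed simp
  with assms show ?thesis by simp
qed

lemma norm_iexp_diff_le: "norm (iexp x - iexp y) \<le> \<bar>x - y\<bar>"
proof -
  have "iexp x - iexp y = iexp y * (iexp (x - y) - 1)"
    by (simp add: algebra_simps flip: exp_add)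
  then have "norm (iexp x - iexp y) = norm (iexp (x - y) - 1)" by (simp add: norm_mult)
  also have "\<dots> \<le> \<bar>x - y\<bar>" using iexp_approx1[of "x - y" 0] by simp
  finally show ?thesis .
qed

lemma norm_iexp_diff_powr_le: "norm (iexp x - iexp y) \<le> 2 * \<bar>x - y\<bar> powr (3/4)"
proof (rule min_two_le_powr)
  show "norm (iexp x - iexp y) \<le> 2"
    using norm_triangle_ineq4[of "iexp x" "iexp y"] by simp
qed (use norm_iexp_diff_le in auto)

text \<open>The function \<open>iexp x - 1 - \<i> * x\<close> has a derivative of size at most
  \<open>\<bar>x\<bar>\<close>, hence the second factor. That extra factor is what makes the terms
  of negative index summable, whose weights grow geometrically.\<close>

lemma norm_iexp_minus_linear_diff_le:
  "norm ((iexp x - 1 - \<i> * x) - (iexp y - 1 - \<i> * y)) \<le> 2 * \<bar>x - y\<bar> * (\<bar>x\<bar> + \<bar>y\<bar>)"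
proof -
  have eq: "(iexp x - 1 - \<i> * x) - (iexp y - 1 - \<i> * y)
      = iexp y * (iexp (x - y) - 1 - \<i> * (x - y)) + \<i> * (x - y) * (iexp y - iexp 0)"
    by (simp add: algebra_simps flip: exp_add)
  have "norm (iexp (x - y) - 1 - \<i> * (x - y)) \<le> \<bar>x - y\<bar>\<^sup>2 / 2"
    using iexp_approx1[of "x - y" 1] by (simp add: algebra_simps numeral_2_eq_2)
  moreover have "norm (iexp y - iexp 0) \<le> \<bar>y\<bar>" using norm_iexp_diff_le[of y 0] by simp
  then have "\<bar>x - y\<bar> * norm (iexp y - iexp 0) \<le> \<bar>x - y\<bar> * \<bar>y\<bar>"
    by (intro mult_left_mono) auto
  ultimately have "norm ((iexp x - 1 - \<i> * x) - (iexp y - 1 - \<i> * y))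
      \<le> \<bar>x - y\<bar>\<^sup>2 / 2 + \<bar>x - y\<bar> * \<bar>y\<bar>"
    unfolding eq
    by (intro order.trans[OF norm_triangle_ineq] add_mono) (simp_all only: norm_mult norm_of_real norm_ii norm_exp_i_times mult_1)
  also have "\<dots> = \<bar>x - y\<bar> * (\<bar>x - y\<bar> / 2 + \<bar>y\<bar>)" by (simp add: power2_eq_square algebra_simps)
  also have "\<dots> \<le> \<bar>x - y\<bar> * (2 * (\<bar>x\<bar> + \<bar>y\<bar>))" by (intro mult_left_mono) auto
  finally show ?thesis by (simp only: mult_ac)
qed

text \<open>Brings errors that are linear in \<open>\<bar>t\<bar>\<close> to the common form
  \<open>\<bar>t\<bar> powr (3/4)\<close>, at the price of a constant depending on the range of
  \<open>t\<close>.\<close>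

lemma powr_le_on_bounded:
  fixes x K :: real
  assumes "0 \<le> x" "x \<le> K"
  shows "x \<le> K powr (1/4) * x powr (3/4)"
proof (cases "x = 0")
  case False
  have "x = x powr (1/4) * x powr (3/4)"
    using assms False by (simp flip: powr_add)
  also have "\<dots> \<le> K powr (1/4) * x powr (3/4)"
    using assms by (intro mult_right_mono powr_mono2) auto
  finally show ?thesis .
qed simp

text \<open>The mean value inequality on a half-plane. A bound on the real part alone is assumed
  because the imaginary part will contain the centering, which is unbounded in
  \<open>n\<close>.\<close>

lemma norm_exp_minus_1_le:
  fixes z :: complex
  assumes "Re z \<le> L" "0 \<le> L"
  shows "norm (exp z - 1) \<le> exp L * norm z"
proof -
  have "norm (exp z - exp 0) \<le> exp L * norm (z - 0)"
  proof (rule field_differentiable_bound[where S = "{w. Re w \<le> L}" and f' = exp])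
    show "convex {w. Re w \<le> L}" by (rule convex_halfspace_Re_le)
  qed (use assms in \<open>auto intro: DERIV_subset[OF DERIV_exp]\<close>)
  then show ?thesis by simp
qed

lemma norm_exp_minus_1_minus_le:
  fixes z :: complex
  assumes "Re z \<le> L" "0 \<le> L"
  shows "norm (exp z - 1 - z) \<le> exp L * (norm z)\<^sup>2"
proof -
  \<comment> \<open>Intersecting the half-plane with a ball keeps the set convex and bounds the
    derivative \<open>exp w - 1\<close> by \<open>exp L * norm z\<close>, which supplies the second
    factor \<open>norm z\<close>.\<close>
  have "norm ((exp z - z) - (exp 0 - 0)) \<le> (exp L * norm z) * norm (z - 0)"
  proof (rule field_differentiable_bound[where S = "{w. Re w \<le> L} \<inter> cball 0 (norm z)" and f' = "\<lambda>w. exp w - 1"])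
    show "convex ({w. Re w \<le> L} \<inter> cball 0 (norm z))"
      by (intro convex_Int convex_halfspace_Re_le convex_cball)
    fix w assume w: "w \<in> {w. Re w \<le> L} \<inter> cball 0 (norm z)"
    show "((\<lambda>w. exp w - w) has_field_derivative exp w - 1) (at w within {w. Re w \<le> L} \<inter> cball 0 (norm z))"
      by (auto intro!: derivative_eq_intros)
    have "norm (exp w - 1) \<le> exp L * norm w" using w assms by (intro norm_exp_minus_1_le) auto
    also have "\<dots> \<le> exp L * norm z" using w by (intro mult_left_mono) auto
    finally show "norm (exp w - 1) \<le> exp L * norm z" .
  qed (use assms in auto)
  then show ?thesis by (simp add: power2_eq_square algebra_simps)
qed

lemma exp_minus_bounds:
  fixes x :: real
  assumes "0 \<le> x"
  shows "1 - exp (- x) \<le> x" "x / (1 + x) \<le> 1 - exp (- x)" "\<bar>(1 - exp (- x)) - x\<bar> \<le> x\<^sup>2"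
proof -
  show 1: "1 - exp (- x) \<le> x" using exp_ge_add_one_self[of "- x"] by simp
  have "exp (- x) \<le> 1 / (1 + x)"
    using exp_ge_add_one_self[of x] assms by (simp add: exp_minus field_simps)
  then show 2: "x / (1 + x) \<le> 1 - exp (- x)" using assms by (simp add: field_simps)
  have "x - x / (1 + x) = x\<^sup>2 / (1 + x)" using assms by (simp add: field_simps power2_eq_square)
  also have "\<dots> \<le> x\<^sup>2 / 1" using assms by (intro divide_left_mono) auto
  finally show "\<bar>(1 - exp (- x)) - x\<bar> \<le> x\<^sup>2" using 1 2 by simp
qed

text \<open>With \<open>y = sqrt x\<close> the term is the square of
  \<open>real (Suc m) * y ^ m\<close>. One copy is eventually below \<open>1\<close>, the other is
  summable.\<close>

lemma summable_square_times_power: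
  fixes x :: real
  assumes "0 < x" "x < 1"
  shows "summable (\<lambda>m. (real (Suc m))\<^sup>2 * x ^ m)"
proof -
  define y where "y = sqrt x"
  have y: "0 < y" "y < 1" "y * y = x" using assms by (auto simp: y_def)
  have sum: "summable (\<lambda>m. real (Suc m) * y ^ m)"
    using geometric_deriv_sums[of y] y by (auto simp: summable_def)
  then have "(\<lambda>m. real (Suc m) * y ^ m) \<longlonglongrightarrow> 0" by (rule summable_LIMSEQ_zero)
  then have "\<forall>\<^sub>F m in sequentially. real (Suc m) * y ^ m < 1" by (rule order_tendstoD(2)) simp
  then have "\<forall>\<^sub>F m in sequentially. norm ((real (Suc m))\<^sup>2 * x ^ m) \<le> real (Suc m) * y ^ m"
  proof eventually_elim
    case (elim m)
    have "(real (Suc m))\<^sup>2 * x ^ m = (real (Suc m) * y ^ m) * (real (Suc m) * y ^ m)"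
      by (simp add: power2_eq_square power_mult_distrib flip: y(3))
    also have "\<dots> \<le> real (Suc m) * y ^ m" using elim y by (intro mult_left_le) auto
    finally show ?case using assms by simp
  qed
  then show ?thesis by (rule summable_comparison_test_ev) (rule sum)
qed

text \<open>Each unfolding of \<open>step\<close> moves every point closer to \<open>0\<close> by a
  factor of at most \<open>\<gamma>\<close>. After finitely many unfoldings, their number depending
  on \<open>t\<close>, all points lie where \<open>f\<close> is at most \<open>\<epsilon>\<close>,
  and averaging with weights of total mass \<open>1\<close> preserves this bound.\<close>

lemma average_maximum_principle:
  fixes f :: "real \<Rightarrow> real" and w :: "nat \<Rightarrow> real"
  assumes \<gamma>: "0 < \<gamma>" "\<gamma> < 1" and w: "\<And>m. 0 \<le> w m" "w sums 1"
    and zero: "\<And>\<epsilon>. 0 < \<epsilon> \<Longrightarrow> \<exists>\<delta>>0. \<forall>t. \<bar>t\<bar> < \<delta> \<longrightarrow> f t \<le> \<epsilon>"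
    and sum: "\<And>t. \<bar>t\<bar> \<le> T \<Longrightarrow> summable (\<lambda>m. w m * f (t * \<gamma> ^ Suc m))"
    and step: "\<And>t. \<bar>t\<bar> \<le> T \<Longrightarrow> f t \<le> (\<Sum>m. w m * f (t * \<gamma> ^ Suc m))"
    and t: "\<bar>t\<bar> \<le> T"
  shows "f t \<le> 0"
proof (rule field_le_epsilon)
  fix \<epsilon> :: real assume "0 < \<epsilon>"
  then obtain \<delta> where \<delta>: "\<delta> > 0" "\<And>t. \<bar>t\<bar> < \<delta> \<Longrightarrow> f t \<le> \<epsilon>" using zero by blast
  have claim: "f t \<le> \<epsilon>" if "\<bar>t\<bar> \<le> T" "\<bar>t\<bar> * \<gamma> ^ j < \<delta>" for j t
    using that
  proof (induction j arbitrary: t)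
    case 0
    then show ?case using \<delta> by simp
  next
    case (Suc j)
    have le: "f (t * \<gamma> ^ Suc m) \<le> \<epsilon>" for m
    proof (rule Suc.IH)
      have "\<gamma> ^ Suc m \<le> \<gamma> ^ 1" using \<gamma> by (intro power_decreasing) auto
      then have g: "\<gamma> ^ Suc m \<le> \<gamma>" by simp
      have abs: "\<bar>t * \<gamma> ^ Suc m\<bar> = \<bar>t\<bar> * \<gamma> ^ Suc m" using \<gamma> by (simp add: abs_mult)
      have "\<gamma> ^ Suc m \<le> 1" using \<gamma> by (intro power_le_one) auto
      then have "\<bar>t\<bar> * \<gamma> ^ Suc m \<le> \<bar>t\<bar> * 1" by (intro mult_left_mono) auto
      then show "\<bar>t * \<gamma> ^ Suc m\<bar> \<le> T" using Suc.prems abs by simp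
      have "\<bar>t\<bar> * \<gamma> ^ Suc m * \<gamma> ^ j \<le> \<bar>t\<bar> * \<gamma> * \<gamma> ^ j"
        using g \<gamma> by (intro mult_right_mono mult_left_mono) auto
      then show "\<bar>t * \<gamma> ^ Suc m\<bar> * \<gamma> ^ j < \<delta>" using Suc.prems abs by (simp add: mult.assoc)
    qed
    have "f t \<le> (\<Sum>m. w m * f (t * \<gamma> ^ Suc m))" by (rule step[OF Suc.prems(1)])
    also have "\<dots> \<le> (\<Sum>m. w m * \<epsilon>)"
      using w le by (intro suminf_le sum Suc.prems mult_left_mono summable_mult2) (auto simp: sums_iff)
    also have "\<dots> = \<epsilon>" using sums_mult2[OF w(2), of \<epsilon>] by (simp add: sums_iff)
    finally show ?case .
  qed
  have "(\<lambda>j. \<bar>t\<bar> * \<gamma> ^ j) \<longlonglongrightarrow> \<bar>t\<bar> * 0" using \<gamma> by (intro tendsto_intros LIMSEQ_realpow_zero) auto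
  then have "\<forall>\<^sub>F j in sequentially. \<bar>t\<bar> * \<gamma> ^ j < \<delta>" using \<delta> by (intro order_tendstoD(2)) auto
  then obtain j where "\<bar>t\<bar> * \<gamma> ^ j < \<delta>" by (auto simp: eventually_sequentially)
  with claim t show "f t \<le> 0 + \<epsilon>" by simp
qed

section \<open>Convergence in probability and characteristic functions\<close>

lemma (in prob_space) char_distr:
  "X \<in> borel_measurable M \<Longrightarrow> char (distr M borel X) t = (CLINT \<omega>|M. iexp (t * X \<omega>))"
  by (simp add: char_def integral_distr)

lemma (in prob_space) real_distribution_distr:
  "X \<in> borel_measurable M \<Longrightarrow> real_distribution (distr M borel X)"
  by (simp add: real_distribution_def real_distribution_axioms_def prob_space_distr)

text \<open>The constant \<open>1\<close> is the characteristic function of the point mass at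
  \<open>0\<close>, so the continuity theorem gives weak convergence to it. The set of
  \<open>x\<close> with \<open>\<bar>x\<bar> > e\<close> is a continuity set, because its boundary
  does not contain \<open>0\<close>.\<close>

lemma (in prob_space) tendsto_prob_0_if_char:
  fixes X :: "nat \<Rightarrow> 'a \<Rightarrow> real"
  assumes X: "\<And>n. X n \<in> borel_measurable M"
    and char: "\<And>t. (\<lambda>n. char (distr M borel (X n)) t) \<longlonglongrightarrow> 1"
    and e: "0 < e"
  shows "(\<lambda>n. \<P>(\<omega> in M. \<bar>X n \<omega>\<bar> > e)) \<longlonglongrightarrow> 0"
proof -
  note [measurable] = X
  let ?A = "{x::real. \<bar>x\<bar> > e}"
  have "char (distr M borel (\<lambda>_. 0)) t = 1" for t
    by (subst char_distr) (simp_all add: prob_space)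
  then have wc: "weak_conv_m (\<lambda>n. distr M borel (X n)) (distr M borel (\<lambda>_. 0))"
    using char by (intro levy_continuity real_distribution_distr) auto
  have "closed {x::real. \<bar>x\<bar> \<ge> e}" "open ?A"
    by (intro closed_Collect_le open_Collect_less continuous_intros)+
  then have "frontier ?A \<subseteq> {x. \<bar>x\<bar> \<ge> e} - ?A"
    unfolding frontier_def interior_open[OF \<open>open ?A\<close>]
    by (intro Diff_mono closure_minimal) auto
  then have "0 \<notin> frontier ?A" using e by auto
  then have fr: "emeasure (distr M borel (\<lambda>_. 0)) (frontier ?A) = 0"
    by (simp add: emeasure_return)
  have "(\<lambda>n. measure (distr M borel (X n)) ?A) \<longlonglongrightarrow> measure (distr M borel (\<lambda>_. 0)) ?A"
    by (rule weak_conv_imp_continuity_set_conv[OF real_distribution_distr real_distribution_distr wc _ fr])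
      measurable
  moreover have "measure (distr M borel (X n)) ?A = \<P>(\<omega> in M. \<bar>X n \<omega>\<bar> > e)" for n
    by (subst measure_distr) (auto intro!: arg_cong[where f = prob])
  moreover have "measure (distr M borel (\<lambda>_. 0)) ?A = 0"
    using e by (subst measure_distr) auto
  ultimately show ?thesis by simp
qed

lemma conv_in_probD:
  "conv_in_prob M X Y F \<Longrightarrow> 0 < e \<Longrightarrow> ((\<lambda>i. \<P>(\<omega> in M. \<bar>X i \<omega> - Y \<omega>\<bar> > e)) \<longlongrightarrow> 0) F"
  by (simp add: conv_in_prob_def)

lemma conv_in_prob_filterlim:
  "conv_in_prob M X Y F \<Longrightarrow> filterlim x F G \<Longrightarrow> conv_in_prob M (\<lambda>i. X (x i)) Y G"
  unfolding conv_in_prob_def by (auto intro: filterlim_compose)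

lemma (in prob_space) prob_abs_diff_triangle:
  fixes X Y W :: "'a \<Rightarrow> real"
  assumes [measurable]: "X \<in> borel_measurable M" "Y \<in> borel_measurable M" "W \<in> borel_measurable M"
  shows "\<P>(\<omega> in M. \<bar>X \<omega> - W \<omega>\<bar> > d + e) \<le> \<P>(\<omega> in M. \<bar>X \<omega> - Y \<omega>\<bar> > d) + \<P>(\<omega> in M. \<bar>Y \<omega> - W \<omega>\<bar> > e)"
proof -
  have "\<P>(\<omega> in M. \<bar>X \<omega> - W \<omega>\<bar> > d + e)
      \<le> prob ({\<omega>\<in>space M. \<bar>X \<omega> - Y \<omega>\<bar> > d} \<union> {\<omega>\<in>space M. \<bar>Y \<omega> - W \<omega>\<bar> > e})"
    by (intro finite_measure_mono) auto
  also have "\<dots> \<le> \<P>(\<omega> in M. \<bar>X \<omega> - Y \<omega>\<bar> > d) + \<P>(\<omega> in M. \<bar>Y \<omega> - W \<omega>\<bar> > e)"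
    by (rule measure_Un_le) auto
  finally show ?thesis .
qed

text \<open>Off the event \<open>\<bar>X - Y\<bar> > e\<close> the integrand is at most
  \<open>\<bar>t\<bar> * e\<close> by the Lipschitz bound; on it the trivial bound \<open>2\<close>
  is used.\<close>

lemma (in prob_space) norm_char_diff_le:
  fixes X Y :: "'a \<Rightarrow> real"
  assumes [measurable]: "X \<in> borel_measurable M" "Y \<in> borel_measurable M"
    and e: "0 \<le> e"
  shows "norm (char (distr M borel X) t - char (distr M borel Y) t)
      \<le> \<bar>t\<bar> * e + 2 * \<P>(\<omega> in M. \<bar>X \<omega> - Y \<omega>\<bar> > e)"
proof -
  let ?A = "{\<omega>\<in>space M. \<bar>X \<omega> - Y \<omega>\<bar> > e}"
  have int: "integrable M (\<lambda>\<omega>. iexp (t * X \<omega>))" "integrable M (\<lambda>\<omega>. iexp (t * Y \<omega>))"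
    by (auto intro!: integrable_iexp)
  have "norm (char (distr M borel X) t - char (distr M borel Y) t)
      = norm (CLINT \<omega>|M. iexp (t * X \<omega>) - iexp (t * Y \<omega>))"
    using int by (simp add: char_distr)
  also have "\<dots> \<le> (LINT \<omega>|M. norm (iexp (t * X \<omega>) - iexp (t * Y \<omega>)))"
    by (rule integral_norm_bound)
  also have "\<dots> \<le> (LINT \<omega>|M. \<bar>t\<bar> * e + 2 * indicator ?A \<omega>)"
  proof (rule integral_mono)
    fix \<omega> assume \<omega>: "\<omega> \<in> space M"
    have n2: "norm (iexp (t * X \<omega>) - iexp (t * Y \<omega>)) \<le> 2"
      using norm_triangle_ineq4[of "iexp (t * X \<omega>)" "iexp (t * Y \<omega>)"] by simp
    have "norm (iexp (t * X \<omega>) - iexp (t * Y \<omega>)) \<le> \<bar>t * X \<omega> - t * Y \<omega>\<bar>"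
      by (rule norm_iexp_diff_le)
    also have "\<dots> = \<bar>t\<bar> * \<bar>X \<omega> - Y \<omega>\<bar>" by (simp add: abs_mult flip: right_diff_distrib)
    finally have n1: "norm (iexp (t * X \<omega>) - iexp (t * Y \<omega>)) \<le> \<bar>t\<bar> * \<bar>X \<omega> - Y \<omega>\<bar>" .
    show "norm (iexp (t * X \<omega>) - iexp (t * Y \<omega>)) \<le> \<bar>t\<bar> * e + 2 * indicator ?A \<omega>"
    proof (cases "\<omega> \<in> ?A")
      case True
      moreover have "0 \<le> \<bar>t\<bar> * e" using e by simp
      ultimately show ?thesis using n2 by simp
    next
      case False
      then have "\<bar>t\<bar> * \<bar>X \<omega> - Y \<omega>\<bar> \<le> \<bar>t\<bar> * e" using \<omega> by (intro mult_left_mono) auto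
      with n1 False show ?thesis by simp
    qed
  next
    show "integrable M (\<lambda>\<omega>. \<bar>t\<bar> * e + 2 * indicator ?A \<omega>)"
      by (intro Bochner_Integration.integrable_add integrable_const integrable_mult_right)
        (auto intro!: integrable_real_indicator simp: emeasure_eq_measure)
  qed (use int in \<open>intro integrable_norm Bochner_Integration.integrable_diff\<close>)
  also have "\<dots> = \<bar>t\<bar> * e + 2 * prob ?A"
    by (subst Bochner_Integration.integral_add) (auto simp: prob_space emeasure_eq_measure intro!: integrable_mult_right integrable_real_indicator)
  finally show ?thesis .
qed

lemma (in prob_space) tendsto_char_if_conv_in_prob:
  fixes X :: "nat \<Rightarrow> 'a \<Rightarrow> real"
  assumes conv: "conv_in_prob M X Y sequentially"
    and X: "\<And>n. X n \<in> borel_measurable M" and Y: "Y \<in> borel_measurable M"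
  shows "(\<lambda>n. char (distr M borel (X n)) t) \<longlonglongrightarrow> char (distr M borel Y) t"
proof (rule metric_LIMSEQ_I)
  fix \<epsilon> :: real assume \<epsilon>: "\<epsilon> > 0"
  \<comment> \<open>The first term of the bound then takes at most half of
    \<open>\<epsilon>\<close>; adding \<open>1\<close> to \<open>\<bar>t\<bar>\<close> covers
    \<open>t = 0\<close>.\<close>
  define e where "e = \<epsilon> / (2 * (\<bar>t\<bar> + 1))"
  have e: "e > 0" using \<epsilon> by (simp add: e_def)
  have "\<bar>t\<bar> * e \<le> (\<bar>t\<bar> + 1) * e" using e by simp
  also have "\<dots> = \<epsilon> / 2" by (simp add: e_def field_simps add_pos_nonneg)
  finally have te: "\<bar>t\<bar> * e \<le> \<epsilon> / 2" .
  have "\<forall>\<^sub>F n in sequentially. \<P>(\<omega> in M. \<bar>X n \<omega> - Y \<omega>\<bar> > e) < \<epsilon> / 4"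
    using \<epsilon> by (intro order_tendstoD(2)[OF conv_in_probD[OF conv e]]) auto
  then have "\<forall>\<^sub>F n in sequentially. dist (char (distr M borel (X n)) t) (char (distr M borel Y) t) < \<epsilon>"
  proof eventually_elim
    case (elim n)
    show ?case
      unfolding dist_norm using norm_char_diff_le[OF X[of n] Y, of e t] e te elim by simp
  qed
  then show "\<exists>no. \<forall>n\<ge>no. dist (char (distr M borel (X n)) t) (char (distr M borel Y) t) < \<epsilon>"
    by (simp add: eventually_sequentially)
qed

text \<open>
  The basis \<open>B\<close> makes it possible to pass to sequences, for which smallness in probability can be
  read off characteristic functions.
\<close>

lemma (in prob_space) conv_in_prob_exists:
  fixes X :: "'i \<Rightarrow> 'a \<Rightarrow> real" and B :: "nat \<Rightarrow> 'i set"
  assumes ev: "\<And>P. eventually P F \<longleftrightarrow> (\<exists>n. \<forall>i\<in>B n. P i)"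
    and ne: "\<And>n. B n \<noteq> {}" and dec: "decseq B"
    and meas: "\<And>i. i \<in> B 0 \<Longrightarrow> X i \<in> borel_measurable M"
    and char: "\<And>x y t. (\<And>n. x n \<in> B n) \<Longrightarrow> (\<And>n. y n \<in> B n) \<Longrightarrow>
      (\<lambda>n. char (distr M borel (\<lambda>\<omega>. X (x n) \<omega> - X (y n) \<omega>)) t) \<longlonglongrightarrow> 1"
  shows "\<exists>I\<in>borel_measurable M. conv_in_prob M X I F"
proof -
  have sub: "B n \<subseteq> B m" if "m \<le> n" for m n using dec that by (auto simp: decseq_def)
  have meas': "X i \<in> borel_measurable M" if "i \<in> B n" for i n using that sub[of 0 n] meas by auto
  \<comment> \<open>If this fails at every \<open>n\<close>, the bad pairs form two sequences that
    run through the basis. The hypothesis on characteristic functions applies to them and forces the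
    probabilities to \<open>0\<close>.\<close>
  have cauchy: "\<exists>n. \<forall>i\<in>B n. \<forall>j\<in>B n. \<P>(\<omega> in M. \<bar>X i \<omega> - X j \<omega>\<bar> > e) < \<eta>"
    if e: "0 < e" and \<eta>: "0 < \<eta>" for e \<eta> :: real
  proof (rule ccontr)
    assume "\<not> ?thesis"
    then have "\<forall>n. \<exists>ij. fst ij \<in> B n \<and> snd ij \<in> B n \<and> \<P>(\<omega> in M. \<bar>X (fst ij) \<omega> - X (snd ij) \<omega>\<bar> > e) \<ge> \<eta>"
      by (simp add: not_less) blast
    then obtain f where f: "\<And>n. fst (f n) \<in> B n" "\<And>n. snd (f n) \<in> B n"
      "\<And>n. \<P>(\<omega> in M. \<bar>X (fst (f n)) \<omega> - X (snd (f n)) \<omega>\<bar> > e) \<ge> \<eta>"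
      by metis
    have "(\<lambda>n. \<P>(\<omega> in M. \<bar>X (fst (f n)) \<omega> - X (snd (f n)) \<omega>\<bar> > e)) \<longlonglongrightarrow> 0"
    proof (rule tendsto_prob_0_if_char[OF _ _ e])
      show "(\<lambda>\<omega>. X (fst (f n)) \<omega> - X (snd (f n)) \<omega>) \<in> borel_measurable M" for n
        by (intro borel_measurable_diff meas'[OF f(1)] meas'[OF f(2)])
      show "(\<lambda>n. char (distr M borel (\<lambda>\<omega>. X (fst (f n)) \<omega> - X (snd (f n)) \<omega>)) t) \<longlonglongrightarrow> 1" for t
        by (intro char f)
    qed
    then have "\<eta> \<le> 0" by (rule LIMSEQ_le_const) (use f in auto)
    with \<eta> show False by simp
  qed
  then have "\<forall>k. \<exists>n. \<forall>i\<in>B n. \<forall>j\<in>B n. \<P>(\<omega> in M. \<bar>X i \<omega> - X j \<omega>\<bar> > (1/2) ^ k) < (1/2) ^ k"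
    by simp
  then obtain N where N: "\<And>k i j. i \<in> B (N k) \<Longrightarrow> j \<in> B (N k) \<Longrightarrow>
      \<P>(\<omega> in M. \<bar>X i \<omega> - X j \<omega>\<bar> > (1/2) ^ k) < (1/2) ^ k"
    by metis
  \<comment> \<open>The sum makes \<open>m\<close> monotone and at least \<open>N k\<close>, so
    \<open>x k\<close> and \<open>x (Suc k)\<close> both lie in \<open>B (N k)\<close>; the summand
    \<open>k\<close> makes \<open>B (m k)\<close> shrink along the filter.\<close>
  define m where "m k = k + (\<Sum>i\<le>k. N i)" for k
  have m: "k \<le> m k" "N k \<le> m k" "m k \<le> m (Suc k)" for k
    by (auto simp: m_def intro: trans_le_add2 member_le_sum)
  obtain x where x: "\<And>k. x k \<in> B (m k)"
    using choice[of "\<lambda>k i. i \<in> B (m k)"] ne by auto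
  have [measurable]: "X (x k) \<in> borel_measurable M" for k using x meas' by blast
  have xx: "\<P>(\<omega> in M. \<bar>X (x (Suc k)) \<omega> - X (x k) \<omega>\<bar> > (1/2) ^ k) < (1/2) ^ k" for k
    using x[of k] x[of "Suc k"] sub[OF m(2)[of k]] sub[OF m(3)[of k]] by (intro N) auto
  \<comment> \<open>By the Borel-Cantelli lemma the increments along \<open>x\<close> are almost
    surely eventually below a geometric sequence, so this subsequence converges almost
    surely.\<close>
  have "AE \<omega> in M. \<forall>\<^sub>F k in sequentially. \<omega> \<in> space M - {\<omega>\<in>space M. \<bar>X (x (Suc k)) \<omega> - X (x k) \<omega>\<bar> > (1/2) ^ k}"
  proof (rule borel_cantelli_AE1)
    show "summable (\<lambda>k. \<P>(\<omega> in M. \<bar>X (x (Suc k)) \<omega> - X (x k) \<omega>\<bar> > (1/2) ^ k))"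
      using xx by (intro summable_comparison_test'[OF summable_geometric[of "1/2::real"], of 0])
        (auto intro: less_imp_le)
  qed (auto simp: emeasure_eq_measure)
  then have conv: "AE \<omega> in M. convergent (\<lambda>k. X (x k) \<omega>)"
  proof eventually_elim
    case (elim \<omega>)
    then have "\<forall>\<^sub>F k in sequentially. norm (X (x (Suc k)) \<omega> - X (x k) \<omega>) \<le> (1/2) ^ k"
      by (rule eventually_mono) auto
    then have "summable (\<lambda>k. X (x (Suc k)) \<omega> - X (x k) \<omega>)"
      by (rule summable_comparison_test_ev[OF _ summable_geometric]) auto
    then have "convergent (\<lambda>n. \<Sum>k<n. X (x (Suc k)) \<omega> - X (x k) \<omega>)"
      by (simp add: summable_iff_convergent)
    then have "convergent (\<lambda>n. (X (x n) \<omega> - X (x 0) \<omega>) + X (x 0) \<omega>)"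
      unfolding sum_lessThan_telescope[of "\<lambda>k. X (x k) \<omega>"] by (intro convergent_add convergent_const)
    then show ?case by simp
  qed
  \<comment> \<open>On the null set of divergence the value of \<open>lim\<close> is unspecified,
    which affects no probability.\<close>
  define I where "I \<omega> = lim (\<lambda>k. X (x k) \<omega>)" for \<omega>
  have [measurable]: "I \<in> borel_measurable M" unfolding I_def by measurable
  have I: "(\<lambda>k. \<P>(\<omega> in M. \<bar>X (x k) \<omega> - I \<omega>\<bar> > e)) \<longlonglongrightarrow> 0" if e: "0 < e" for e
  proof -
    have "(\<lambda>k. LINT \<omega>|M. indicator {\<omega>\<in>space M. \<bar>X (x k) \<omega> - I \<omega>\<bar> > e} \<omega> :: real) \<longlonglongrightarrow> (LINT \<omega>|M. 0)"
    proof (rule integral_dominated_convergence[where w = "\<lambda>_. 1"])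
      show "AE \<omega> in M. (\<lambda>k. indicator {\<omega>\<in>space M. \<bar>X (x k) \<omega> - I \<omega>\<bar> > e} \<omega> :: real) \<longlonglongrightarrow> 0"
        using conv
      proof eventually_elim
        case (elim \<omega>)
        then have "(\<lambda>k. X (x k) \<omega>) \<longlonglongrightarrow> I \<omega>" by (simp add: I_def convergent_LIMSEQ_iff)
        then have "\<forall>\<^sub>F k in sequentially. dist (X (x k) \<omega>) (I \<omega>) < e" using e by (rule tendstoD)
        then have "\<forall>\<^sub>F k in sequentially. indicator {\<omega>\<in>space M. \<bar>X (x k) \<omega> - I \<omega>\<bar> > e} \<omega> = (0::real)"
          by eventually_elim (auto simp: dist_real_def)
        then show ?case by (rule tendsto_eventually)
      qed
    qed auto
    then show ?thesis by simp
  qed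
  have "conv_in_prob M X I F"
    unfolding conv_in_prob_def
  proof (intro allI impI, rule tendstoI)
    fix e \<eta> :: real assume e: "e > 0" and \<eta>: "\<eta> > 0"
    obtain n where n: "\<And>i j. i \<in> B n \<Longrightarrow> j \<in> B n \<Longrightarrow> \<P>(\<omega> in M. \<bar>X i \<omega> - X j \<omega>\<bar> > e / 2) < \<eta> / 2"
      using cauchy[of "e / 2" "\<eta> / 2"] e \<eta> by auto
    have "\<forall>\<^sub>F k in sequentially. \<P>(\<omega> in M. \<bar>X (x k) \<omega> - I \<omega>\<bar> > e / 2) < \<eta> / 2"
      using e \<eta> by (intro order_tendstoD(2)[OF I]) auto
    then have "\<forall>\<^sub>F k in sequentially. \<P>(\<omega> in M. \<bar>X (x k) \<omega> - I \<omega>\<bar> > e / 2) < \<eta> / 2 \<and> n \<le> k"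
      using eventually_ge_at_top by (rule eventually_conj)
    then obtain k where k: "\<P>(\<omega> in M. \<bar>X (x k) \<omega> - I \<omega>\<bar> > e / 2) < \<eta> / 2" "n \<le> k"
      using eventually_happens'[OF sequentially_bot] by blast
    have xk: "x k \<in> B n" using x[of k] sub[of n "m k"] k(2) m(1)[of k] by auto
    have "dist (\<P>(\<omega> in M. \<bar>X i \<omega> - I \<omega>\<bar> > e)) 0 < \<eta>" if i: "i \<in> B n" for i
    proof -
      have "\<P>(\<omega> in M. \<bar>X i \<omega> - I \<omega>\<bar> > e / 2 + e / 2)
        \<le> \<P>(\<omega> in M. \<bar>X i \<omega> - X (x k) \<omega>\<bar> > e / 2) + \<P>(\<omega> in M. \<bar>X (x k) \<omega> - I \<omega>\<bar> > e / 2)"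
        using meas'[OF i] by (intro prob_abs_diff_triangle) auto
      then show ?thesis using k(1) n[OF i xk] by (simp add: dist_real_def)
    qed
    then show "\<forall>\<^sub>F i in F. dist (\<P>(\<omega> in M. \<bar>X i \<omega> - I \<omega>\<bar> > e)) 0 < \<eta>"
      unfolding ev by blast
  qed
  then show ?thesis by (intro bexI[of _ I]) auto
qed

section \<open>Refinement of tagged divisions\<close>

text \<open>
  The cells are read as half-open intervals: then degenerate cells are empty and every point of
  \<open>[A, B)\<close> lies in exactly one cell.
\<close>

definition tag_at :: "(real \<times> real set) set \<Rightarrow> real \<Rightarrow> real" where
  "tag_at D v = (SOME x. \<exists>K. (x, K) \<in> D \<and> Inf K \<le> v \<and> v < Sup K)"

lemma tagged_division_real_interval:
  assumes "D tagged_division_of {A..B::real}" "(x, K) \<in> D"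
  shows "K = {Inf K..Sup K}" "Inf K \<le> x" "x \<le> Sup K" "A \<le> Inf K" "Sup K \<le> B"
proof -
  obtain c d where K: "K = {c..d}" using tagged_division_ofD(4)[OF assms] by auto
  have x: "x \<in> K" using tagged_division_ofD(2)[OF assms] .
  then have "c \<le> d" using K by auto
  then have "Inf K = c" "Sup K = d" using K by auto
  moreover have "c \<in> {A..B}" "d \<in> {A..B}"
    using tagged_division_ofD(3)[OF assms] \<open>c \<le> d\<close> K by auto
  ultimately show "K = {Inf K..Sup K}" "Inf K \<le> x" "x \<le> Sup K" "A \<le> Inf K" "Sup K \<le> B"
    using x K by auto
qed

text \<open>Cells are closed, so a cell that contains \<open>v\<close> may end at \<open>v\<close>
  or be degenerate. The cell wanted is one that contains a point \<open>w\<close> to the right of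
  \<open>v\<close> but left of every left endpoint beyond \<open>v\<close>: its own left endpoint
  cannot exceed \<open>v\<close>. Uniqueness follows from disjoint interiors.\<close>

lemma tagged_division_cell_at:
  assumes D: "D tagged_division_of {A..B::real}" and v: "A \<le> v" "v < B"
  shows "\<exists>!xK. xK \<in> D \<and> Inf (snd xK) \<le> v \<and> v < Sup (snd xK)"
proof -
  note I = tagged_division_real_interval[OF D]
  define E where "E = {e \<in> insert B (Inf ` snd ` D). v < e}"
  have E: "finite E" "B \<in> E" using tagged_division_ofD(1)[OF D] v by (auto simp: E_def)
  then have "Min E \<in> E" by (intro Min_in) auto
  then have vm: "v < Min E" by (simp add: E_def)
  have mB: "Min E \<le> B" using E by simp
  define w where "w = (v + Min E) / 2"
  have w: "v < w" "w < Min E" using vm by (simp_all add: w_def)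
  then have "w \<in> {A..B}" using v mB by simp
  then obtain x K where xK: "(x, K) \<in> D" "w \<in> K" using tagged_division_ofD(6)[OF D] by blast
  have wK: "Inf K \<le> w" "w \<le> Sup K" using xK I(1)[OF xK(1)] by auto
  have "Inf K \<le> v"
  proof (rule ccontr)
    assume "\<not> Inf K \<le> v"
    then have "Inf K \<in> E" using xK by (force simp: E_def)
    then have "Min E \<le> Inf K" using E by simp
    then show False using wK w by simp
  qed
  moreover have "v < Sup K" using wK w by simp
  moreover have "(y, L) = (x, K)" if yL: "(y, L) \<in> D" "Inf L \<le> v" "v < Sup L" for y L
  proof (rule ccontr)
    assume "(y, L) \<noteq> (x, K)"
    then have "interior L \<inter> interior K = {}" using tagged_division_ofD(5)[OF D yL(1) xK(1)] by blast
    moreover have "interior L = {Inf L<..<Sup L}" using I(1)[OF yL(1)] interior_atLeastAtMost_real by metis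
    moreover have "interior K = {Inf K<..<Sup K}" using I(1)[OF xK(1)] interior_atLeastAtMost_real by metis
    moreover have "(v + min (Sup L) (Sup K)) / 2 \<in> {Inf L<..<Sup L} \<inter> {Inf K<..<Sup K}"
      using yL \<open>Inf K \<le> v\<close> \<open>v < Sup K\<close> by (auto simp: min_def)
    ultimately show False by blast
  qed
  then have "z = (x, K)" if "z \<in> D \<and> Inf (snd z) \<le> v \<and> v < Sup (snd z)" for z
    using that by (metis prod.collapse)
  ultimately show ?thesis
    using xK(1) by (intro ex1I[of _ "(x, K)"] conjI; simp)
qed

lemma tag_at:
  assumes D: "D tagged_division_of {A..B::real}" and v: "A \<le> v" "v < B"
  shows tag_at_in: "tag_at D v \<in> {A..B}"
    and tag_at_fine: "(\<lambda>x. ball x d) fine D \<Longrightarrow> \<bar>tag_at D v - v\<bar> < d"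
    and sum_cells_at: "(\<Sum>(x, K)\<in>D. if Inf K \<le> v \<and> v < Sup K then F x else 0) = (F (tag_at D v) :: 'c::comm_monoid_add)"
proof -
  obtain z where z: "z \<in> D" "Inf (snd z) \<le> v" "v < Sup (snd z)"
    "\<And>y. y \<in> D \<Longrightarrow> Inf (snd y) \<le> v \<Longrightarrow> v < Sup (snd y) \<Longrightarrow> y = z"
    by (rule ex1E[OF tagged_division_cell_at[OF D v]]) blast
  obtain x K where z_eq: "z = (x, K)" by (cases z)
  have xK: "(x, K) \<in> D" "Inf K \<le> v" "v < Sup K" using z(1-3) by (simp_all add: z_eq)
  have uniq: "(y, L) = (x, K)" if "(y, L) \<in> D" "Inf L \<le> v" "v < Sup L" for y L
    using z(4)[of "(y, L)"] that by (simp add: z_eq)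
  have t: "tag_at D v = x"
    unfolding tag_at_def using xK uniq by (intro some_equality) blast+
  note I = tagged_division_real_interval[OF D xK(1)]
  show "tag_at D v \<in> {A..B}" unfolding t using I by auto
  show "\<bar>tag_at D v - v\<bar> < d" if "(\<lambda>x. ball x d) fine D"
  proof -
    have "v \<in> K" by (subst I(1)) (use xK in auto)
    moreover have "K \<subseteq> ball x d" using that xK(1) by (rule fineD)
    ultimately have "v \<in> ball x d" by blast
    then show ?thesis by (simp add: t dist_real_def)
  qed
  have "(\<Sum>(y, L)\<in>D. if Inf L \<le> v \<and> v < Sup L then F y else 0) = (\<Sum>yL\<in>D. if yL = (x, K) then F x else 0)"
  proof (intro sum.cong refl, clarify)
    fix y L assume "(y, L) \<in> D"
    then show "(if Inf L \<le> v \<and> v < Sup L then F y else 0) = (if (y, L) = (x, K) then F x else 0)"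
      using uniq[of y L] xK(2,3) by (cases "(y, L) = (x, K)") (simp, argo)
  qed
  also have "\<dots> = F x" using xK(1) tagged_division_ofD(1)[OF D] by simp
  finally show "(\<Sum>(x, K)\<in>D. if Inf K \<le> v \<and> v < Sup K then F x else 0) = F (tag_at D v)"
    by (simp add: t)
qed

text \<open>Evaluating \<open>W\<close> at times clamped to \<open>[c, d]\<close> gives a
  telescoping sum. As \<open>c\<close> and \<open>d\<close> are among the points of
  \<open>t\<close>, no step crosses them, so a clamped increment is either the full increment or
  \<open>0\<close>.\<close>

lemma increment_eq_sum:
  fixes W :: "real \<Rightarrow> 'c::ab_group_add"
  assumes t: "incseq t" "t 0 = A" "t n = B" and c: "c \<in> t ` {..n}" "d \<in> t ` {..n}" "c \<le> d"
  shows "W d - W c = (\<Sum>i<n. if c \<le> t i \<and> t i < d then W (t (Suc i)) - W (t i) else 0)"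
proof -
  let ?C = "\<lambda>x. max c (min d x)"
  have mono: "i \<le> j \<Longrightarrow> t i \<le> t j" for i j using t(1) by (simp add: incseqD)
  have jump: "t (Suc i) \<le> e" if "e \<in> t ` {..n}" "t i < e" for e i
  proof -
    from that(1) obtain k where "e = t k" by (rule imageE)
    moreover have "Suc i \<le> k" using that(2) mono[of k i] \<open>e = t k\<close> by (cases "Suc i \<le> k") auto
    ultimately show ?thesis using mono by simp
  qed
  have range: "A \<le> c" "d \<le> B" using c t(2,3) mono by auto
  have "(\<Sum>i<n. if c \<le> t i \<and> t i < d then W (t (Suc i)) - W (t i) else 0)
      = (\<Sum>i<n. W (?C (t (Suc i))) - W (?C (t i)))"
  proof (intro sum.cong refl)
    fix i
    show "(if c \<le> t i \<and> t i < d then W (t (Suc i)) - W (t i) else 0) = W (?C (t (Suc i))) - W (?C (t i))"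
      using jump[OF c(1), of i] jump[OF c(2), of i] mono[of i "Suc i"] c(3)
      by (cases "c = d"; cases "t i < c"; cases "t i < d") (auto simp: max_def min_def)
  qed
  also have "\<dots> = W (?C (t n)) - W (?C (t 0))"
    by (rule sum_lessThan_telescope[of "\<lambda>i. W (?C (t i))"])
  also have "?C (t n) = d" using range c(3) t(3) by (auto simp: max_def min_def)
  also have "?C (t 0) = c" using range c(3) t(2) by (auto simp: max_def min_def)
  finally show ?thesis by simp
qed

text \<open>\<open>W\<close> is kept general because the identity is used twice: with a path of
  \<open>Z\<close> it produces increments that are independent, and with \<open>of_real\<close> it
  carries the resulting exponent back to the original division.\<close>

lemma tagged_division_sum_refine:
  fixes F W :: "real \<Rightarrow> 'c::comm_ring_1"
  assumes D: "D tagged_division_of {A..B}"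
    and t: "incseq t" "t 0 = A" "t n = B" "Inf ` snd ` D \<union> Sup ` snd ` D \<subseteq> t ` {..n}"
  shows "(\<Sum>(x, K)\<in>D. F x * (W (Sup K) - W (Inf K)))
       = (\<Sum>i<n. F (tag_at D (t i)) * (W (t (Suc i)) - W (t i)))"
proof -
  note I = tagged_division_real_interval[OF D]
  have "(\<Sum>(x, K)\<in>D. F x * (W (Sup K) - W (Inf K)))
    = (\<Sum>(x, K)\<in>D. \<Sum>i<n. (if Inf K \<le> t i \<and> t i < Sup K then F x else 0) * (W (t (Suc i)) - W (t i)))"
  proof (intro sum.cong refl, clarify)
    fix x K assume xK: "(x, K) \<in> D"
    then have "Inf K \<in> t ` {..n}" "Sup K \<in> t ` {..n}" using t(4) by force+
    then have "W (Sup K) - W (Inf K)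
      = (\<Sum>i<n. if Inf K \<le> t i \<and> t i < Sup K then W (t (Suc i)) - W (t i) else 0)"
      using I(2,3)[OF xK] by (intro increment_eq_sum[OF t(1-3)]) auto
    then show "F x * (W (Sup K) - W (Inf K))
      = (\<Sum>i<n. (if Inf K \<le> t i \<and> t i < Sup K then F x else 0) * (W (t (Suc i)) - W (t i)))"
      by (auto simp: sum_distrib_left intro!: sum.cong)
  qed
  also have "\<dots> = (\<Sum>i<n. \<Sum>(x, K)\<in>D. (if Inf K \<le> t i \<and> t i < Sup K then F x else 0) * (W (t (Suc i)) - W (t i)))"
    unfolding case_prod_unfold by (rule sum.swap)
  also have "\<dots> = (\<Sum>i<n. F (tag_at D (t i)) * (W (t (Suc i)) - W (t i)))"
  proof (intro sum.cong refl)
    fix i assume i: "i \<in> {..<n}"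
    have le: "A \<le> t i" "t i \<le> t (Suc i)" "t (Suc i) \<le> B" using t(1) i
      unfolding t(2,3)[symmetric] by (auto intro: incseqD)
    have "(\<Sum>(x, K)\<in>D. (if Inf K \<le> t i \<and> t i < Sup K then F x else 0) * (W (t (Suc i)) - W (t i)))
      = (\<Sum>(x, K)\<in>D. if Inf K \<le> t i \<and> t i < Sup K then F x else 0) * (W (t (Suc i)) - W (t i))"
      by (simp add: sum_distrib_right case_prod_unfold)
    also have "\<dots> = F (tag_at D (t i)) * (W (t (Suc i)) - W (t i))"
    proof (cases "t i < B")
      case True
      then show ?thesis by (simp add: sum_cells_at[OF D le(1)])
    next
      \<comment> \<open>At \<open>t i = B\<close> no half-open cell contains the point and
        \<open>tag_at\<close> is meaningless, but the increment over this step vanishes.\<close>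
      case False
      then have "t (Suc i) = t i" using le by simp
      then show ?thesis by simp
    qed
    finally show "(\<Sum>(x, K)\<in>D. (if Inf K \<le> t i \<and> t i < Sup K then F x else 0) * (W (t (Suc i)) - W (t i)))
      = F (tag_at D (t i)) * (W (t (Suc i)) - W (t i))" .
  qed
  finally show ?thesis .
qed

lemma finite_subset_incseq:
  fixes P :: "real set"
  assumes "finite P" "P \<subseteq> {A..B}" "A \<le> B"
  obtains t n where "incseq t" "t 0 = A" "t n = B" "P \<subseteq> t ` {..n}"
proof -
  define L where "L = sorted_list_of_set (insert A (insert B P))"
  define n where "n = length L - 1"
  \<comment> \<open>Freezing the index at \<open>n\<close> extends the finite list to a monotone
    sequence on all of \<open>nat\<close>, the form in which independence of increments is
    stated.\<close>
  define t where "t i = L ! min i n" for i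
  have set: "set L = insert A (insert B P)" using assms(1) unfolding L_def by (subst set_sorted_list_of_set) auto
  then have ne: "L \<noteq> []" by auto
  then have lt: "min i n < length L" for i by (cases L) (auto simp: n_def)
  have sorted: "sorted L" by (simp add: L_def)
  have inc: "incseq t"
    unfolding incseq_def t_def using sorted lt by (auto intro!: sorted_nth_mono)
  have all: "set L \<subseteq> t ` {..n}"
  proof
    fix x assume "x \<in> set L"
    then obtain i where "i < length L" "x = L ! i" by (auto simp: in_set_conv_nth)
    then show "x \<in> t ` {..n}" by (intro image_eqI[of _ _ i]) (auto simp: t_def n_def min_def)
  qed
  have in_L: "t i \<in> {A..B}" for i
    using nth_mem[OF lt[of i]] set assms by (auto simp: t_def)
  obtain i where i: "A = t i" "i \<le> n" using all set by auto
  obtain j where j: "B = t j" "j \<le> n" using all set by auto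
  have "t 0 \<le> A" "B \<le> t n" using incseqD[OF inc] i j by auto
  then have "t 0 = A" "t n = B" using in_L[of 0] in_L[of n] by auto
  with that inc all set show ?thesis by blast
qed

lemma tagged_division_incseq:
  fixes A B :: real
  assumes "finite \<D>" "\<And>D. D \<in> \<D> \<Longrightarrow> D tagged_division_of {A..B}" "A \<le> B"
  obtains t n where "incseq t" "t 0 = A" "t n = B"
    "\<And>D. D \<in> \<D> \<Longrightarrow> Inf ` snd ` D \<union> Sup ` snd ` D \<subseteq> t ` {..n}"
proof -
  have "finite D" if "D \<in> \<D>" for D using assms(2)[OF that] tagged_division_ofD(1) by blast
  then have "finite (\<Union>D\<in>\<D>. Inf ` snd ` D \<union> Sup ` snd ` D)" using assms(1) by auto
  moreover have "(\<Union>D\<in>\<D>. Inf ` snd ` D \<union> Sup ` snd ` D) \<subseteq> {A..B}"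
  proof -
    have "Inf K \<in> {A..B}" "Sup K \<in> {A..B}" if "D \<in> \<D>" "(x, K) \<in> D" for D x K
      using tagged_division_real_interval[OF assms(2)[OF that(1)] that(2)] by auto
    then show ?thesis by auto
  qed
  ultimately obtain t n where "incseq t" "t 0 = A" "t n = B"
    "(\<Union>D\<in>\<D>. Inf ` snd ` D \<union> Sup ` snd ` D) \<subseteq> t ` {..n}"
    using assms(3) by (rule finite_subset_incseq)
  then show ?thesis by (intro that[of t n]) blast+
qed

section \<open>The mesh filter and a countable decreasing basis\<close>

lemma eventually_mesh_filter:
  "eventually P (mesh_filter A B) \<longleftrightarrow>
     (\<exists>d>0. \<forall>D. D tagged_division_of {A..B} \<and> (\<lambda>x. ball x d) fine D \<longrightarrow> P D)"
proof -
  have "eventually P (mesh_filter A B) \<longleftrightarrow>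
    (\<exists>d\<in>{0<..}. eventually P (principal {D. D tagged_division_of {A..B} \<and> (\<lambda>x. ball x d) fine D}))"
    unfolding mesh_filter_def
  proof (rule eventually_INF_base)
    fix c d :: real assume "c \<in> {0<..}" "d \<in> {0<..}"
    moreover have "(\<lambda>x. ball x c) fine D \<and> (\<lambda>x. ball x d) fine D" if "(\<lambda>x. ball x (min c d)) fine D" for D :: "(real \<times> real set) set"
      using that by (fastforce simp: fine_def)
    ultimately show "\<exists>x\<in>{0<..}. principal {D. D tagged_division_of {A..B} \<and> (\<lambda>y. ball y x) fine D}
        \<le> inf (principal {D. D tagged_division_of {A..B} \<and> (\<lambda>x. ball x c) fine D})
              (principal {D. D tagged_division_of {A..B} \<and> (\<lambda>x. ball x d) fine D})"
      by (intro bexI[of _ "min c d"]) auto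
  qed auto
  then show ?thesis by (auto simp: eventually_principal)
qed

definition mesh_basis :: "real \<Rightarrow> real \<Rightarrow> nat \<Rightarrow> (real \<times> real set) set set" where
  "mesh_basis A B n = {D. D tagged_division_of {A..B} \<and> (\<lambda>x. ball x (inverse (real (Suc n)))) fine D}"

lemma eventually_mesh_filter_basis:
  "eventually P (mesh_filter A B) \<longleftrightarrow> (\<exists>n. \<forall>D\<in>mesh_basis A B n. P D)"
proof
  assume "eventually P (mesh_filter A B)"
  then obtain d where d: "d > 0" "\<And>D. D tagged_division_of {A..B} \<Longrightarrow> (\<lambda>x. ball x d) fine D \<Longrightarrow> P D"
    by (auto simp: eventually_mesh_filter)
  obtain n where n: "inverse (real (Suc n)) < d" using reals_Archimedean[OF d(1)] by auto
  have "(\<lambda>x. ball x d) fine D" if "(\<lambda>x. ball x (inverse (real (Suc n)))) fine D" for D :: "(real \<times> real set) set"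
    using that n by (fastforce simp: fine_def)
  with d show "\<exists>n. \<forall>D\<in>mesh_basis A B n. P D" by (intro exI[of _ n]) (auto simp: mesh_basis_def)
next
  assume "\<exists>n. \<forall>D\<in>mesh_basis A B n. P D"
  then obtain n where "\<forall>D\<in>mesh_basis A B n. P D" ..
  then show "eventually P (mesh_filter A B)"
    unfolding eventually_mesh_filter
    by (intro exI[of _ "inverse (real (Suc n))"]) (auto simp: mesh_basis_def)
qed

lemma mesh_basis_decseq: "decseq (mesh_basis A B)"
proof (rule decseq_SucI)
  fix n
  have le: "inverse (real (Suc (Suc n))) \<le> inverse (real (Suc n))" by (simp add: field_simps)
  have "(\<lambda>x. ball x (inverse (real (Suc n)))) fine D" if "(\<lambda>x. ball x (inverse (real (Suc (Suc n))))) fine D" for D :: "(real \<times> real set) set"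
    using that subset_ball[OF le] unfolding fine_def by fast
  then show "mesh_basis A B (Suc n) \<subseteq> mesh_basis A B n" by (auto simp: mesh_basis_def)
qed

lemma mesh_basis_nonempty: "mesh_basis A B n \<noteq> {}"
proof -
  have "gauge (\<lambda>x::real. ball x (inverse (real (Suc n))))" by (rule gauge_ball) simp
  then obtain D where "D tagged_division_of {A..B}" "(\<lambda>x. ball x (inverse (real (Suc n)))) fine D"
    by (rule fine_division_exists_real)
  then show ?thesis by (auto simp: mesh_basis_def)
qed

lemma filterlim_mesh_filter:
  assumes "\<And>n. D n \<in> mesh_basis A B n"
  shows "filterlim D (mesh_filter A B) sequentially"
  unfolding filterlim_iff eventually_mesh_filter_basis
proof clarify
  fix P n assume "\<forall>D\<in>mesh_basis A B n. P D"
  then have "P (D k)" if "n \<le> k" for k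
    using assms[of k] mesh_basis_decseq[of A B] that by (auto simp: decseq_def)
  then show "\<forall>\<^sub>F k in sequentially. P (D k)" unfolding eventually_sequentially by blast
qed

section \<open>Wiener integrals with respect to Levy processes\<close>

locale levy_process_exponent = levy_process M Z for M :: "'b measure" and Z +
  fixes \<psi> :: "real \<Rightarrow> complex"
  assumes cont_\<psi>: "continuous_on UNIV \<psi>" and \<psi>_0: "\<psi> 0 = 0"
    and char_Z: "\<And>u x. 0 \<le> u \<Longrightarrow> char (distr M borel (Z u)) x = exp (of_real u * \<psi> x)"
begin

abbreviation RS :: "(real \<Rightarrow> real) \<Rightarrow> (real \<times> real set) set \<Rightarrow> 'b \<Rightarrow> real" where
  "RS f D \<omega> \<equiv> \<Sum>(x, K)\<in>D. f x * (Z (Sup K) \<omega> - Z (Inf K) \<omega>)"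

lemma RS_measurable:
  assumes "D tagged_division_of {A..B}" "0 \<le> A"
  shows "RS f D \<in> borel_measurable M"
proof -
  have "(\<lambda>\<omega>. \<Sum>xK\<in>D. f (fst xK) * (Z (Sup (snd xK)) \<omega> - Z (Inf (snd xK)) \<omega>)) \<in> borel_measurable M"
  proof (intro borel_measurable_sum borel_measurable_times borel_measurable_const borel_measurable_diff)
    fix xK assume "xK \<in> D"
    then have "(fst xK, snd xK) \<in> D" by simp
    note I = tagged_division_real_interval[OF assms(1) this]
    show "Z (Sup (snd xK)) \<in> borel_measurable M" "Z (Inf (snd xK)) \<in> borel_measurable M"
      using I assms(2) by (auto intro!: rv)
  qed
  then show ?thesis by (simp add: case_prod_unfold)
qed

lemma char_increment_sum:
  assumes t: "incseq t" "0 \<le> t 0"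
  shows "char (distr M borel (\<lambda>\<omega>. \<Sum>i<n. c i * (Z (t (Suc i)) \<omega> - Z (t i) \<omega>))) x
       = exp (\<Sum>i<n. \<psi> (x * c i) * of_real (t (Suc i) - t i))"
proof -
  have t0: "0 \<le> t i" "t i \<le> t (Suc i)" for i using t incseqD[OF t(1), of 0 i] by (auto intro: incseqD)
  have [measurable]: "Z (t i) \<in> borel_measurable M" for i using t0 by (intro rv)
  have "indep_vars (\<lambda>_. borel) (\<lambda>i \<omega>. c i * (Z (t (Suc i)) \<omega> - Z (t i) \<omega>)) {..<n}"
    by (rule indep_vars_compose2[OF indep_increments[OF t(2,1)]]) measurable
  then have "char (distr M borel (\<lambda>\<omega>. \<Sum>i<n. c i * (Z (t (Suc i)) \<omega> - Z (t i) \<omega>))) x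
      = (\<Prod>i<n. char (distr M borel (\<lambda>\<omega>. c i * (Z (t (Suc i)) \<omega> - Z (t i) \<omega>))) x)"
    by (rule char_distr_sum)
  also have "\<dots> = (\<Prod>i<n. exp (\<psi> (x * c i) * of_real (t (Suc i) - t i)))"
  proof (intro prod.cong refl)
    fix i
    have "char (distr M borel (\<lambda>\<omega>. c i * (Z (t (Suc i)) \<omega> - Z (t i) \<omega>))) x
        = char (distr M borel (\<lambda>\<omega>. Z (t (Suc i)) \<omega> - Z (t i) \<omega>)) (x * c i)"
      by (subst (1 2) char_distr) (simp_all add: mult.assoc)
    also have "distr M borel (\<lambda>\<omega>. Z (t (Suc i)) \<omega> - Z (t i) \<omega>) = distr M borel (Z (t (Suc i) - t i))"
      using stationary_increments[of "t i" "t (Suc i) - t i"] t0[of i] by simp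
    also have "char \<dots> (x * c i) = exp (\<psi> (x * c i) * of_real (t (Suc i) - t i))"
      using t0[of i] by (subst char_Z) (simp_all add: mult.commute)
    finally show "char (distr M borel (\<lambda>\<omega>. c i * (Z (t (Suc i)) \<omega> - Z (t i) \<omega>))) x
        = exp (\<psi> (x * c i) * of_real (t (Suc i) - t i))" .
  qed
  also have "\<dots> = exp (\<Sum>i<n. \<psi> (x * c i) * of_real (t (Suc i) - t i))"
    by (rule exp_sum[symmetric]) simp
  finally show ?thesis .
qed

lemma char_RS:
  assumes D: "D tagged_division_of {A..B}" and A: "0 \<le> A" "A \<le> B"
  shows "char (distr M borel (RS f D)) y = exp (\<Sum>(x, K)\<in>D. \<psi> (y * f x) * of_real (Sup K - Inf K))"
proof -
  obtain t n where t: "incseq t" "t 0 = A" "t n = B"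
    "\<And>D'. D' \<in> {D} \<Longrightarrow> Inf ` snd ` D' \<union> Sup ` snd ` D' \<subseteq> t ` {..n}"
    by (rule tagged_division_incseq[of "{D}" A B]) (use D A in auto)
  note R = tagged_division_sum_refine[OF D t(1-3) t(4)[OF singletonI]]
  have "RS f D = (\<lambda>\<omega>. \<Sum>i<n. f (tag_at D (t i)) * (Z (t (Suc i)) \<omega> - Z (t i) \<omega>))"
    using R[of f "\<lambda>v. Z v \<omega>" for \<omega>] by (rule ext)
  then have "char (distr M borel (RS f D)) y
    = exp (\<Sum>i<n. \<psi> (y * f (tag_at D (t i))) * of_real (t (Suc i) - t i))"
    using char_increment_sum[of t "\<lambda>i. f (tag_at D (t i))" n y] t A by simp
  then show ?thesis using R[of "\<lambda>x. \<psi> (y * f x)" of_real] by simp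
qed

text \<open>On a common refinement the difference of the two sums is a sum of increments of
  \<open>Z\<close> with coefficients \<open>c i\<close>, the differences of \<open>f\<close> at two
  tags that are both close to \<open>t i\<close>. Uniform continuity makes all \<open>c i\<close>
  small. The exponent is then at most \<open>B - A\<close> times a bound for \<open>\<psi>\<close>
  near \<open>0\<close>.\<close>

lemma char_RS_diff_tendsto:
  assumes f: "continuous_on {A..B} f" and A: "0 \<le> A" "A \<le> B"
    and D: "\<And>n. D n \<in> mesh_basis A B n" and E: "\<And>n. E n \<in> mesh_basis A B n"
  shows "(\<lambda>n. char (distr M borel (\<lambda>\<omega>. RS f (D n) \<omega> - RS f (E n) \<omega>)) y) \<longlonglongrightarrow> 1"
proof -
  let ?h = "\<lambda>n. 2 * inverse (real (Suc n))"
  \<comment> \<open>The exponent \<open>w\<close> depends on the refinement chosen for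
    \<open>n\<close>. Quantifying over every \<open>\<eta>\<close> inside \<open>P\<close> allows
    \<open>w\<close> to be fixed before the accuracy is known.\<close>
  define P where "P n w \<longleftrightarrow> char (distr M borel (\<lambda>\<omega>. RS f (D n) \<omega> - RS f (E n) \<omega>)) y = exp w \<and>
     (\<forall>\<eta>. (\<forall>u\<in>{A..B}. \<forall>v\<in>{A..B}. \<bar>u - v\<bar> < ?h n \<longrightarrow> norm (\<psi> (y * (f u - f v))) \<le> \<eta>) \<longrightarrow> 0 \<le> \<eta> \<longrightarrow> norm w \<le> (B - A) * \<eta>)"
    for n w
  have "\<exists>w. P n w"
    for n
  proof -
    have D': "D n tagged_division_of {A..B}" "(\<lambda>x. ball x (inverse (real (Suc n)))) fine D n"
      and E': "E n tagged_division_of {A..B}" "(\<lambda>x. ball x (inverse (real (Suc n)))) fine E n"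
      using D[of n] E[of n] by (auto simp: mesh_basis_def)
    obtain t N where t: "incseq t" "t 0 = A" "t N = B"
      "\<And>D'. D' \<in> {D n, E n} \<Longrightarrow> Inf ` snd ` D' \<union> Sup ` snd ` D' \<subseteq> t ` {..N}"
      by (rule tagged_division_incseq[of "{D n, E n}" A B]) (use D' E' A in auto)
    define c where "c i = f (tag_at (D n) (t i)) - f (tag_at (E n) (t i))" for i
    define w where "w = (\<Sum>i<N. \<psi> (y * c i) * of_real (t (Suc i) - t i))"
    have "RS f (D n) \<omega> - RS f (E n) \<omega> = (\<Sum>i<N. c i * (Z (t (Suc i)) \<omega> - Z (t i) \<omega>))" for \<omega>
      using t(4) tagged_division_sum_refine[OF D'(1) t(1-3), of f "\<lambda>v. Z v \<omega>"]
        tagged_division_sum_refine[OF E'(1) t(1-3), of f "\<lambda>v. Z v \<omega>"]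
      by (simp add: c_def left_diff_distrib sum_subtractf)
    then have 1: "char (distr M borel (\<lambda>\<omega>. RS f (D n) \<omega> - RS f (E n) \<omega>)) y = exp w"
      using char_increment_sum[of t c N y] t A by (simp add: w_def)
    have 2: "norm w \<le> (B - A) * \<eta>"
      if \<eta>: "\<forall>u\<in>{A..B}. \<forall>v\<in>{A..B}. \<bar>u - v\<bar> < ?h n \<longrightarrow> norm (\<psi> (y * (f u - f v))) \<le> \<eta>" "0 \<le> \<eta>" for \<eta>
    proof -
      have "norm w \<le> (\<Sum>i<N. \<eta> * (t (Suc i) - t i))"
        unfolding w_def
      proof (rule sum_norm_le)
        fix i assume "i \<in> {..<N}"
        then have ti: "A \<le> t i" "t i \<le> t (Suc i)" "t (Suc i) \<le> B"
          using t(1) unfolding t(2,3)[symmetric] by (auto intro: incseqD)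
        show "norm (\<psi> (y * c i) * of_real (t (Suc i) - t i)) \<le> \<eta> * (t (Suc i) - t i)"
        proof (cases "t i < B")
          case True
          have "\<bar>tag_at (D n) (t i) - tag_at (E n) (t i)\<bar> < ?h n"
            using tag_at_fine[OF D'(1) ti(1) True D'(2)] tag_at_fine[OF E'(1) ti(1) True E'(2)] by linarith
          then have "norm (\<psi> (y * c i)) \<le> \<eta>"
            using \<eta>(1) tag_at_in[OF D'(1) ti(1) True] tag_at_in[OF E'(1) ti(1) True] unfolding c_def by blast
          moreover have "norm (\<psi> (y * c i) * of_real (t (Suc i) - t i)) = norm (\<psi> (y * c i)) * (t (Suc i) - t i)"
            using ti(2) unfolding norm_mult norm_of_real by simp
          ultimately show ?thesis using ti(2) by (simp add: mult_right_mono)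
        next
          case False
          then have "t (Suc i) = t i" using ti by simp
          then show ?thesis by simp
        qed
      qed
      also have "\<dots> = \<eta> * (B - A)"
        using sum_lessThan_telescope[of t N] t(2,3) by (simp flip: sum_distrib_left)
      finally show ?thesis by (simp add: mult.commute)
    qed
    show ?thesis unfolding P_def using 1 2 by (intro exI[of _ w]) blast
  qed
  then have "\<forall>n. \<exists>w. P n w" by blast
  then obtain w where "\<forall>n. P n (w n)" by (rule choice[THEN exE])
  then have w: "\<And>n. char (distr M borel (\<lambda>\<omega>. RS f (D n) \<omega> - RS f (E n) \<omega>)) y = exp (w n)"
    "\<And>n \<eta>. (\<forall>u\<in>{A..B}. \<forall>v\<in>{A..B}. \<bar>u - v\<bar> < ?h n \<longrightarrow> norm (\<psi> (y * (f u - f v))) \<le> \<eta>) \<Longrightarrow>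
       0 \<le> \<eta> \<Longrightarrow> norm (w n) \<le> (B - A) * \<eta>"
    unfolding P_def by blast+
  have "w \<longlonglongrightarrow> 0"
  proof (rule LIMSEQ_I)
    fix \<epsilon> :: real assume \<epsilon>: "\<epsilon> > 0"
    define \<eta> where "\<eta> = \<epsilon> / (B - A + 1)"
    have \<eta>: "\<eta> > 0" "(B - A) * \<eta> < \<epsilon>" using \<epsilon> A by (auto simp: \<eta>_def field_simps)
    have "isCont \<psi> 0" using cont_\<psi> by (simp add: continuous_on_eq_continuous_at)
    then obtain \<delta> where \<delta>: "\<delta> > 0" "\<And>z. \<bar>z\<bar> < \<delta> \<Longrightarrow> norm (\<psi> z) < \<eta>"
      using \<eta>(1) \<psi>_0 by (auto simp: continuous_at_eps_delta dist_norm)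
    have "uniformly_continuous_on {A..B} f" using f by (rule compact_uniformly_continuous) simp
    moreover have "\<delta> / (\<bar>y\<bar> + 1) > 0" using \<delta>(1) by simp
    ultimately obtain \<delta>' where \<delta>': "\<delta>' > 0"
      "\<And>u v. u \<in> {A..B} \<Longrightarrow> v \<in> {A..B} \<Longrightarrow> dist v u < \<delta>' \<Longrightarrow> dist (f v) (f u) < \<delta> / (\<bar>y\<bar> + 1)"
      unfolding uniformly_continuous_on_def by metis
    obtain n0 where n0: "inverse (real (Suc n0)) < \<delta>' / 2" using reals_Archimedean[of "\<delta>' / 2"] \<delta>'(1) by auto
    have "norm (w n - 0) < \<epsilon>" if "n \<ge> n0" for n
    proof -
      have "inverse (real (Suc n)) \<le> inverse (real (Suc n0))" using that by (simp add: field_simps)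
      then have hn: "?h n < \<delta>'" using n0 by linarith
      have "norm (w n) \<le> (B - A) * \<eta>"
      proof (rule w(2), intro ballI impI)
        fix u v assume uv: "u \<in> {A..B}" "v \<in> {A..B}" "\<bar>u - v\<bar> < ?h n"
        then have "\<bar>f u - f v\<bar> < \<delta> / (\<bar>y\<bar> + 1)"
          using \<delta>'(2)[of v u] hn by (simp add: dist_real_def)
        then have "(\<bar>y\<bar> + 1) * \<bar>f u - f v\<bar> < \<delta>"
          by (simp add: field_simps add_pos_nonneg)
        moreover have "\<bar>y * (f u - f v)\<bar> \<le> (\<bar>y\<bar> + 1) * \<bar>f u - f v\<bar>"
          by (simp add: abs_mult mult_right_mono)
        ultimately have "\<bar>y * (f u - f v)\<bar> < \<delta>" by simp
        then show "norm (\<psi> (y * (f u - f v))) \<le> \<eta>" by (intro less_imp_le \<delta>(2))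
      qed (use \<eta> in simp)
      then show ?thesis using \<eta>(2) by simp
    qed
    then show "\<exists>no. \<forall>n\<ge>no. norm (w n - 0) < \<epsilon>" by blast
  qed
  then have "(\<lambda>n. exp (w n)) \<longlonglongrightarrow> exp 0" by (intro tendsto_intros)
  then show ?thesis by (simp add: w(1))
qed

lemma wiener_integral_exists:
  assumes f: "continuous_on {A..B} f" and A: "0 \<le> A" "A \<le> B"
  shows "\<exists>I. has_wiener_integral M Z f A B I"
proof -
  have "\<exists>I\<in>borel_measurable M. conv_in_prob M (RS f) I (mesh_filter A B)"
  proof (rule conv_in_prob_exists[OF eventually_mesh_filter_basis mesh_basis_nonempty mesh_basis_decseq])
    show "RS f D \<in> borel_measurable M" if "D \<in> mesh_basis A B 0" for D
      using that A by (auto simp: mesh_basis_def intro: RS_measurable)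
  qed (rule char_RS_diff_tendsto[OF f A])
  then show ?thesis unfolding has_wiener_integral_def by blast
qed

text \<open>A single sequence of divisions has to serve two limits: the sums in \<open>Z\<close>
  must converge in probability, and the Riemann sums of the exponent must converge to its
  integral.\<close>

lemma char_wiener_integral:
  assumes f: "continuous_on {A..B} f" and A: "0 \<le> A" "A \<le> B"
    and I: "has_wiener_integral M Z f A B I"
  shows "char (distr M borel I) y = exp (integral {A..B} (\<lambda>u. \<psi> (y * f u)))"
proof -
  let ?i = "integral {A..B} (\<lambda>u. \<psi> (y * f u))"
  have "continuous_on {A..B} (\<lambda>u. \<psi> (y * f u))"
    by (intro continuous_on_compose2[OF cont_\<psi>] continuous_intros f) auto
  then have int: "((\<lambda>u. \<psi> (y * f u)) has_integral ?i) {A..B}"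
    by (intro integrable_integral integrable_continuous_real)
  have "\<forall>n. \<exists>D. D \<in> mesh_basis A B n \<and>
    norm ((\<Sum>(x, K)\<in>D. \<psi> (y * f x) * of_real (Sup K - Inf K)) - ?i) < inverse (real (Suc n))"
  proof
    fix n
    have "inverse (real (Suc n)) > 0" by simp
    then obtain \<gamma> where \<gamma>: "gauge \<gamma>"
      "\<And>D. D tagged_division_of {A..B} \<Longrightarrow> \<gamma> fine D \<Longrightarrow>
        norm ((\<Sum>(x, K)\<in>D. measure lborel K *\<^sub>R \<psi> (y * f x)) - ?i) < inverse (real (Suc n))"
      using has_integral_real[THEN iffD1, OF int] by meson
    \<comment> \<open>The gauge \<open>\<gamma>\<close> controls the Riemann sum of the exponent,
      the ball controls the mesh.\<close>
    have "gauge (\<lambda>x. \<gamma> x \<inter> ball x (inverse (real (Suc n))))"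
      by (intro gauge_Int \<gamma> gauge_ball) simp
    then obtain D where D: "D tagged_division_of {A..B}" "(\<lambda>x. \<gamma> x \<inter> ball x (inverse (real (Suc n)))) fine D"
      by (rule fine_division_exists_real)
    then have D': "D \<in> mesh_basis A B n" "\<gamma> fine D" by (auto simp: mesh_basis_def fine_Int)
    have "(\<Sum>(x, K)\<in>D. measure lborel K *\<^sub>R \<psi> (y * f x)) = (\<Sum>(x, K)\<in>D. \<psi> (y * f x) * of_real (Sup K - Inf K))"
    proof (intro sum.cong refl, clarify)
      fix x K assume "(x, K) \<in> D"
      note I = tagged_division_real_interval[OF D(1) this]
      have "measure lborel K = Sup K - Inf K" using I(2,3) by (subst I(1)) simp
      then show "measure lborel K *\<^sub>R \<psi> (y * f x) = \<psi> (y * f x) * of_real (Sup K - Inf K)"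
        by (simp add: scaleR_conv_of_real)
    qed
    then show "\<exists>D. D \<in> mesh_basis A B n \<and>
      norm ((\<Sum>(x, K)\<in>D. \<psi> (y * f x) * of_real (Sup K - Inf K)) - ?i) < inverse (real (Suc n))"
      using \<gamma>(2)[OF D(1) D'(2)] D'(1) by auto
  qed
  from choice[OF this] obtain D where D: "\<And>n. D n \<in> mesh_basis A B n"
    "\<And>n. norm ((\<Sum>(x, K)\<in>D n. \<psi> (y * f x) * of_real (Sup K - Inf K)) - ?i) < inverse (real (Suc n))"
    by blast
  have D': "D n tagged_division_of {A..B}" for n using D(1)[of n] by (simp add: mesh_basis_def)
  have "conv_in_prob M (RS f) I (mesh_filter A B)" using I by (simp add: has_wiener_integral_def)
  then have "conv_in_prob M (\<lambda>n. RS f (D n)) I sequentially"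
    by (rule conv_in_prob_filterlim) (rule filterlim_mesh_filter[OF D(1)])
  then have "(\<lambda>n. char (distr M borel (RS f (D n))) y) \<longlonglongrightarrow> char (distr M borel I) y"
    using I unfolding has_wiener_integral_def
    by (intro tendsto_char_if_conv_in_prob RS_measurable[OF D' A(1)]) auto
  moreover have "(\<lambda>n. (\<Sum>(x, K)\<in>D n. \<psi> (y * f x) * of_real (Sup K - Inf K)) - ?i) \<longlonglongrightarrow> 0"
    by (rule Lim_null_comparison[OF always_eventually LIMSEQ_inverse_real_of_nat])
      (intro allI less_imp_le D(2))
  then have "(\<lambda>n. char (distr M borel (RS f (D n))) y) \<longlonglongrightarrow> exp ?i"
    unfolding char_RS[OF D' A] by (intro tendsto_exp) (rule LIM_zero_cancel)
  ultimately show ?thesis by (rule LIMSEQ_unique)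
qed

text \<open>One fixed fine division \<open>D\<close> of \<open>[0, A]\<close> is glued to every fine
  division \<open>E\<close> of \<open>[A, B]\<close>. The sum over \<open>E\<close> is the sum over
  \<open>D \<union> E\<close> minus the sum over \<open>D\<close>, hence close to
  \<open>J' - J\<close>. This yields the law of \<open>J' - J\<close> from the exponent on
  \<open>[A, B]\<close> alone.\<close>

lemma wiener_integral_diff:
  assumes A: "0 \<le> A" "A \<le> B"
    and J: "has_wiener_integral M Z f 0 A J" and J': "has_wiener_integral M Z f 0 B J'"
  shows "has_wiener_integral M Z f A B (\<lambda>\<omega>. J' \<omega> - J \<omega>)"
  unfolding has_wiener_integral_def
proof (intro conjI)
  have [measurable]: "J \<in> borel_measurable M" "J' \<in> borel_measurable M"
    using J J' by (auto simp: has_wiener_integral_def)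
  then show "(\<lambda>\<omega>. J' \<omega> - J \<omega>) \<in> borel_measurable M" by measurable
  show "conv_in_prob M (RS f) (\<lambda>\<omega>. J' \<omega> - J \<omega>) (mesh_filter A B)"
    unfolding conv_in_prob_def
  proof (intro allI impI, rule tendstoI)
    fix e \<eta> :: real assume e: "e > 0" and \<eta>: "\<eta> > 0"
    have "\<forall>\<^sub>F D in mesh_filter 0 A. \<P>(\<omega> in M. \<bar>RS f D \<omega> - J \<omega>\<bar> > e / 2) < \<eta> / 2"
      using e \<eta> J unfolding has_wiener_integral_def by (intro order_tendstoD(2)[OF conv_in_probD]) auto
    then obtain d1 where d1: "d1 > 0" "\<And>D. D tagged_division_of {0..A} \<Longrightarrow> (\<lambda>x. ball x d1) fine D \<Longrightarrow>
        \<P>(\<omega> in M. \<bar>RS f D \<omega> - J \<omega>\<bar> > e / 2) < \<eta> / 2"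
      unfolding eventually_mesh_filter by blast
    have "\<forall>\<^sub>F D in mesh_filter 0 B. \<P>(\<omega> in M. \<bar>RS f D \<omega> - J' \<omega>\<bar> > e / 2) < \<eta> / 2"
      using e \<eta> J' unfolding has_wiener_integral_def by (intro order_tendstoD(2)[OF conv_in_probD]) auto
    then obtain d2 where d2: "d2 > 0" "\<And>D. D tagged_division_of {0..B} \<Longrightarrow> (\<lambda>x. ball x d2) fine D \<Longrightarrow>
        \<P>(\<omega> in M. \<bar>RS f D \<omega> - J' \<omega>\<bar> > e / 2) < \<eta> / 2"
      unfolding eventually_mesh_filter by blast
    have "gauge (\<lambda>x::real. ball x d1 \<inter> ball x d2)" using d1(1) d2(1) by (intro gauge_Int gauge_ball)
    then obtain D where D: "D tagged_division_of {0..A}" "(\<lambda>x. ball x d1 \<inter> ball x d2) fine D"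
      by (rule fine_division_exists_real)
    then have D1: "(\<lambda>x. ball x d1) fine D" and D2: "(\<lambda>x. ball x d2) fine D" by (auto simp: fine_Int)
    have [measurable]: "RS f D \<in> borel_measurable M" using D(1) by (rule RS_measurable) simp
    have small: "dist (\<P>(\<omega> in M. \<bar>RS f E \<omega> - (J' \<omega> - J \<omega>)\<bar> > e)) 0 < \<eta>"
      if E: "E tagged_division_of {A..B}" "(\<lambda>x. ball x d2) fine E" for E
    proof -
      have [measurable]: "RS f E \<in> borel_measurable M" using E(1) A(1) by (rule RS_measurable)
      have DE: "(D \<union> E) tagged_division_of {0..B}"
      proof -
        have "interior {0..A} \<inter> interior {A..B} = {}" by auto
        then have "(D \<union> E) tagged_division_of ({0..A} \<union> {A..B})" by (rule tagged_division_Un[OF D(1) E(1)])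
        moreover have "{0..A} \<union> {A..B} = {0..B}" using A by auto
        ultimately show ?thesis by simp
      qed
      \<comment> \<open>The only cell that \<open>D\<close> and \<open>E\<close> can share is the
        degenerate one at \<open>A\<close>, whose summand is \<open>0\<close>.\<close>
      have sum: "RS f (D \<union> E) \<omega> = RS f D \<omega> + RS f E \<omega>" for \<omega>
      proof (rule sum.union_inter_neutral)
        show "\<forall>xK\<in>D \<inter> E. (case xK of (x, K) \<Rightarrow> f x * (Z (Sup K) \<omega> - Z (Inf K) \<omega>)) = 0"
        proof clarify
          fix x K assume "(x, K) \<in> D" "(x, K) \<in> E"
          then have "Inf K = A" "Sup K = A"
            using tagged_division_real_interval[OF D(1)] tagged_division_real_interval[OF E(1)]
            by (meson order.antisym order.trans)+
          then show "f x * (Z (Sup K) \<omega> - Z (Inf K) \<omega>) = 0" by simp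
        qed
      qed (use D(1) E(1) in auto)
      have [measurable]: "RS f (D \<union> E) \<in> borel_measurable M" using DE by (rule RS_measurable) simp
      have "\<P>(\<omega> in M. \<bar>RS f E \<omega> - (J' \<omega> - J \<omega>)\<bar> > e)
        \<le> prob ({\<omega>\<in>space M. \<bar>RS f (D \<union> E) \<omega> - J' \<omega>\<bar> > e / 2} \<union> {\<omega>\<in>space M. \<bar>RS f D \<omega> - J \<omega>\<bar> > e / 2})"
      proof (rule finite_measure_mono)
        show "{\<omega>\<in>space M. \<bar>RS f E \<omega> - (J' \<omega> - J \<omega>)\<bar> > e}
          \<subseteq> {\<omega>\<in>space M. \<bar>RS f (D \<union> E) \<omega> - J' \<omega>\<bar> > e / 2} \<union> {\<omega>\<in>space M. \<bar>RS f D \<omega> - J \<omega>\<bar> > e / 2}"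
        proof
          fix \<omega> assume *: "\<omega> \<in> {\<omega>\<in>space M. \<bar>RS f E \<omega> - (J' \<omega> - J \<omega>)\<bar> > e}"
          then have "\<bar>RS f (D \<union> E) \<omega> - J' \<omega>\<bar> > e / 2 \<or> \<bar>RS f D \<omega> - J \<omega>\<bar> > e / 2"
            unfolding sum by (auto simp: abs_real_def split: if_splits)
          with * show "\<omega> \<in> {\<omega>\<in>space M. \<bar>RS f (D \<union> E) \<omega> - J' \<omega>\<bar> > e / 2} \<union> {\<omega>\<in>space M. \<bar>RS f D \<omega> - J \<omega>\<bar> > e / 2}"
            by blast
        qed
      qed measurable
      also have "\<dots> \<le> \<P>(\<omega> in M. \<bar>RS f (D \<union> E) \<omega> - J' \<omega>\<bar> > e / 2) + \<P>(\<omega> in M. \<bar>RS f D \<omega> - J \<omega>\<bar> > e / 2)"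
        by (rule measure_Un_le) measurable
      also have "\<dots> < \<eta>" using d1(2)[OF D(1) D1] d2(2)[OF DE fine_Un[OF D2 E(2)]] by simp
      finally show ?thesis by (simp add: dist_real_def)
    qed
    then show "\<forall>\<^sub>F E in mesh_filter A B. dist (\<P>(\<omega> in M. \<bar>RS f E \<omega> - (J' \<omega> - J \<omega>)\<bar> > e)) 0 < \<eta>"
      unfolding eventually_mesh_filter using d2(1) by blast
  qed
qed

section \<open>Integrals over the half-line\<close>

context
  fixes f :: "real \<Rightarrow> real" and L :: "real \<Rightarrow> complex"
  assumes f: "continuous_on {0..} f"
    and L: "\<And>y. ((\<lambda>A. integral {0..A} (\<lambda>u. \<psi> (y * f u))) \<longlongrightarrow> L y) at_top"
begin

lemma char_wiener_integral_diff:
  assumes A: "0 \<le> A" "A \<le> B"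
    and J: "has_wiener_integral M Z f 0 A J" and J': "has_wiener_integral M Z f 0 B J'"
  shows "char (distr M borel (\<lambda>\<omega>. J' \<omega> - J \<omega>)) y
    = exp (integral {0..B} (\<lambda>u. \<psi> (y * f u)) - integral {0..A} (\<lambda>u. \<psi> (y * f u)))"
proof -
  have "continuous_on {0..B} (\<lambda>u. \<psi> (y * f u))"
    by (intro continuous_on_compose2[OF cont_\<psi>] continuous_intros continuous_on_subset[OF f]) auto
  then have sum: "integral {0..A} (\<lambda>u. \<psi> (y * f u)) + integral {A..B} (\<lambda>u. \<psi> (y * f u)) = integral {0..B} (\<lambda>u. \<psi> (y * f u))"
    by (intro Henstock_Kurzweil_Integration.integral_combine A integrable_continuous_real)
  have "char (distr M borel (\<lambda>\<omega>. J' \<omega> - J \<omega>)) y = exp (integral {A..B} (\<lambda>u. \<psi> (y * f u)))"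
    using A by (intro char_wiener_integral wiener_integral_diff J J' continuous_on_subset[OF f]) auto
  then show ?thesis unfolding sum[symmetric] by simp
qed

lemma wiener_integral_0_infty_exists: "\<exists>I. has_wiener_integral_0_infty M Z f I"
proof -
  have "\<exists>I. has_wiener_integral M Z f 0 A I" if "0 < A" for A
    using that by (intro wiener_integral_exists continuous_on_subset[OF f]) auto
  then obtain J where J: "\<And>A. 0 < A \<Longrightarrow> has_wiener_integral M Z f 0 A (J A)" by metis
  then have J_meas: "J A \<in> borel_measurable M" if "0 < A" for A
    using that unfolding has_wiener_integral_def by blast
  let ?G = "\<lambda>y A. integral {0..A} (\<lambda>u. \<psi> (y * f u))"
  \<comment> \<open>The basis sets below start at \<open>n + 1\<close> because \<open>J A\<close> is
    specified for positive \<open>A\<close> only.\<close>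
  have "\<exists>I\<in>borel_measurable M. conv_in_prob M J I at_top"
  proof (rule conv_in_prob_exists[where B = "\<lambda>n. {real n + 1..}"])
    show "eventually P at_top \<longleftrightarrow> (\<exists>n. \<forall>A\<in>{real n + 1..}. P A)" for P :: "real \<Rightarrow> bool"
    proof
      assume "eventually P at_top"
      then obtain A where A: "\<And>B. B \<ge> A \<Longrightarrow> P B" by (auto simp: eventually_at_top_linorder)
      obtain n where "A \<le> real n" using real_arch_simple by blast
      with A show "\<exists>n. \<forall>A\<in>{real n + 1..}. P A" by (intro exI[of _ n]) auto
    qed (auto simp: eventually_at_top_linorder)
    show "decseq (\<lambda>n. {real n + 1..})" by (rule decseq_SucI) auto
    show "J A \<in> borel_measurable M" if "A \<in> {real 0 + 1..}" for A using that by (intro J_meas) simp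
    fix x y :: "nat \<Rightarrow> real" and t
    assume x: "\<And>n. x n \<in> {real n + 1..}" and y: "\<And>n. y n \<in> {real n + 1..}"
    have pos: "0 < x n" "0 < y n" for n using x[of n] y[of n] by auto
    have le: "real n \<le> x n" "real n \<le> y n" for n using x[of n] y[of n] by auto
    have top: "filterlim x at_top sequentially" "filterlim y at_top sequentially"
      by (rule filterlim_at_top_mono[OF filterlim_real_sequentially always_eventually]; rule allI; rule le)+
    \<comment> \<open>Which of \<open>x n\<close> and \<open>y n\<close> is larger may vary with
      \<open>n\<close>. For \<open>x n < y n\<close> the difference is reversed and evaluated at
      \<open>- t\<close>; the sum of the two bounds covers both cases, and each tends to
      \<open>0\<close> since the integrals of the exponent converge.\<close>
    let ?a = "\<lambda>n. exp (?G t (x n) - ?G t (y n))" and ?b = "\<lambda>n. exp (?G (- t) (y n) - ?G (- t) (x n))"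
    have "?a \<longlonglongrightarrow> exp (L t - L t)" "?b \<longlonglongrightarrow> exp (L (- t) - L (- t))"
      by (intro tendsto_intros filterlim_compose[OF L] top)+
    then have ab: "(\<lambda>n. norm (?a n - 1) + norm (?b n - 1)) \<longlonglongrightarrow> 0"
      by (intro tendsto_add_zero tendsto_norm_zero) (simp_all add: LIM_zero_iff)
    have "(\<lambda>n. char (distr M borel (\<lambda>\<omega>. J (x n) \<omega> - J (y n) \<omega>)) t - 1) \<longlonglongrightarrow> 0"
    proof (rule Lim_null_comparison[OF always_eventually ab], rule allI)
      fix n
      note [measurable] = J_meas[OF pos(1)[of n]] J_meas[OF pos(2)[of n]]
      show "norm (char (distr M borel (\<lambda>\<omega>. J (x n) \<omega> - J (y n) \<omega>)) t - 1) \<le> norm (?a n - 1) + norm (?b n - 1)"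
      proof (cases "y n \<le> x n")
        case True
        then have "char (distr M borel (\<lambda>\<omega>. J (x n) \<omega> - J (y n) \<omega>)) t = ?a n"
          using pos[of n] by (intro char_wiener_integral_diff J) auto
        then show ?thesis by simp
      next
        case False
        have "char (distr M borel (\<lambda>\<omega>. J (x n) \<omega> - J (y n) \<omega>)) t = char (distr M borel (\<lambda>\<omega>. J (y n) \<omega> - J (x n) \<omega>)) (- t)"
          by (subst (1 2) char_distr) (simp_all add: algebra_simps)
        also have "\<dots> = ?b n"
          using pos[of n] False by (intro char_wiener_integral_diff J) auto
        finally show ?thesis by simp
      qed
    qed
    then show "(\<lambda>n. char (distr M borel (\<lambda>\<omega>. J (x n) \<omega> - J (y n) \<omega>)) t) \<longlonglongrightarrow> 1"
      by (simp add: LIM_zero_iff)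
  qed auto
  then show ?thesis unfolding has_wiener_integral_0_infty_def using J by blast
qed

lemma char_wiener_integral_0_infty:
  assumes "has_wiener_integral_0_infty M Z f I"
  shows "char (distr M borel I) y = exp (L y)"
proof -
  obtain J where J: "\<And>A. 0 < A \<Longrightarrow> has_wiener_integral M Z f 0 A (J A)"
    and conv: "conv_in_prob M J I at_top" and I: "I \<in> borel_measurable M"
    using assms unfolding has_wiener_integral_0_infty_def by blast
  have top: "filterlim (\<lambda>n. real (Suc n)) at_top sequentially"
    by (rule filterlim_compose[OF filterlim_real_sequentially filterlim_Suc])
  have "(\<lambda>n. char (distr M borel (J (real (Suc n)))) y) \<longlonglongrightarrow> char (distr M borel I) y"
    using J unfolding has_wiener_integral_def
    by (intro tendsto_char_if_conv_in_prob conv_in_prob_filterlim[OF conv top] I) auto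
  moreover have "char (distr M borel (J (real (Suc n)))) y = exp (integral {0..real (Suc n)} (\<lambda>u. \<psi> (y * f u)))" for n
    by (intro char_wiener_integral J continuous_on_subset[OF f]) auto
  moreover have "(\<lambda>n. exp (integral {0..real (Suc n)} (\<lambda>u. \<psi> (y * f u)))) \<longlonglongrightarrow> exp (L y)"
    by (intro tendsto_exp filterlim_compose[OF L top])
  ultimately show ?thesis by (simp add: LIMSEQ_unique)
qed

end

end

section \<open>The limiting exponent\<close>

locale st_petersburg =
  fixes p q r s a :: real
  assumes p: "0 < p" "p < 1" and q_def: "q = 1 - p" and r_def: "r = 1 / q"
    and s: "0 < s" and a: "0 < a"
begin

abbreviation g :: "real \<Rightarrow> complex" where "g \<equiv> levy_exponent p q r s"

section \<open>The exponent as two one-sided series\<close>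

definition pos_term :: "real \<Rightarrow> nat \<Rightarrow> complex" where
  "pos_term y k = (iexp (y * s * r ^ k) - 1) * of_real (p * q ^ k)"

text \<open>This is the summand of index \<open>- (k + 1)\<close>, with
  \<open>r powi (- (k + 1))\<close> written as \<open>q ^ Suc k\<close> and the weight as
  \<open>r ^ Suc k\<close>.\<close>

definition neg_term :: "real \<Rightarrow> nat \<Rightarrow> complex" where
  "neg_term y k = (iexp (y * s * q ^ Suc k) - 1 - \<i> * of_real (y * s * q ^ Suc k)) * of_real (p * r ^ Suc k)"

definition pos_part :: "real \<Rightarrow> complex" where "pos_part y = (\<Sum>k. pos_term y k)"

definition neg_part :: "real \<Rightarrow> complex" where "neg_part y = (\<Sum>k. neg_term y k)"

text \<open>The ratio \<open>q * r powr (3/4)\<close> of the geometric series for the moment of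
  order \<open>3/4\<close> of the payoff.\<close>

definition \<beta> :: real where "\<beta> = q powr (1/4)"

lemma q: "0 < q" "q < 1" using p q_def by auto

lemma r: "1 < r" "0 < r" "q * r = 1" "r * q = 1" using q by (auto simp: r_def)

lemma \<beta>: "0 < \<beta>" "\<beta> < 1"
  using q using powr_less_mono2[of "1/4" q 1] by (auto simp: \<beta>_def)

lemma q_r_powr: "q ^ k * (r ^ k) powr (3/4) = \<beta> ^ k"
proof -
  have "q ^ k = q powr real k" using q by (simp add: powr_realpow)
  moreover have "(r ^ k) powr (3/4) = q powr (- (real k * (3/4)))"
    using q by (simp add: r_def power_one_over powr_divide powr_minus_divide powr_powr flip: powr_realpow)
  moreover have "\<beta> ^ k = q powr (1/4 * real k)"
    using q \<beta> by (simp add: \<beta>_def powr_powr flip: powr_realpow)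
  ultimately show ?thesis by (simp add: field_simps flip: powr_add)
qed

lemma pos_term_diff_le:
  "norm (pos_term x k - pos_term y k)
     \<le> 2 * p * s powr (3/4) * \<bar>x - y\<bar> powr (3/4) * \<beta> ^ k"
proof -
  have "pos_term x k - pos_term y k = (iexp (x * s * r ^ k) - iexp (y * s * r ^ k)) * of_real (p * q ^ k)"
    by (simp add: pos_term_def algebra_simps)
  then have "norm (pos_term x k - pos_term y k)
     \<le> 2 * \<bar>x * s * r ^ k - y * s * r ^ k\<bar> powr (3/4) * (p * q ^ k)"
    using p q by (simp only: norm_mult norm_of_real) (intro mult_mono norm_iexp_diff_powr_le; simp)
  also have "\<bar>x * s * r ^ k - y * s * r ^ k\<bar> = \<bar>x - y\<bar> * s * r ^ k"
    using s r by (simp add: abs_mult flip: left_diff_distrib)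
  also have "2 * (\<bar>x - y\<bar> * s * r ^ k) powr (3/4) * (p * q ^ k)
    = 2 * p * s powr (3/4) * \<bar>x - y\<bar> powr (3/4) * (q ^ k * (r ^ k) powr (3/4))"
    using s r by (simp add: powr_mult)
  finally show ?thesis by (simp add: q_r_powr)
qed

text \<open>Second-order smallness contributes \<open>(q ^ Suc k)\<^sup>2\<close>. One factor
  cancels the weight \<open>r ^ Suc k\<close>, the other is left to make the series
  geometric.\<close>

lemma neg_term_diff_le:
  "norm (neg_term x k - neg_term y k)
     \<le> 2 * p * s\<^sup>2 * (\<bar>x - y\<bar> * (\<bar>x\<bar> + \<bar>y\<bar>)) * q ^ k"
proof -
  let ?d = "s * q ^ Suc k"
  have d: "?d > 0" using s q by simp
  have "neg_term x k - neg_term y k = ((iexp (x * s * q ^ Suc k) - 1 - \<i> * of_real (x * s * q ^ Suc k))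
      - (iexp (y * s * q ^ Suc k) - 1 - \<i> * of_real (y * s * q ^ Suc k))) * of_real (p * r ^ Suc k)"
    unfolding neg_term_def by (rule left_diff_distrib[symmetric])
  moreover have "\<bar>p * r ^ Suc k\<bar> = p * r ^ Suc k" using p r by simp
  ultimately have "norm (neg_term x k - neg_term y k)
     \<le> 2 * \<bar>x * s * q ^ Suc k - y * s * q ^ Suc k\<bar> * (\<bar>x * s * q ^ Suc k\<bar> + \<bar>y * s * q ^ Suc k\<bar>) * (p * r ^ Suc k)"
    using p r by (simp only: norm_mult norm_of_real) (intro mult_right_mono norm_iexp_minus_linear_diff_le; simp)
  also have "\<bar>x * s * q ^ Suc k - y * s * q ^ Suc k\<bar> = \<bar>x - y\<bar> * ?d"
    by (simp only: mult.assoc left_diff_distrib[symmetric] abs_mult[of "x - y"] abs_of_pos[OF d])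
  also have "\<bar>x * s * q ^ Suc k\<bar> + \<bar>y * s * q ^ Suc k\<bar> = (\<bar>x\<bar> + \<bar>y\<bar>) * ?d"
    using d s q by (simp add: abs_mult algebra_simps)
  also have "2 * (\<bar>x - y\<bar> * ?d) * ((\<bar>x\<bar> + \<bar>y\<bar>) * ?d) * (p * r ^ Suc k)
    = 2 * p * s\<^sup>2 * (\<bar>x - y\<bar> * (\<bar>x\<bar> + \<bar>y\<bar>)) * q ^ Suc k * (q ^ Suc k * r ^ Suc k)"
    by (simp add: power2_eq_square algebra_simps)
  also have "q ^ Suc k * r ^ Suc k = 1" using r by (metis power_mult_distrib power_one)
  also have "2 * p * s\<^sup>2 * (\<bar>x - y\<bar> * (\<bar>x\<bar> + \<bar>y\<bar>)) * q ^ Suc k * 1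
     \<le> 2 * p * s\<^sup>2 * (\<bar>x - y\<bar> * (\<bar>x\<bar> + \<bar>y\<bar>)) * q ^ k"
    using p q by (simp add: mult_left_mono mult_left_le_one_le)
  finally show ?thesis .
qed

lemma pos_term_le:
  "norm (pos_term x k)
     \<le> 2 * p * s powr (3/4) * \<bar>x\<bar> powr (3/4) * \<beta> ^ k"
  using pos_term_diff_le[of x k 0] by (simp add: pos_term_def)

lemma neg_term_le:
  "norm (neg_term x k)
     \<le> 2 * p * s\<^sup>2 * x\<^sup>2 * q ^ k"
  using neg_term_diff_le[of x k 0] by (simp add: power2_eq_square neg_term_def)

lemma summable_pos_norm: "summable (\<lambda>k. norm (pos_term x k))"
proof (rule summable_comparison_test'[OF summable_mult])
  show "summable (\<lambda>k. \<beta> ^ k)" using \<beta> by (simp add: summable_geometric)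
qed (use pos_term_le in auto)

lemma summable_neg_norm:
  "summable (\<lambda>k. norm (neg_term x k))"
proof (rule summable_comparison_test'[OF summable_mult])
  show "summable (\<lambda>k. q ^ k)" using q by (simp add: summable_geometric)
qed (use neg_term_le in auto)

lemmas summable_pos = summable_norm_cancel[OF summable_pos_norm]
lemmas summable_neg = summable_norm_cancel[OF summable_neg_norm]

lemma levy_exponent_eq: "g y = pos_part y + neg_part y"
proof -
  define \<xi> where "\<xi> k = (exp (\<i> * complex_of_real (y * s * r powi k)) - 1
           - \<i> * complex_of_real (y * s * r powi k * (if k < 0 then 1 else 0)))
        * complex_of_real (p * q powi k)" for k :: int
  have A: "(\<xi> has_sum pos_part y) (range int)"
  proof (subst has_sum_reindex)
    show "((\<xi> \<circ> int) has_sum pos_part y) UNIV"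
    proof (rule norm_summable_imp_has_sum)
      show "summable (\<lambda>n. norm ((\<xi> \<circ> int) n))"
        using summable_pos_norm[of y] by (simp add: \<xi>_def pos_term_def)
      show "(\<xi> \<circ> int) sums pos_part y"
        using summable_sums[OF summable_pos[of y]] by (simp add: \<xi>_def pos_part_def pos_term_def o_def)
    qed
  qed simp
  have B: "(\<xi> has_sum neg_part y) (range (\<lambda>k. - int (Suc k)))"
  proof (subst has_sum_reindex)
    have qr: "r powi (- int (Suc k)) = q ^ Suc k" "q powi (- int (Suc k)) = r ^ Suc k" for k
      unfolding power_int_minus power_int_of_nat using q
      by (simp_all add: r_def power_one_over field_simps)
    have e: "(\<xi> \<circ> (\<lambda>k. - int (Suc k))) = neg_term y"
      unfolding o_def \<xi>_def qr neg_term_def by (rule ext) simp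
    show "((\<xi> \<circ> (\<lambda>k. - int (Suc k))) has_sum neg_part y) UNIV"
      unfolding e neg_part_def
      by (intro norm_summable_imp_has_sum summable_neg_norm summable_sums summable_neg)
  qed (auto simp: inj_on_def)
  have "(\<xi> has_sum (pos_part y + neg_part y)) (range int \<union> range (\<lambda>k. - int (Suc k)))"
    using A B by (rule has_sum_Un_disjoint) auto
  also have "range int \<union> range (\<lambda>k. - int (Suc k)) = UNIV"
  proof -
    have "x \<in> range int \<union> range (\<lambda>k. - int (Suc k))" for x
      by (cases x rule: int_cases) auto
    then show ?thesis by auto
  qed
  finally show ?thesis
    unfolding levy_exponent_def \<xi>_def by (rule infsumI)
qed

section \<open>Growth and Hoelder continuity of the exponent\<close>

lemma neg_part_le: "\<exists>C\<ge>0. \<forall>y. norm (neg_part y) \<le> C * y\<^sup>2"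
proof (intro exI[of _ "2 * p * s\<^sup>2 * (1 / (1 - q))"] conjI allI)
  fix y :: real
  have "norm (neg_part y) \<le> (\<Sum>k. 2 * p * s\<^sup>2 * y\<^sup>2 * q ^ k)"
    unfolding neg_part_def using q
    by (intro norm_suminf_le neg_term_le summable_mult summable_geometric) auto
  also have "\<dots> = 2 * p * s\<^sup>2 * y\<^sup>2 * (1 / (1 - q))"
    using q by (subst suminf_mult) (auto simp: summable_geometric suminf_geometric)
  finally show "norm (neg_part y) \<le> 2 * p * s\<^sup>2 * (1 / (1 - q)) * y\<^sup>2" by (simp add: mult_ac)
qed (use p q in auto)

text \<open>The fractional power comes from the nonnegative indices, where only a moment of order
  below \<open>1\<close> is finite; the product comes from the compensated negative indices.\<close>

lemma levy_exponent_diff_le: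
  "\<exists>C\<ge>0. \<forall>x y. norm (g x - g y) \<le> C * (\<bar>x - y\<bar> powr (3/4) + \<bar>x - y\<bar> * (\<bar>x\<bar> + \<bar>y\<bar>))"
proof -
  define C1 where "C1 = 2 * p * s powr (3/4) * (1 / (1 - \<beta>))"
  define C2 where "C2 = 2 * p * s\<^sup>2 * (1 / (1 - q))"
  have C: "C1 \<ge> 0" "C2 \<ge> 0" using p q \<beta> by (auto simp: C1_def C2_def)
  have 1: "norm (pos_part x - pos_part y) \<le> C1 * \<bar>x - y\<bar> powr (3/4)" for x y
  proof -
    have "norm (pos_part x - pos_part y) \<le> (\<Sum>k. 2 * p * s powr (3/4) * \<bar>x - y\<bar> powr (3/4) * \<beta> ^ k)"
      unfolding pos_part_def suminf_diff[OF summable_pos summable_pos] using \<beta>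
      by (intro norm_suminf_le pos_term_diff_le summable_mult summable_geometric) auto
    also have "\<dots> = 2 * p * s powr (3/4) * \<bar>x - y\<bar> powr (3/4) * (1 / (1 - \<beta>))"
      using \<beta> by (subst suminf_mult) (auto simp: summable_geometric suminf_geometric)
    finally show ?thesis by (simp add: C1_def mult_ac)
  qed
  have 2: "norm (neg_part x - neg_part y) \<le> C2 * (\<bar>x - y\<bar> * (\<bar>x\<bar> + \<bar>y\<bar>))" for x y
  proof -
    have "norm (neg_part x - neg_part y) \<le> (\<Sum>k. 2 * p * s\<^sup>2 * (\<bar>x - y\<bar> * (\<bar>x\<bar> + \<bar>y\<bar>)) * q ^ k)"
      unfolding neg_part_def suminf_diff[OF summable_neg summable_neg] using q
      by (intro norm_suminf_le neg_term_diff_le summable_mult summable_geometric) auto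
    also have "\<dots> = 2 * p * s\<^sup>2 * (\<bar>x - y\<bar> * (\<bar>x\<bar> + \<bar>y\<bar>)) * (1 / (1 - q))"
      using q by (subst suminf_mult) (auto simp: summable_geometric suminf_geometric)
    finally show ?thesis by (simp add: C2_def mult_ac)
  qed
  show ?thesis
  proof (intro exI[of _ "C1 + C2"] conjI allI)
    fix x y :: real
    let ?u = "\<bar>x - y\<bar> powr (3/4)" and ?v = "\<bar>x - y\<bar> * (\<bar>x\<bar> + \<bar>y\<bar>)"
    have "norm (g x - g y) \<le> norm (pos_part x - pos_part y) + norm (neg_part x - neg_part y)"
      unfolding levy_exponent_eq by (metis add_diff_add norm_triangle_ineq)
    also have "\<dots> \<le> C1 * ?u + C2 * ?v" using 1 2 by (intro add_mono)
    also have "\<dots> \<le> C1 * (?u + ?v) + C2 * (?u + ?v)"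
      using C by (intro add_mono mult_left_mono) auto
    finally show "norm (g x - g y) \<le> (C1 + C2) * (?u + ?v)" by (simp add: algebra_simps)
  qed (use C in auto)
qed

lemma levy_exponent_0 [simp]: "g 0 = 0"
  by (simp add: levy_exponent_def)

lemma levy_exponent_holder:
  "\<exists>C\<ge>0. \<forall>x y. \<bar>x\<bar> \<le> T \<longrightarrow> \<bar>y\<bar> \<le> T \<longrightarrow> norm (g x - g y) \<le> C * \<bar>x - y\<bar> powr (3/4)"
proof -
  obtain C where C: "C \<ge> 0"
    "\<And>x y. norm (g x - g y) \<le> C * (\<bar>x - y\<bar> powr (3/4) + \<bar>x - y\<bar> * (\<bar>x\<bar> + \<bar>y\<bar>))"
    using levy_exponent_diff_le by blast
  show ?thesis
  proof (intro exI[of _ "C * (1 + (2 * \<bar>T\<bar>) powr (1/4) * (2 * \<bar>T\<bar>))"] conjI allI impI)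
    fix x y :: real assume T: "\<bar>x\<bar> \<le> T" "\<bar>y\<bar> \<le> T"
    have "\<bar>x - y\<bar> \<le> (2 * \<bar>T\<bar>) powr (1/4) * \<bar>x - y\<bar> powr (3/4)"
      using T by (intro powr_le_on_bounded) auto
    then have "\<bar>x - y\<bar> * (\<bar>x\<bar> + \<bar>y\<bar>) \<le> (2 * \<bar>T\<bar>) powr (1/4) * \<bar>x - y\<bar> powr (3/4) * (2 * \<bar>T\<bar>)"
      using T by (intro mult_mono) auto
    then have "C * (\<bar>x - y\<bar> powr (3/4) + \<bar>x - y\<bar> * (\<bar>x\<bar> + \<bar>y\<bar>))
      \<le> C * (\<bar>x - y\<bar> powr (3/4) + (2 * \<bar>T\<bar>) powr (1/4) * \<bar>x - y\<bar> powr (3/4) * (2 * \<bar>T\<bar>))"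
      using C by (intro mult_left_mono add_mono) auto
    with C(2)[of x y]
    show "norm (g x - g y) \<le> C * (1 + (2 * \<bar>T\<bar>) powr (1/4) * (2 * \<bar>T\<bar>)) * \<bar>x - y\<bar> powr (3/4)"
      by (simp add: algebra_simps)
  qed (use C in auto)
qed

lemma isCont_levy_exponent: "isCont g x"
proof -
  obtain C where C: "C \<ge> 0"
    "\<And>x y. norm (g x - g y) \<le> C * (\<bar>x - y\<bar> powr (3/4) + \<bar>x - y\<bar> * (\<bar>x\<bar> + \<bar>y\<bar>))"
    using levy_exponent_diff_le by blast
  have "((\<lambda>y. C * (\<bar>y - x\<bar> powr (3/4) + \<bar>y - x\<bar> * (\<bar>y\<bar> + \<bar>x\<bar>))) \<longlongrightarrow>
     C * (\<bar>x - x\<bar> powr (3/4) + \<bar>x - x\<bar> * (\<bar>x\<bar> + \<bar>x\<bar>))) (at x)"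
    by (intro tendsto_intros tendsto_powr') auto
  then have "((\<lambda>y. C * (\<bar>y - x\<bar> powr (3/4) + \<bar>y - x\<bar> * (\<bar>y\<bar> + \<bar>x\<bar>))) \<longlongrightarrow> 0) (at x)"
    by simp
  then have "((\<lambda>y. g y - g x) \<longlongrightarrow> 0) (at x)"
    by (rule Lim_null_comparison[rotated]) (use C in auto)
  then show ?thesis unfolding isCont_def using LIM_zero_iff by blast
qed

lemma continuous_on_levy_exponent [continuous_intros]:
  "continuous_on A f \<Longrightarrow> continuous_on A (\<lambda>x. g (f x))"
  using continuous_on_compose2[of UNIV g A f] isCont_levy_exponent
  by (auto simp: continuous_on_eq_continuous_at)

section \<open>Scaling relations of the exponent\<close>

lemma pos_term_scale: "pos_term (q * t) (Suc k) = of_real q * pos_term t k"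
proof -
  have "q * t * s * r ^ Suc k = t * s * r ^ k * (q * r)" by (simp add: mult_ac)
  then have *: "q * t * s * r ^ Suc k = t * s * r ^ k" using r by simp
  show ?thesis unfolding pos_term_def * by (simp add: mult_ac)
qed

lemma neg_term_scale: "of_real q * neg_term t (Suc k) = neg_term (q * t) k"
proof -
  have "q * (p * r ^ Suc (Suc k)) = (q * r) * (p * r ^ Suc k)" by (simp add: mult_ac)
  then have *: "q * (p * r ^ Suc (Suc k)) = p * r ^ Suc k" using r by simp
  have "of_real q * neg_term t (Suc k) = (iexp (t * s * q ^ Suc (Suc k)) - 1
      - \<i> * of_real (t * s * q ^ Suc (Suc k))) * of_real (q * (p * r ^ Suc (Suc k)))"
    unfolding neg_term_def by (simp only: of_real_mult mult_ac)
  then show ?thesis unfolding * neg_term_def by (simp add: mult_ac)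
qed

text \<open>A shift of the index multiplies all weights by \<open>q\<close>. Only one term changes
  its compensator: index \<open>- 1\<close> of \<open>g t\<close> is compensated, while it becomes
  the uncompensated index \<open>0\<close> of \<open>g (q * t)\<close>. Since
  \<open>q * r = 1\<close>, the discrepancy is the linear term shown.\<close>

lemma levy_exponent_scale: "g (q * t) = of_real q * (g t + \<i> * of_real (t * s * p))"
proof -
  have "pos_part (q * t) = (\<Sum>k. pos_term (q * t) (Suc k)) + pos_term (q * t) 0"
    unfolding pos_part_def using suminf_split_head[OF summable_pos[of "q * t"]] by simp
  also have "(\<Sum>k. pos_term (q * t) (Suc k)) = of_real q * pos_part t"
    unfolding pos_part_def pos_term_scale by (rule suminf_mult[OF summable_pos])
  finally have 1: "pos_part (q * t) = of_real q * pos_part t + (iexp (q * t * s) - 1) * p"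
    by (simp add: pos_term_def)
  have "neg_part t = (\<Sum>k. neg_term t (Suc k)) + neg_term t 0"
    unfolding neg_part_def using suminf_split_head[OF summable_neg[of t]] by simp
  moreover have "summable (\<lambda>k. neg_term t (Suc k))"
    using summable_neg[of t, THEN summable_ignore_initial_segment, of 1] by simp
  then have "of_real q * (\<Sum>k. neg_term t (Suc k)) = neg_part (q * t)"
    unfolding neg_part_def by (simp only: suminf_mult[symmetric] neg_term_scale)
  ultimately have "of_real q * neg_part t = neg_part (q * t) + of_real q * neg_term t 0"
    by (simp add: distrib_left)
  moreover have "of_real q * neg_term t 0
      = (iexp (q * t * s) - 1 - \<i> * of_real (q * t * s)) * of_real ((q * r) * p)"
    by (simp add: neg_term_def mult_ac)
  ultimately have 2: "neg_part (q * t) = of_real q * neg_part t - (iexp (q * t * s) - 1 - \<i> * of_real (q * t * s)) * p"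
    using r by simp
  show ?thesis unfolding levy_exponent_eq 1 2 by (simp add: algebra_simps)
qed

text \<open>Each of the \<open>n\<close> scalings contributes one copy of the linear term. The
  accumulated factor \<open>n\<close> is what the centering of the sum has to remove.\<close>

lemma levy_exponent_scale_power:
  "g (q ^ n * t) = of_real (q ^ n) * (g t + \<i> * of_real (n * t * s * p))"
proof (induction n)
  case (Suc n)
  have "g (q ^ Suc n * t) = g (q * (q ^ n * t))" by (simp add: mult_ac)
  then show ?case unfolding levy_exponent_scale Suc by (simp add: algebra_simps)
qed simp

section \<open>The exponent integrated along the discount curve\<close>

abbreviation \<phi> :: "real \<Rightarrow> real" where "\<phi> u \<equiv> exp (- a * u)"

definition G :: "real \<Rightarrow> real \<Rightarrow> complex" where
  "G t A = integral {0..A} (\<lambda>u. g (t * \<phi> u))"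

text \<open>The limit is taken along the integers first; \<open>G_tendsto_H\<close> extends it to
  real upper limits.\<close>

definition H :: "real \<Rightarrow> complex" where
  "H t = lim (\<lambda>n. G t (real n))"

definition \<kappa> :: real where "\<kappa> = 3/4 * a"

lemma \<kappa>: "0 < \<kappa>" using a by (simp add: \<kappa>_def)

lemma \<phi>_powr: "\<phi> u powr (3/4) = exp (- \<kappa> * u)"
  by (simp add: powr_def \<kappa>_def)

lemma integrable_levy_exponent_\<phi>: "(\<lambda>u. g (t * \<phi> u)) integrable_on {A..B}"
  by (intro integrable_continuous_real continuous_intros)

lemma levy_exponent_bound:
  "\<exists>C\<ge>0. \<forall>x. \<bar>x\<bar> \<le> T \<longrightarrow> norm (g x) \<le> C * \<bar>x\<bar> powr (3/4)"
proof -
  obtain C where "C \<ge> 0" "\<And>x y. \<bar>x\<bar> \<le> \<bar>T\<bar> \<Longrightarrow> \<bar>y\<bar> \<le> \<bar>T\<bar> \<Longrightarrow> norm (g x - g y) \<le> C * \<bar>x - y\<bar> powr (3/4)"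
    using levy_exponent_holder[of "\<bar>T\<bar>"] by blast
  from this(1) this(2)[of _ 0] show ?thesis by (intro exI[of _ C]) force
qed

lemma has_integral_exp_\<kappa>:
  assumes "A \<le> B"
  shows "((\<lambda>u. exp (- \<kappa> * u)) has_integral (exp (- \<kappa> * A) - exp (- \<kappa> * B)) / \<kappa>) {A..B}"
proof -
  have "((\<lambda>u. exp (- \<kappa> * u)) has_integral (- exp (- \<kappa> * B) / \<kappa>) - (- exp (- \<kappa> * A) / \<kappa>)) {A..B}"
    using \<kappa> assms
    by (intro fundamental_theorem_of_calculus)
       (auto intro!: derivative_eq_intros simp flip: has_real_derivative_iff_has_vector_derivative)
  then show ?thesis by (simp add: diff_divide_distrib)
qed

text \<open>The bound is uniform in \<open>B\<close>, so it gives both the existence of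
  \<open>H t\<close> and the rate of convergence of \<open>G t A\<close>; at \<open>A = 0\<close> it
  shows that \<open>H t\<close> is \<open>O(\<bar>t\<bar> powr (3/4))\<close>.\<close>

lemma integral_levy_exponent_\<phi>_le:
  "\<exists>C\<ge>0. \<forall>t A B. \<bar>t\<bar> \<le> T \<longrightarrow> 0 \<le> A \<longrightarrow> A \<le> B \<longrightarrow>
     norm (integral {A..B} (\<lambda>u. g (t * \<phi> u))) \<le> C * \<bar>t\<bar> powr (3/4) * exp (- \<kappa> * A)"
proof -
  obtain C where C: "C \<ge> 0" "\<And>x. \<bar>x\<bar> \<le> T \<Longrightarrow> norm (g x) \<le> C * \<bar>x\<bar> powr (3/4)"
    using levy_exponent_bound[of T] by blast
  show ?thesis
  proof (intro exI[of _ "C / \<kappa>"] conjI allI impI)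
    fix t A B :: real assume t: "\<bar>t\<bar> \<le> T" and AB: "0 \<le> A" "A \<le> B"
    let ?K = "C * \<bar>t\<bar> powr (3/4)"
    have I: "((\<lambda>u. ?K * exp (- \<kappa> * u)) has_integral ?K * ((exp (- \<kappa> * A) - exp (- \<kappa> * B)) / \<kappa>)) {A..B}"
      by (intro has_integral_mult_right has_integral_exp_\<kappa> AB)
    have "norm (integral {A..B} (\<lambda>u. g (t * \<phi> u))) \<le> integral {A..B} (\<lambda>u. ?K * exp (- \<kappa> * u))"
    proof (rule integral_norm_bound_integral)
      fix u assume u: "u \<in> {A..B}"
      then have "\<phi> u \<le> 1" using AB a by simp
      then have "\<bar>t * \<phi> u\<bar> \<le> \<bar>t\<bar>" by (simp add: abs_mult mult_left_le)
      then have "norm (g (t * \<phi> u)) \<le> C * \<bar>t * \<phi> u\<bar> powr (3/4)" using t by (intro C) auto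
      also have "\<dots> = ?K * exp (- \<kappa> * u)"
        by (simp only: abs_mult abs_exp_cancel) (simp only: powr_mult \<phi>_powr mult.assoc)
      finally show "norm (g (t * \<phi> u)) \<le> ?K * exp (- \<kappa> * u)" .
    qed (use I integrable_levy_exponent_\<phi> in auto)
    also have "\<dots> = ?K * ((exp (- \<kappa> * A) - exp (- \<kappa> * B)) / \<kappa>)"
      using I by (rule integral_unique)
    also have "\<dots> \<le> ?K * (exp (- \<kappa> * A) / \<kappa>)"
      using C \<kappa> by (intro mult_left_mono divide_right_mono) auto
    finally show "norm (integral {A..B} (\<lambda>u. g (t * \<phi> u))) \<le> C / \<kappa> * \<bar>t\<bar> powr (3/4) * exp (- \<kappa> * A)"
      by simp
  qed (use C \<kappa> in auto)
qed

lemma G_diff: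
  assumes "0 \<le> A" "A \<le> B"
  shows "G t B - G t A = integral {A..B} (\<lambda>u. g (t * \<phi> u))"
  using Henstock_Kurzweil_Integration.integral_combine[OF assms integrable_levy_exponent_\<phi>[of t]]
  by (simp add: G_def algebra_simps)

lemma G_0 [simp]: "G t 0 = 0" by (simp add: G_def)

lemma exp_\<kappa>_tendsto: "((\<lambda>A. K * exp (- \<kappa> * A)) \<longlongrightarrow> 0) at_top"
proof -
  have "((\<lambda>A. exp (- (\<kappa> * A))) \<longlongrightarrow> 0) at_top"
    using \<kappa> by (intro filterlim_compose[OF exp_at_bot] filterlim_uminus_at_bot_at_top[THEN filterlim_compose]
        filterlim_tendsto_pos_mult_at_top[OF tendsto_const _ filterlim_ident]) 
  then show ?thesis by (intro tendsto_mult_right_zero) simp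
qed

lemma G_LIMSEQ_H: "(\<lambda>n. G t (real n)) \<longlonglongrightarrow> H t"
proof -
  obtain C where C: "C \<ge> 0" "\<And>t' A B. \<bar>t'\<bar> \<le> \<bar>t\<bar> \<Longrightarrow> 0 \<le> A \<Longrightarrow> A \<le> B \<Longrightarrow>
     norm (integral {A..B} (\<lambda>u. g (t' * \<phi> u))) \<le> C * \<bar>t'\<bar> powr (3/4) * exp (- \<kappa> * A)"
    using integral_levy_exponent_\<phi>_le[of "\<bar>t\<bar>"] by blast
  let ?K = "C * \<bar>t\<bar> powr (3/4)"
  have bd: "norm (G t (real m) - G t (real n)) \<le> ?K * exp (- \<kappa> * n)" if "n \<le> m" for m n :: nat
    using C(2)[of t "real n" "real m"] that by (simp add: G_diff)
  have lim: "(\<lambda>n. ?K * exp (- \<kappa> * real n)) \<longlonglongrightarrow> 0"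
    using filterlim_compose[OF exp_\<kappa>_tendsto filterlim_real_sequentially] by simp
  have "Cauchy (\<lambda>n. G t (real n))"
  proof (rule CauchyI')
    fix e :: real assume "e > 0"
    then have "\<forall>\<^sub>F n in sequentially. ?K * exp (- \<kappa> * real n) < e"
      by (rule order_tendstoD(2)[OF lim])
    then obtain N where N: "\<And>n. n \<ge> N \<Longrightarrow> ?K * exp (- \<kappa> * real n) < e"
      unfolding eventually_sequentially by blast
    have "norm (G t (real m) - G t (real n)) < e" if "m \<ge> N" "n > m" for m n
      using bd[of m n] N[OF that(1)] that(2) by (simp add: norm_minus_commute)
    then show "\<exists>M. \<forall>m\<ge>M. \<forall>n>m. dist (G t (real m)) (G t (real n)) < e"
      unfolding dist_norm by blast
  qed
  then show ?thesis unfolding H_def by (simp only: Cauchy_convergent convergent_LIMSEQ_iff[symmetric])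
qed

lemma norm_H_minus_G_le:
  "\<exists>C\<ge>0. \<forall>t A. \<bar>t\<bar> \<le> T \<longrightarrow> 0 \<le> A \<longrightarrow> norm (H t - G t A) \<le> C * \<bar>t\<bar> powr (3/4) * exp (- \<kappa> * A)"
proof -
  obtain C where C: "C \<ge> 0" "\<And>t A B. \<bar>t\<bar> \<le> T \<Longrightarrow> 0 \<le> A \<Longrightarrow> A \<le> B \<Longrightarrow>
     norm (integral {A..B} (\<lambda>u. g (t * \<phi> u))) \<le> C * \<bar>t\<bar> powr (3/4) * exp (- \<kappa> * A)"
    using integral_levy_exponent_\<phi>_le[of T] by blast
  show ?thesis
  proof (intro exI[of _ C] conjI allI impI)
    fix t A :: real assume t: "\<bar>t\<bar> \<le> T" "0 \<le> A"
    have "eventually (\<lambda>n. real n \<ge> A) sequentially"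
      using filterlim_real_sequentially by (simp add: filterlim_at_top)
    then have "eventually (\<lambda>n. norm (G t (real n) - G t A) \<le> C * \<bar>t\<bar> powr (3/4) * exp (- \<kappa> * A)) sequentially"
      by eventually_elim (use C(2) t in \<open>simp add: G_diff\<close>)
    moreover have "(\<lambda>n. norm (G t (real n) - G t A)) \<longlonglongrightarrow> norm (H t - G t A)"
      by (intro tendsto_intros G_LIMSEQ_H)
    ultimately show "norm (H t - G t A) \<le> C * \<bar>t\<bar> powr (3/4) * exp (- \<kappa> * A)"
      by (intro tendsto_upperbound[where F = sequentially]) auto
  qed (use C in auto)
qed

lemma G_tendsto_H: "(G t \<longlongrightarrow> H t) at_top"
proof -
  obtain C where C: "C \<ge> 0" "\<And>t' A. \<bar>t'\<bar> \<le> \<bar>t\<bar> \<Longrightarrow> 0 \<le> A \<Longrightarrow> norm (H t' - G t' A) \<le> C * \<bar>t'\<bar> powr (3/4) * exp (- \<kappa> * A)"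
    using norm_H_minus_G_le[of "\<bar>t\<bar>"] by blast
  have "((\<lambda>A. G t A - H t) \<longlongrightarrow> 0) at_top"
  proof (rule Lim_null_comparison[OF _ exp_\<kappa>_tendsto])
    show "\<forall>\<^sub>F A in at_top. norm (G t A - H t) \<le> C * \<bar>t\<bar> powr (3/4) * exp (- \<kappa> * A)"
      using eventually_ge_at_top[of 0]
      by eventually_elim (use C in \<open>auto simp: norm_minus_commute\<close>)
  qed
  then show ?thesis using LIM_zero_iff by blast
qed

lemma norm_H_le: "\<exists>C\<ge>0. \<forall>t. \<bar>t\<bar> \<le> T \<longrightarrow> norm (H t) \<le> C * \<bar>t\<bar> powr (3/4)"
proof -
  obtain C where C: "C \<ge> 0" "\<And>t A. \<bar>t\<bar> \<le> T \<Longrightarrow> 0 \<le> A \<Longrightarrow> norm (H t - G t A) \<le> C * \<bar>t\<bar> powr (3/4) * exp (- \<kappa> * A)"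
    using norm_H_minus_G_le[of T] by blast
  from C(1) C(2)[of _ 0] show ?thesis by (intro exI[of _ C]) simp
qed

text \<open>Substituting \<open>u + c\<close> for \<open>u\<close>: discounting the argument by
  \<open>c\<close> deletes the first \<open>c\<close> units of time from the integral. In this way a
  waiting time acts on \<open>exp (H t)\<close> by the factor \<open>exp (- G t c)\<close>.\<close>

lemma H_scale:
  assumes "0 \<le> c"
  shows "H (t * \<phi> c) = H t - G t c"
proof -
  have "G (t * \<phi> c) A = G t (A + c) - G t c" if "0 \<le> A" for A
  proof -
    have "integral {c - c..(A + c) - c} (\<lambda>u. g (t * \<phi> (u + c))) = integral {c..A + c} (\<lambda>u. g (t * \<phi> u))"
      by (rule integral_shift_real_ivl)
    moreover have "(\<lambda>u. g (t * \<phi> (u + c))) = (\<lambda>u. g (t * \<phi> c * \<phi> u))"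
      by (simp add: algebra_simps exp_diff exp_minus divide_inverse)
    ultimately have "G (t * \<phi> c) A = integral {c..A + c} (\<lambda>u. g (t * \<phi> u))" by (simp add: G_def)
    also have "\<dots> = G t (A + c) - G t c" using that assms by (simp add: G_diff)
    finally show ?thesis .
  qed
  then have "\<forall>\<^sub>F A in at_top. G t (A + c) - G t c = G (t * \<phi> c) A"
    by (intro eventually_at_top_linorderI[of 0]) simp
  moreover have "filterlim (\<lambda>A. A + c) at_top at_top"
    using filterlim_tendsto_add_at_top[OF tendsto_const filterlim_ident, of c] by (simp add: add.commute)
  then have "((\<lambda>A. G t (A + c) - G t c) \<longlongrightarrow> H t - G t c) at_top"
    by (intro tendsto_intros filterlim_compose[OF G_tendsto_H])
  ultimately have "(G (t * \<phi> c) \<longlongrightarrow> H t - G t c) at_top"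
    by (simp add: tendsto_cong)
  then show ?thesis using G_tendsto_H tendsto_unique trivial_limit_at_top_linorder by blast
qed

text \<open>On \<open>[0, c]\<close> the argument \<open>t * \<phi> u\<close> moves by at most
  \<open>\<bar>t\<bar> * a * c\<close>, and \<open>g\<close> is Hoelder continuous of order
  \<open>3/4\<close>. The error \<open>c powr (7/4)\<close> is of smaller order than
  \<open>1 / N\<close> when \<open>c\<close> is of order \<open>1 / N\<close>.\<close>

lemma G_expansion:
  "\<exists>C\<ge>0. \<forall>t c. \<bar>t\<bar> \<le> T \<longrightarrow> 0 \<le> c \<longrightarrow> norm (G t c - c * g t) \<le> C * \<bar>t\<bar> powr (3/4) * (c * c powr (3/4))"
proof -
  obtain C where C: "C \<ge> 0"
    "\<And>x y. \<bar>x\<bar> \<le> T \<Longrightarrow> \<bar>y\<bar> \<le> T \<Longrightarrow> norm (g x - g y) \<le> C * \<bar>x - y\<bar> powr (3/4)"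
    using levy_exponent_holder[of T] by blast
  show ?thesis
  proof (intro exI[of _ "C * a powr (3/4)"] conjI allI impI)
    fix t c :: real assume t: "\<bar>t\<bar> \<le> T" and c: "0 \<le> c"
    let ?K = "C * (\<bar>t\<bar> * a * c) powr (3/4)"
    have "norm (integral {0..c} (\<lambda>u. g (t * \<phi> u) - g t)) \<le> integral {0..c} (\<lambda>u. ?K)"
    proof (rule integral_norm_bound_integral)
      fix u assume u: "u \<in> {0..c}"
      then have \<phi>: "\<phi> u \<le> 1" using a by simp
      have "t * \<phi> u - t = - (t * (1 - \<phi> u))" by (simp add: algebra_simps)
      then have "\<bar>t * \<phi> u - t\<bar> = \<bar>t\<bar> * (1 - \<phi> u)" using \<phi> by (simp add: abs_mult)
      also have "\<dots> \<le> \<bar>t\<bar> * (a * u)"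
        using exp_ge_add_one_self[of "- a * u"] by (intro mult_left_mono) auto
      also have "\<dots> \<le> \<bar>t\<bar> * (a * c)" using u a by (intro mult_left_mono) auto
      finally have 1: "\<bar>t * \<phi> u - t\<bar> \<le> \<bar>t\<bar> * a * c" by simp
      have "\<bar>t * \<phi> u\<bar> \<le> \<bar>t\<bar>" using \<phi> by (simp add: abs_mult mult_left_le)
      then have "norm (g (t * \<phi> u) - g t) \<le> C * \<bar>t * \<phi> u - t\<bar> powr (3/4)" using t by (intro C) auto
      also have "\<dots> \<le> ?K" using 1 C by (intro mult_left_mono powr_mono2) auto
      finally show "norm (g (t * \<phi> u) - g t) \<le> ?K" .
    qed (intro integrable_continuous_real continuous_intros)+
    also have "integral {0..c} (\<lambda>u. ?K) = C * a powr (3/4) * \<bar>t\<bar> powr (3/4) * (c * c powr (3/4))"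
      using a c by (simp add: powr_mult mult_ac)
    also have "integral {0..c} (\<lambda>u. g (t * \<phi> u) - g t) = G t c - c * g t"
      unfolding G_def using c
      by (subst Henstock_Kurzweil_Integration.integral_diff)
         (auto intro!: integrable_continuous_real continuous_intros simp: scaleR_conv_of_real)
    finally show "norm (G t c - c * g t) \<le> C * a powr (3/4) * \<bar>t\<bar> powr (3/4) * (c * c powr (3/4))" .
  qed (use C in auto)
qed

lemma norm_G_le:
  "\<exists>C\<ge>0. \<forall>t c. \<bar>t\<bar> \<le> T \<longrightarrow> 0 \<le> c \<longrightarrow> norm (G t c) \<le> C * \<bar>t\<bar> powr (3/4) * c"
proof -
  obtain C where C: "C \<ge> 0" "\<And>x. \<bar>x\<bar> \<le> T \<Longrightarrow> norm (g x) \<le> C * \<bar>x\<bar> powr (3/4)"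
    using levy_exponent_bound[of T] by blast
  show ?thesis
  proof (intro exI[of _ C] conjI allI impI)
    fix t c :: real assume t: "\<bar>t\<bar> \<le> T" and c: "0 \<le> c"
    have "norm (G t c) \<le> integral {0..c} (\<lambda>u. C * \<bar>t\<bar> powr (3/4))"
      unfolding G_def
    proof (rule integral_norm_bound_integral)
      fix u assume u: "u \<in> {0..c}"
      then have \<phi>: "\<phi> u \<le> 1" using a by simp
      have le: "\<bar>t * \<phi> u\<bar> \<le> \<bar>t\<bar>" using \<phi> by (simp add: abs_mult mult_left_le)
      then have "norm (g (t * \<phi> u)) \<le> C * \<bar>t * \<phi> u\<bar> powr (3/4)" using t by (intro C) auto
      also have "\<dots> \<le> C * \<bar>t\<bar> powr (3/4)" using le C by (intro mult_left_mono powr_mono2) auto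
      finally show "norm (g (t * \<phi> u)) \<le> C * \<bar>t\<bar> powr (3/4)" .
    qed (intro integrable_continuous_real continuous_intros)+
    then show "norm (G t c) \<le> C * \<bar>t\<bar> powr (3/4) * c" using c by (simp add: mult_ac)
  qed (use C in auto)
qed

section \<open>The discounted sum\<close>

text \<open>\<open>geometric_pmf\<close> counts failures and starts at \<open>0\<close>;
  \<open>Suc\<close> moves its support to the positive integers.\<close>

definition \<tau>_pmf :: "nat pmf" where "\<tau>_pmf = map_pmf Suc (geometric_pmf p)"

text \<open>Indices start at \<open>0\<close> here, and the discount is written as a product over
  the waiting times, so that prepending a waiting time pulls out one factor from all later
  terms.\<close>

definition seq_term :: "real \<Rightarrow> (nat \<Rightarrow> nat) \<Rightarrow> nat \<Rightarrow> real" where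
  "seq_term \<gamma> x k = (\<Prod>i\<le>k. \<gamma> ^ x i) * (s * r ^ (x k - 1))"

definition seq_sum :: "real \<Rightarrow> (nat \<Rightarrow> nat) \<Rightarrow> real" where
  "seq_sum \<gamma> x = (\<Sum>k. seq_term \<gamma> x k)"

definition \<S> :: "(nat \<Rightarrow> nat) measure" where "\<S> = (\<Pi>\<^sub>M i\<in>UNIV. measure_pmf \<tau>_pmf)"

lemma pmf_geo: "pmf (geometric_pmf p) m = p * q ^ m"
  using p by (simp add: q_def)

lemma sequence_space_\<tau>: "sequence_space (measure_pmf \<tau>_pmf)"
  by (intro sequence_space.intro product_prob_space.intro product_sigma_finite.intro product_prob_space_axioms.intro)
    (auto intro: prob_space_imp_sigma_finite prob_space_measure_pmf)

lemma prob_space_\<S>: "prob_space \<S>"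
  unfolding \<S>_def by (intro prob_space_PiM prob_space_measure_pmf)

lemma discounted_term_eq:
  "discounted_term s r \<tau> \<gamma> (Suc k) \<omega> = seq_term \<gamma> (\<lambda>i. \<tau> (Suc i) \<omega>) k"
proof -
  have "arrival_time \<tau> (Suc k) \<omega> = (\<Sum>i\<le>k. \<tau> (Suc i) \<omega>)"
    unfolding arrival_time_def One_nat_def sum.atLeast1_atMost_eq lessThan_Suc_atMost ..
  then show ?thesis by (simp add: discounted_term_def seq_term_def payoff_def power_sum)
qed

lemma discounted_sum_eq:
  "discounted_sum s r \<tau> \<gamma> \<omega> = seq_sum \<gamma> (\<lambda>i. \<tau> (Suc i) \<omega>)"
  by (simp add: discounted_sum_def seq_sum_def discounted_term_eq)

lemma component_measurable: "(\<lambda>x. h (x i)) \<in> borel_measurable \<S>"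
proof -
  have "(\<lambda>x. x i) \<in> measurable \<S> (measure_pmf \<tau>_pmf)"
    unfolding \<S>_def by (rule measurable_component_singleton) simp
  then show ?thesis by (rule measurable_compose) simp
qed

lemma seq_term_measurable: "(\<lambda>x. seq_term \<gamma> x k) \<in> borel_measurable \<S>"
  unfolding seq_term_def
  by (intro borel_measurable_times borel_measurable_prod component_measurable borel_measurable_const)

lemma seq_sum_measurable: "seq_sum \<gamma> \<in> borel_measurable \<S>"
  unfolding seq_sum_def[abs_def] by (intro borel_measurable_suminf seq_term_measurable)

text \<open>Since \<open>q * sqrt r = sqrt q\<close>, the expectation is the geometric series
  \<open>p * (\<Sum>m. sqrt q ^ m)\<close>.\<close>

lemma sqrt_sum_finite: "(\<integral>\<^sup>+j. ennreal (sqrt (r ^ (j - 1))) \<partial>\<tau>_pmf) < \<infinity>"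
proof -
  have "(\<integral>\<^sup>+j. ennreal (sqrt (r ^ (j - 1))) \<partial>\<tau>_pmf) = (\<Sum>m. ennreal (p * q ^ m) * ennreal (sqrt (r ^ m)))"
    unfolding \<tau>_pmf_def nn_integral_map_pmf
    by (simp add: nn_integral_measure_pmf nn_integral_count_space_nat pmf_geo)
  also have "\<dots> = (\<Sum>m. ennreal (p * sqrt q ^ m))"
  proof (intro suminf_cong)
    fix m
    have "q * sqrt r = sqrt q * (sqrt q * sqrt r)" using q by (simp flip: mult.assoc)
    also have "sqrt q * sqrt r = 1" using r by (simp flip: real_sqrt_mult)
    finally have "q ^ m * sqrt (r ^ m) = sqrt q ^ m" by (simp add: real_sqrt_power flip: power_mult_distrib)
    then show "ennreal (p * q ^ m) * ennreal (sqrt (r ^ m)) = ennreal (p * sqrt q ^ m)"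
      using p q r by (simp add: mult.assoc flip: ennreal_mult)
  qed
  also have "\<dots> = ennreal (\<Sum>m. p * sqrt q ^ m)"
    using p q by (intro suminf_ennreal2 summable_mult summable_geometric) auto
  finally show ?thesis by simp
qed

text \<open>
  The payoffs have infinite mean, but their square roots have finite mean, and a series with
  nonnegative terms converges if the series of the square roots does.
\<close>

lemma AE_summable_seq_term:
  assumes "prob_space N" and X: "\<And>k. X k \<in> measurable N (count_space UNIV)"
    and law: "\<And>k. distr N (count_space UNIV) (X k) = measure_pmf \<tau>_pmf"
    and \<gamma>: "0 < \<gamma>" "\<gamma> < 1"
  shows "AE \<omega> in N. summable (seq_term \<gamma> (\<lambda>k. X k \<omega>))"
proof -
  interpret N: prob_space N by fact
  define b where "b k \<omega> = sqrt (\<gamma> ^ k * s) * sqrt (r ^ (X k \<omega> - 1))" for k \<omega>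
  have b0: "0 \<le> b k \<omega>" for k \<omega> using \<gamma> s r by (simp add: b_def)
  have meas: "(\<lambda>\<omega>. h (X k \<omega>)) \<in> borel_measurable N" for k and h :: "nat \<Rightarrow> 'c::topological_space"
    by (rule measurable_compose[OF X]) simp
  have b_meas: "(\<lambda>\<omega>. ennreal (b k \<omega>)) \<in> borel_measurable N" for k
    unfolding b_def by (rule meas)
  define c where "c = (\<integral>\<^sup>+j. ennreal (sqrt (r ^ (j - 1))) \<partial>\<tau>_pmf)"
  have int_b: "(\<integral>\<^sup>+\<omega>. ennreal (b k \<omega>) \<partial>N) = ennreal (sqrt s * sqrt \<gamma> ^ k) * c" for k
  proof -
    have "(\<integral>\<^sup>+\<omega>. ennreal (b k \<omega>) \<partial>N) = (\<integral>\<^sup>+\<omega>. ennreal (sqrt (\<gamma> ^ k * s)) * ennreal (sqrt (r ^ (X k \<omega> - 1))) \<partial>N)"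
      using \<gamma> s r by (simp add: b_def ennreal_mult)
    also have "\<dots> = ennreal (sqrt (\<gamma> ^ k * s)) * (\<integral>\<^sup>+\<omega>. ennreal (sqrt (r ^ (X k \<omega> - 1))) \<partial>N)"
      by (intro nn_integral_cmult meas)
    also have "(\<integral>\<^sup>+\<omega>. ennreal (sqrt (r ^ (X k \<omega> - 1))) \<partial>N) = c"
      unfolding c_def law[of k, symmetric] by (rule nn_integral_distr[symmetric, OF X]) simp
    finally show ?thesis by (simp add: real_sqrt_mult real_sqrt_power mult.commute)
  qed
  have "(\<integral>\<^sup>+\<omega>. (\<Sum>k. ennreal (b k \<omega>)) \<partial>N) = (\<Sum>k. ennreal (sqrt s * sqrt \<gamma> ^ k) * c)"
    by (simp only: nn_integral_suminf[OF b_meas] int_b)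
  also have "\<dots> = (\<Sum>k. ennreal (sqrt s * sqrt \<gamma> ^ k)) * c" by (rule ennreal_suminf_multc)
  also have "(\<Sum>k. ennreal (sqrt s * sqrt \<gamma> ^ k)) = ennreal (\<Sum>k. sqrt s * sqrt \<gamma> ^ k)"
    using \<gamma> s by (intro suminf_ennreal2 summable_mult summable_geometric) auto
  also have "\<dots> * c \<noteq> \<infinity>" using sqrt_sum_finite by (simp add: c_def ennreal_mult_eq_top_iff)
  finally have "AE \<omega> in N. (\<Sum>k. ennreal (b k \<omega>)) \<noteq> \<infinity>"
    by (intro nn_integral_PInf_AE borel_measurable_suminf_order b_meas)
  \<comment> \<open>Waiting times of at least \<open>1\<close> let the discount of the term of index
    \<open>k\<close> be bounded by \<open>\<gamma> ^ Suc k\<close>.\<close>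
  moreover have "AE \<omega> in N. \<forall>k. 1 \<le> X k \<omega>"
  proof -
    have "AE j in measure_pmf \<tau>_pmf. 1 \<le> j" by (auto simp: AE_measure_pmf_iff \<tau>_pmf_def)
    then have "AE j in distr N (count_space UNIV) (X k). 1 \<le> j" for k by (simp only: law)
    then have "AE \<omega> in N. 1 \<le> X k \<omega>" for k by (rule AE_distrD[OF X])
    then show ?thesis by (simp add: AE_all_countable)
  qed
  ultimately show ?thesis
  proof eventually_elim
    case (elim \<omega>)
    from elim(1) have sum_b: "summable (\<lambda>k. b k \<omega>)" using b0 by (intro summable_suminf_not_top) auto
    then have "(\<lambda>k. b k \<omega>) \<longlonglongrightarrow> 0" by (rule summable_LIMSEQ_zero)
    then have "\<forall>\<^sub>F k in sequentially. b k \<omega> < 1" by (rule order_tendstoD(2)) simp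
    then have "\<forall>\<^sub>F k in sequentially. norm (seq_term \<gamma> (\<lambda>k. X k \<omega>) k) \<le> b k \<omega>"
    proof eventually_elim
      case (elim k)
      have "(\<Prod>i\<le>k. \<gamma> ^ X i \<omega>) \<le> (\<Prod>i\<le>k. \<gamma> ^ 1)"
        using \<gamma> \<open>\<forall>k. 1 \<le> X k \<omega>\<close> by (intro prod_mono conjI power_decreasing) auto
      also have "\<dots> = \<gamma> ^ Suc k" by simp
      also have "\<dots> \<le> \<gamma> ^ k" using \<gamma> by (intro power_decreasing) auto
      finally have "seq_term \<gamma> (\<lambda>k. X k \<omega>) k \<le> \<gamma> ^ k * (s * r ^ (X k \<omega> - 1))"
        unfolding seq_term_def using s r by (intro mult_right_mono) auto
      also have "\<dots> = b k \<omega> ^ 2" using \<gamma> s r by (simp add: b_def power_mult_distrib)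
      also have "\<dots> \<le> b k \<omega>" using elim b0[of k \<omega>] by (simp add: power2_eq_square mult_left_le)
      finally show ?case using \<gamma> s r by (simp add: seq_term_def prod_nonneg)
    qed
    then show ?case by (rule summable_comparison_test_ev) (rule sum_b)
  qed
qed

lemma AE_summable_\<S>:
  assumes "0 < \<gamma>" "\<gamma> < 1"
  shows "AE x in \<S>. summable (seq_term \<gamma> x)"
proof -
  have m: "(\<lambda>x. x k) \<in> measurable \<S> (count_space UNIV)" for k
  proof -
    have "(\<lambda>x. x k) \<in> measurable \<S> (measure_pmf \<tau>_pmf)"
      unfolding \<S>_def by (rule measurable_component_singleton) simp
    then show ?thesis by simp
  qed
  have "distr \<S> (count_space UNIV) (\<lambda>x. x k) = measure_pmf \<tau>_pmf" for k
  proof -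
    have "distr \<S> (measure_pmf \<tau>_pmf) (\<lambda>x. x k) = measure_pmf \<tau>_pmf"
      unfolding \<S>_def by (rule distr_PiM_component) (auto intro: prob_space_measure_pmf)
    moreover have "distr \<S> (measure_pmf \<tau>_pmf) (\<lambda>x. x k) = distr \<S> (count_space UNIV) (\<lambda>x. x k)"
      by (rule distr_cong) auto
    ultimately show ?thesis by simp
  qed
  from AE_summable_seq_term[OF prob_space_\<S> m this assms] show ?thesis by simp
qed

text \<open>The self-similarity of the sum: after the first waiting time \<open>j\<close> the series
  starts afresh, discounted by \<open>\<gamma> ^ j\<close>. Summability ensures that the value of
  the infinite series respects this shift.\<close>

lemma seq_sum_case_nat:
  assumes "summable (seq_term \<gamma> x)"
  shows "seq_sum \<gamma> (case_nat j x) = \<gamma> ^ j * (s * r ^ (j - 1) + seq_sum \<gamma> x)"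
proof -
  have "seq_term \<gamma> (case_nat j x) (Suc k) = \<gamma> ^ j * seq_term \<gamma> x k" for k
    by (simp only: seq_term_def prod.atMost_Suc_shift) (simp add: mult_ac)
  then have shift: "(\<lambda>k. seq_term \<gamma> (case_nat j x) (Suc k)) = (\<lambda>k. \<gamma> ^ j * seq_term \<gamma> x k)" by simp
  then have "summable (\<lambda>k. seq_term \<gamma> (case_nat j x) (Suc k))"
    using assms by (simp add: summable_mult)
  then have "summable (seq_term \<gamma> (case_nat j x))" by (simp only: summable_Suc_iff)
  then have "seq_sum \<gamma> (case_nat j x) = (\<Sum>k. \<gamma> ^ j * seq_term \<gamma> x k) + seq_term \<gamma> (case_nat j x) 0"
    unfolding seq_sum_def shift[symmetric] using suminf_split_head by fastforce
  moreover have "seq_term \<gamma> (case_nat j x) 0 = \<gamma> ^ j * (s * r ^ (j - 1))"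
    by (simp add: seq_term_def)
  ultimately show ?thesis
    by (simp add: suminf_mult[OF assms] seq_sum_def distrib_left)
qed

section \<open>Recursion for the characteristic function of the sum\<close>

definition \<theta> :: "real \<Rightarrow> real \<Rightarrow> complex" where
  "\<theta> \<gamma> t = char (distr \<S> borel (seq_sum \<gamma>)) t"

lemma \<theta>_eq: "\<theta> \<gamma> t = (CLINT x|\<S>. iexp (t * seq_sum \<gamma> x))"
  unfolding \<theta>_def using prob_space.char_distr[OF prob_space_\<S> seq_sum_measurable] .

lemma real_distribution_seq_sum: "real_distribution (distr \<S> borel (seq_sum \<gamma>))"
  by (rule prob_space.real_distribution_distr[OF prob_space_\<S> seq_sum_measurable])

lemma expectation_\<tau>_pmf:
  fixes F :: "nat \<Rightarrow> complex"
  assumes "\<And>j. norm (F j) \<le> 1"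
  shows "(\<lambda>m. of_real (p * q ^ m) * F (Suc m)) sums (CLINT j|measure_pmf \<tau>_pmf. F j)"
proof -
  have "summable (\<lambda>m. norm (pmf (geometric_pmf p) m *\<^sub>R F (Suc m)))"
  proof (rule summable_comparison_test'[of "\<lambda>m. p * q ^ m" 0])
    show "summable (\<lambda>m. p * q ^ m)" using q by (intro summable_mult summable_geometric) simp
    show "norm (norm (pmf (geometric_pmf p) m *\<^sub>R F (Suc m))) \<le> p * q ^ m" for m
      using assms[of "Suc m"] p q by (simp add: pmf_geo mult_left_le)
  qed
  then have "integrable (count_space UNIV) (\<lambda>m. pmf (geometric_pmf p) m *\<^sub>R F (Suc m))"
    by (simp add: integrable_count_space_nat_iff)
  then have "(\<lambda>m. pmf (geometric_pmf p) m *\<^sub>R F (Suc m)) sums (CLINT m|count_space UNIV. pmf (geometric_pmf p) m *\<^sub>R F (Suc m))"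
    by (rule sums_integral_count_space_nat)
  moreover have "(CLINT m|count_space UNIV. pmf (geometric_pmf p) m *\<^sub>R F (Suc m)) = (CLINT j|measure_pmf \<tau>_pmf. F j)"
    unfolding \<tau>_pmf_def integral_map_pmf by (simp add: measure_pmf_eq_density integral_density)
  ultimately show ?thesis by (simp add: pmf_geo scaleR_conv_of_real)
qed

text \<open>Prepending an independent waiting time to a sequence with law \<open>\<S>\<close> gives
  a sequence with law \<open>\<S>\<close> again. Fubini conditions on that first coordinate; the
  inner integral is \<open>\<theta> \<gamma>\<close> at the contracted point times the phase of the
  first payoff.\<close>

lemma \<theta>_recursion:
  assumes \<gamma>: "0 < \<gamma>" "\<gamma> < 1"
  shows "(\<lambda>m. of_real (p * q ^ m) * (iexp (t * \<gamma> ^ Suc m * (s * r ^ m)) * \<theta> \<gamma> (t * \<gamma> ^ Suc m))) sums \<theta> \<gamma> t"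
proof -
  interpret sequence_space "measure_pmf \<tau>_pmf" by (rule sequence_space_\<tau>)
  interpret SS: prob_space \<S> by (rule prob_space_\<S>)
  interpret PP: pair_sigma_finite "measure_pmf \<tau>_pmf" \<S>
    by (intro pair_sigma_finite.intro prob_space_imp_sigma_finite prob_space_measure_pmf prob_space_\<S>)
  interpret PPP: pair_prob_space "measure_pmf \<tau>_pmf" \<S> ..
  let ?f = "\<lambda>x. iexp (t * seq_sum \<gamma> x)"
  note [measurable] = seq_sum_measurable
  have [measurable]: "?f \<in> borel_measurable \<S>" by measurable
  have it: "distr (measure_pmf \<tau>_pmf \<Otimes>\<^sub>M \<S>) \<S> (\<lambda>(j, x). case_nat j x) = \<S>"
    using PiM_iter by (simp add: \<S>_def)
  have cn[measurable]: "(\<lambda>(j, x). case_nat j x) \<in> measurable (measure_pmf \<tau>_pmf \<Otimes>\<^sub>M \<S>) \<S>"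
    unfolding \<S>_def by measurable
  have "\<theta> \<gamma> t = (CLINT x|distr (measure_pmf \<tau>_pmf \<Otimes>\<^sub>M \<S>) \<S> (\<lambda>(j, x). case_nat j x). ?f x)"
    unfolding it by (rule \<theta>_eq)
  also have "\<dots> = (CLINT jx|(measure_pmf \<tau>_pmf \<Otimes>\<^sub>M \<S>). ?f (case_nat (fst jx) (snd jx)))"
    by (subst integral_distr) (auto simp: case_prod_unfold)
  also have "\<dots> = (CLINT j|measure_pmf \<tau>_pmf. CLINT x|\<S>. ?f (case_nat j x))"
  proof -
    have "integrable (measure_pmf \<tau>_pmf \<Otimes>\<^sub>M \<S>) (\<lambda>jx. ?f (case_nat (fst jx) (snd jx)))"
    proof (rule PPP.integrable_const_bound[where B = 1])
      show "(\<lambda>jx. ?f (case_nat (fst jx) (snd jx))) \<in> borel_measurable (measure_pmf \<tau>_pmf \<Otimes>\<^sub>M \<S>)"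
        using measurable_compose[OF cn \<open>?f \<in> borel_measurable \<S>\<close>] by (simp add: case_prod_unfold)
    qed simp
    from PP.integral_fst'[OF this] show ?thesis by simp
  qed
  also have "(\<lambda>j. CLINT x|\<S>. ?f (case_nat j x)) = (\<lambda>j. iexp (t * \<gamma> ^ j * (s * r ^ (j - 1))) * \<theta> \<gamma> (t * \<gamma> ^ j))"
  proof
    fix j
    have "(CLINT x|\<S>. ?f (case_nat j x)) = (CLINT x|\<S>. iexp (t * \<gamma> ^ j * (s * r ^ (j - 1))) * iexp (t * \<gamma> ^ j * seq_sum \<gamma> x))"
    proof (rule integral_cong_AE)
      have "(\<lambda>x. case_nat j x) \<in> measurable \<S> \<S>" unfolding \<S>_def by measurable
      then show "(\<lambda>x. ?f (case_nat j x)) \<in> borel_measurable \<S>" by measurable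
      show "(\<lambda>x. iexp (t * \<gamma> ^ j * (s * r ^ (j - 1))) * iexp (t * \<gamma> ^ j * seq_sum \<gamma> x)) \<in> borel_measurable \<S>"
        by measurable
      show "AE x in \<S>. ?f (case_nat j x) = iexp (t * \<gamma> ^ j * (s * r ^ (j - 1))) * iexp (t * \<gamma> ^ j * seq_sum \<gamma> x)"
        using AE_summable_\<S>[OF \<gamma>]
      proof eventually_elim
        case (elim x)
        show ?case unfolding seq_sum_case_nat[OF elim] by (simp add: exp_add[symmetric] algebra_simps)
      qed
    qed
    then show "(CLINT x|\<S>. ?f (case_nat j x)) = iexp (t * \<gamma> ^ j * (s * r ^ (j - 1))) * \<theta> \<gamma> (t * \<gamma> ^ j)"
      by (simp add: \<theta>_eq)
  qed
  finally have "\<theta> \<gamma> t = (CLINT j|measure_pmf \<tau>_pmf. iexp (t * \<gamma> ^ j * (s * r ^ (j - 1))) * \<theta> \<gamma> (t * \<gamma> ^ j))" .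
  moreover have "norm (iexp (t * \<gamma> ^ j * (s * r ^ (j - 1))) * \<theta> \<gamma> (t * \<gamma> ^ j)) \<le> 1" for j
    unfolding norm_mult \<theta>_def using real_distribution.cmod_char_le_1[OF real_distribution_seq_sum]
    by simp
  from expectation_\<tau>_pmf[of "\<lambda>j. iexp (t * \<gamma> ^ j * (s * r ^ (j - 1))) * \<theta> \<gamma> (t * \<gamma> ^ j)", OF this]
  have "(\<lambda>m. of_real (p * q ^ m) * (iexp (t * \<gamma> ^ Suc m * (s * r ^ m)) * \<theta> \<gamma> (t * \<gamma> ^ Suc m)))
    sums (CLINT j|measure_pmf \<tau>_pmf. iexp (t * \<gamma> ^ j * (s * r ^ (j - 1))) * \<theta> \<gamma> (t * \<gamma> ^ j))"
    by simp
  ultimately show ?thesis by simp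
qed

text \<open>The prescribed probabilities of the positive values already add up to \<open>1\<close>,
  so the value \<open>0\<close> has probability \<open>0\<close> and the law is determined.\<close>

lemma distr_\<tau>:
  assumes "prob_space N" and X: "X \<in> measurable N (count_space UNIV)"
    and prob: "\<And>j. 1 \<le> j \<Longrightarrow> \<P>(\<omega> in N. X \<omega> = j) = p * q ^ (j - 1)"
  shows "distr N (count_space UNIV) X = measure_pmf \<tau>_pmf"
proof -
  interpret N: prob_space N by fact
  have ev: "{\<omega>\<in>space N. X \<omega> = j} \<in> sets N" for j
    using measurable_sets[OF X, of "{j}"] by (simp add: vimage_def Int_def conj_commute)
  have "(\<lambda>m. \<P>(\<omega> in N. X \<omega> = Suc m)) sums N.prob (\<Union>m. {\<omega>\<in>space N. X \<omega> = Suc m})"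
    by (rule N.finite_measure_UNION) (auto simp: ev disjoint_family_on_def)
  moreover have "(\<lambda>m. p * q ^ m) sums (p * (1 / (1 - q)))"
    using q by (intro sums_mult geometric_sums) simp
  then have "(\<lambda>m. \<P>(\<omega> in N. X \<omega> = Suc m)) sums 1" using p by (simp add: prob q_def)
  ultimately have 1: "N.prob (\<Union>m. {\<omega>\<in>space N. X \<omega> = Suc m}) = 1" by (rule sums_unique2)
  have "space N - (\<Union>m. {\<omega>\<in>space N. X \<omega> = Suc m}) = {\<omega>\<in>space N. X \<omega> = 0}"
    using not0_implies_Suc by auto
  then have 0: "\<P>(\<omega> in N. X \<omega> = 0) = 0"
    using N.prob_compl[of "\<Union>m. {\<omega>\<in>space N. X \<omega> = Suc m}"] 1 ev by auto
  show ?thesis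
  proof (rule measure_eqI_countable[of _ UNIV])
    fix j
    have "emeasure (distr N (count_space UNIV) X) {j} = ennreal (\<P>(\<omega> in N. X \<omega> = j))"
      using X by (subst emeasure_distr)
        (auto simp: N.emeasure_eq_measure vimage_def Int_def conj_commute)
    also have "\<P>(\<omega> in N. X \<omega> = j) = pmf \<tau>_pmf j"
    proof (cases j)
      case 0
      then have "j \<notin> set_pmf \<tau>_pmf" by (simp add: \<tau>_pmf_def)
      then show ?thesis using \<open>\<P>(\<omega> in N. X \<omega> = 0) = 0\<close> 0 by (simp add: set_pmf_iff)
    next
      case (Suc m)
      then show ?thesis using prob[of j] by (simp add: \<tau>_pmf_def pmf_map_inj' pmf_geo)
    qed
    finally show "emeasure (distr N (count_space UNIV) X) {j} = emeasure (measure_pmf \<tau>_pmf) {j}"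
      by (simp add: emeasure_pmf_single)
  qed auto
qed

text \<open>Independence identifies the joint law on the index set of positive integers as a
  product; reindexing by \<open>Suc\<close> transports it to \<open>\<S>\<close>.\<close>

lemma distr_sequence:
  assumes "prob_space N" and ind: "prob_space.indep_vars N (\<lambda>_. count_space UNIV) \<tau> {1..}"
    and law: "\<And>k. 1 \<le> k \<Longrightarrow> distr N (count_space UNIV) (\<tau> k) = measure_pmf \<tau>_pmf"
  shows "(\<lambda>\<omega> i. \<tau> (Suc i) \<omega>) \<in> measurable N \<S>"
    and "distr N \<S> (\<lambda>\<omega> i. \<tau> (Suc i) \<omega>) = \<S>"
proof -
  interpret N: prob_space N by fact
  have rv: "\<tau> k \<in> measurable N (count_space UNIV)" if "1 \<le> k" for k
    using ind that by (auto simp: N.indep_vars_def)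
  show meas: "(\<lambda>\<omega> i. \<tau> (Suc i) \<omega>) \<in> measurable N \<S>"
    unfolding \<S>_def by (rule measurable_PiM_single') (auto simp: rv)
  \<comment> \<open>Both product spaces carry the same sigma-algebra. The independence lemma speaks
    about \<open>?P\<close>, whereas \<open>?Q\<close> is the space that also has the right
    measure.\<close>
  let ?P = "\<Pi>\<^sub>M i\<in>{1..}. count_space UNIV :: nat measure" and ?Q = "\<Pi>\<^sub>M i\<in>{1::nat..}. measure_pmf \<tau>_pmf"
  have sets: "sets ?P = sets ?Q" by (intro sets_PiM_cong) auto
  have m1: "(\<lambda>\<omega>. \<lambda>i\<in>{1..}. \<tau> i \<omega>) \<in> measurable N ?P"
    by (intro measurable_restrict rv) simp
  then have m2: "(\<lambda>\<omega>. \<lambda>i\<in>{1..}. \<tau> i \<omega>) \<in> measurable N ?Q"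
    using measurable_cong_sets[OF refl sets, of N] by blast
  have "distr N ?Q (\<lambda>\<omega>. \<lambda>i\<in>{1..}. \<tau> i \<omega>) = distr N ?P (\<lambda>\<omega>. \<lambda>i\<in>{1..}. \<tau> i \<omega>)"
    by (rule distr_cong[OF refl sets[symmetric] refl])
  also have "\<dots> = (\<Pi>\<^sub>M i\<in>{1..}. distr N (count_space UNIV) (\<tau> i))"
    by (rule N.indep_vars_iff_distr_eq_PiM'[THEN iffD1, OF _ _ ind]) (auto simp: rv)
  also have "\<dots> = ?Q" by (intro PiM_cong law) auto
  finally have Q: "distr N ?Q (\<lambda>\<omega>. \<lambda>i\<in>{1..}. \<tau> i \<omega>) = ?Q" .
  have "\<S> = distr ?Q \<S> (\<lambda>\<omega>. \<lambda>n\<in>UNIV. \<omega> (Suc n))"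
    unfolding \<S>_def by (rule distr_PiM_reindex[symmetric]) (auto intro: prob_space_measure_pmf)
  also have "\<dots> = distr (distr N ?Q (\<lambda>\<omega>. \<lambda>i\<in>{1..}. \<tau> i \<omega>)) \<S> (\<lambda>\<omega>. \<lambda>n\<in>UNIV. \<omega> (Suc n))"
    unfolding Q ..
  also have "\<dots> = distr N \<S> (\<lambda>\<omega> i. \<tau> (Suc i) \<omega>)"
  proof (subst distr_distr[OF _ m2])
    show "(\<lambda>\<omega>. \<lambda>n\<in>UNIV. \<omega> (Suc n)) \<in> measurable ?Q \<S>"
      unfolding \<S>_def by (intro measurable_restrict measurable_component_singleton) auto
    show "distr N \<S> ((\<lambda>\<omega>. \<lambda>n\<in>UNIV. \<omega> (Suc n)) \<circ> (\<lambda>\<omega>. \<lambda>i\<in>{1..}. \<tau> i \<omega>)) = distr N \<S> (\<lambda>\<omega> i. \<tau> (Suc i) \<omega>)"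
      by (rule distr_cong) (auto simp: fun_eq_iff)
  qed
  finally show "distr N \<S> (\<lambda>\<omega> i. \<tau> (Suc i) \<omega>) = \<S>" by simp
qed

section \<open>Convergence of the characteristic functions\<close>

text \<open>
  \<open>lag n m\<close> is the amount of rescaled time \<open>u\<close> that passes when \<open>\<tau> = m + 1\<close>. Given this event,
  \<open>step_factor n t m\<close> is the contribution of the first payoff and of the centering to the
  characteristic function \<open>h n t\<close> of the centered sum.
\<close>

definition lag :: "nat \<Rightarrow> nat \<Rightarrow> real" where "lag n m = real (Suc m) * p * q ^ n"

definition drift :: "nat \<Rightarrow> real" where "drift n = s * p * real n / a"

definition step_factor :: "nat \<Rightarrow> real \<Rightarrow> nat \<Rightarrow> complex" where
  "step_factor n t m = iexp (t * \<phi> (lag n m) * (q ^ n * s * r ^ m) - t * drift n * (1 - \<phi> (lag n m)))"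

lemma lag_nonneg: "0 \<le> lag n m" using p q by (simp add: lag_def)

lemma q_power_le_1: "0 < q ^ n" "q ^ n \<le> 1" using q by (auto intro: power_le_one)

lemma \<phi>_bounds: "0 \<le> c \<Longrightarrow> 0 < \<phi> c \<and> \<phi> c \<le> 1" using a by simp

lemma norm_step_factor [simp]: "norm (step_factor n t m) = 1"
  by (simp only: step_factor_def norm_exp_i_times)

text \<open>To first order one renewal contributes the phase of its undiscounted payoff, minus the
  lag times the exponent with its linear term. Four remainders are left: the discount of the payoff
  (\<open>K1\<close>), the cross term (\<open>K2\<close>), the second-order part of the remaining
  factor (\<open>K3\<close>), and the linearization of its exponent (\<open>K4\<close>). Their
  growth in \<open>m\<close> is tame enough to be summed against the weights
  \<open>p * q ^ m\<close>, which leave \<open>(real (Suc m))\<^sup>2 * \<beta> ^ m\<close>.\<close>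

lemma step_expansion:
  "\<exists>K\<ge>0. \<forall>t n m. \<bar>t\<bar> \<le> T \<longrightarrow>
     norm (step_factor n t m * exp (- G t (lag n m)) - 1 - (iexp (q ^ n * t * s * r ^ m) - 1)
        + lag n m * (g t + \<i> * of_real (n * t * s * p)))
     \<le> K * \<bar>t\<bar> powr (3/4) * (real (Suc n))\<^sup>2 * (q ^ n * sqrt (q ^ n)) * ((real (Suc m))\<^sup>2 * (r ^ m) powr (3/4))"
proof -
  obtain CH where CH: "CH \<ge> 0" "\<And>t. \<bar>t\<bar> \<le> T \<Longrightarrow> norm (H t) \<le> CH * \<bar>t\<bar> powr (3/4)"
    using norm_H_le[of T] by blast
  obtain CG where CG: "CG \<ge> 0" "\<And>t c. \<bar>t\<bar> \<le> T \<Longrightarrow> 0 \<le> c \<Longrightarrow> norm (G t c) \<le> CG * \<bar>t\<bar> powr (3/4) * c"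
    using norm_G_le[of T] by blast
  obtain CE where CE: "CE \<ge> 0" "\<And>t c. \<bar>t\<bar> \<le> T \<Longrightarrow> 0 \<le> c \<Longrightarrow>
      norm (G t c - c * g t) \<le> CE * \<bar>t\<bar> powr (3/4) * (c * c powr (3/4))"
    using G_expansion[of T] by blast
  define \<Theta> where "\<Theta> = \<bar>T\<bar> powr (3/4)"
  define \<Lambda> where "\<Lambda> = 2 * CH * \<Theta>"
  define D where "D = s * p * \<bar>T\<bar> powr (1/4)"
  define K1 where "K1 = 2 * (s * a * p) powr (3/4)"
  define K2 where "K2 = 2 * s powr (3/4) * \<Theta> * exp \<Lambda> * (D + CG)"
  define K3 where "K3 = exp \<Lambda> * (D + CG)\<^sup>2 * \<Theta>"
  define K4 where "K4 = D * a + CE"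
  have nonneg: "0 \<le> \<Theta>" "0 \<le> \<Lambda>" "0 \<le> D" "0 \<le> K1" "0 \<le> K2" "0 \<le> K3" "0 \<le> K4"
    using CH CG CE p s a by (auto simp: \<Theta>_def \<Lambda>_def D_def K1_def K2_def K3_def K4_def)
  show ?thesis
  proof (intro exI[of _ "K1 + K2 + K3 + K4"] conjI allI impI)
    fix t :: real and n m :: nat assume t: "\<bar>t\<bar> \<le> T"
    define W where "W = \<bar>t\<bar> powr (3/4)"
    define \<nu> where "\<nu> = q ^ n"
    define c where "c = lag n m"
    define u where "u = \<phi> c"
    define R where "R = (r ^ m) powr (3/4)"
    define e where "e = \<nu> * sqrt \<nu>"
    define Sn where "Sn = real (Suc n)"
    define Sm where "Sm = real (Suc m)"
    \<comment> \<open>\<open>Y\<close> and \<open>Y0\<close> are the phases of the payoff with and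
      without its own discount. \<open>A\<close> collects the centering and \<open>G t c\<close>, so
      that the quantity to be expanded is \<open>iexp Y * exp (- A)\<close>.\<close>
    define Y where "Y = t * u * (\<nu> * s * r ^ m)"
    define Y0 where "Y0 = \<nu> * t * s * r ^ m"
    define A where "A = \<i> * of_real (t * drift n * (1 - u)) + G t c"
    have \<nu>: "0 < \<nu>" "\<nu> \<le> 1" using q_power_le_1 by (auto simp: \<nu>_def)
    have c: "0 \<le> c" "c = Sm * p * \<nu>" using lag_nonneg by (auto simp: c_def lag_def Sm_def \<nu>_def)
    have S: "1 \<le> Sn" "1 \<le> Sm" by (auto simp: Sn_def Sm_def)
    have c_le: "c \<le> Sm * \<nu>" using c S p \<nu> by (simp add: mult_right_mono mult_left_le)
    have R: "1 \<le> R" using r by (simp add: R_def ge_one_powr_ge_zero)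
    have W: "0 \<le> W" "W \<le> \<Theta>" using t by (auto simp: W_def \<Theta>_def intro!: powr_mono2)
    have u: "0 < u" "u \<le> 1" using \<phi>_bounds[OF c(1)] by (auto simp: u_def)
    have u1: "1 - u \<le> a * c" "\<bar>(1 - u) - a * c\<bar> \<le> (a * c)\<^sup>2"
      using exp_minus_bounds[of "a * c"] a c by (auto simp: u_def)
    have tW: "\<bar>t\<bar> \<le> \<bar>T\<bar> powr (1/4) * W" unfolding W_def using t by (intro powr_le_on_bounded) auto
    have sq: "Sn \<le> Sn\<^sup>2" "Sm \<le> Sm\<^sup>2" using S by (auto simp: self_le_power)
    have \<nu>34: "\<nu> powr (3/4) \<le> sqrt \<nu>"
      using \<nu> powr_mono'[of "1/2" "3/4" \<nu>] by (simp add: powr_half_sqrt)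
    have e: "0 \<le> e" "(\<nu>\<^sup>2) powr (3/4) = e" "\<nu> * \<nu> powr (3/4) \<le> e" "\<nu>\<^sup>2 \<le> e"
    proof -
      show "0 \<le> e" using \<nu> by (simp add: e_def)
      have "(\<nu>\<^sup>2) powr (3/4) = \<nu> powr (1 + 1/2)"
        using \<nu> by (simp add: powr_powr flip: powr_numeral)
      also have "\<dots> = e" using \<nu> by (simp only: powr_add) (simp add: powr_half_sqrt e_def)
      finally show "(\<nu>\<^sup>2) powr (3/4) = e" .
      show "\<nu> * \<nu> powr (3/4) \<le> e" unfolding e_def using \<nu> \<nu>34 by (intro mult_left_mono) auto
      have "\<nu> \<le> sqrt \<nu>" using \<nu> powr_mono'[of "1/2" 1 \<nu>] by (simp add: powr_half_sqrt)
      then show "\<nu>\<^sup>2 \<le> e" unfolding e_def power2_eq_square using \<nu> by (intro mult_left_mono) auto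
    qed
    let ?B = "W * Sn\<^sup>2 * e * (Sm\<^sup>2 * R)"

    have drift: "\<bar>t * drift n\<bar> * a \<le> D * Sn * W"
    proof -
      have "\<bar>t * drift n\<bar> * a = \<bar>t\<bar> * (s * p * real n)"
        using s p a by (simp add: drift_def abs_mult)
      also have "\<dots> \<le> (\<bar>T\<bar> powr (1/4) * W) * (s * p * Sn)"
        using tW s p W by (intro mult_mono) (auto simp: Sn_def)
      finally show ?thesis by (simp add: D_def mult_ac)
    qed
    have tdr: "norm (\<i> * of_real (t * drift n * (1 - u))) \<le> D * Sn * W * c"
    proof -
      have "norm (\<i> * of_real (t * drift n * (1 - u))) = \<bar>t * drift n\<bar> * (1 - u)"
        using u by (simp only: norm_mult norm_ii norm_of_real) (simp add: abs_mult)
      also have "\<dots> \<le> \<bar>t * drift n\<bar> * (a * c)" using u1 by (intro mult_left_mono) auto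
      also have "\<dots> = (\<bar>t * drift n\<bar> * a) * c" by simp
      also have "\<dots> \<le> D * Sn * W * c" using drift c by (intro mult_right_mono) auto
      finally show ?thesis .
    qed
    have A: "norm A \<le> (D + CG) * Sn * W * (Sm * \<nu>)"
    proof -
      have "norm A \<le> D * Sn * W * c + CG * W * c"
        unfolding A_def using CG(2)[OF t c(1)] tdr by (intro norm_triangle_le add_mono) (auto simp: W_def)
      also have "\<dots> \<le> D * Sn * W * c + CG * W * c * Sn"
        using mult_left_mono[of 1 Sn "CG * W * c"] S CG W c by simp
      also have "\<dots> = (D + CG) * Sn * W * c" by (simp add: algebra_simps)
      also have "\<dots> \<le> (D + CG) * Sn * W * (Sm * \<nu>)"
        using c_le nonneg CG S W by (intro mult_left_mono) auto
      finally show ?thesis .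
    qed
    \<comment> \<open>The centering is purely imaginary and drops out. Writing \<open>G t c\<close>
      as a difference of two values of \<open>H\<close> gives a bound uniform in \<open>c\<close>,
      whereas the bound proportional to \<open>c\<close> is useless for the unbounded lags.\<close>
    have ReA: "Re (- A) \<le> \<Lambda>"
    proof -
      have "\<bar>t * u\<bar> \<le> \<bar>t\<bar>" using u by (simp add: abs_mult mult_left_le)
      then have tu: "\<bar>t * u\<bar> \<le> T" "\<bar>t * u\<bar> powr (3/4) \<le> W" using t by (auto simp: W_def intro: powr_mono2)
      have "Re (- A) = Re (- G t c)" by (simp add: A_def)
      also have "- G t c = H (t * u) - H t" using H_scale[OF c(1), of t] by (simp add: u_def)
      also have "Re \<dots> \<le> norm (H (t * u) - H t)" by (rule complex_Re_le_cmod)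
      also have "\<dots> \<le> norm (H (t * u)) + norm (H t)" by (rule norm_triangle_ineq4)
      also have "\<dots> \<le> CH * W + CH * W"
        using CH(2)[OF t] CH(2)[OF tu(1)] mult_left_mono[OF tu(2) CH(1)] by (auto simp: W_def)
      also have "\<dots> \<le> \<Lambda>" using W CH by (simp add: \<Lambda>_def mult_left_mono)
      finally show ?thesis .
    qed

    \<comment> \<open>This remainder sets the rate: \<open>Y - Y0\<close> is of order
      \<open>\<nu>\<^sup>2 * r ^ m\<close>, and its power \<open>3/4\<close> is of order
      \<open>\<nu> powr (3/2)\<close>, which is \<open>e\<close>. All other remainders are of
      smaller or equal order in \<open>\<nu>\<close>.\<close>
    have R1: "norm (iexp Y - iexp Y0) \<le> K1 * ?B"
    proof -
      have "Y - Y0 = - (t * (1 - u) * (\<nu> * s * r ^ m))" by (simp add: Y_def Y0_def algebra_simps)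
      then have "\<bar>Y - Y0\<bar> = \<bar>t\<bar> * (1 - u) * (\<nu> * s * r ^ m)" using u \<nu> s r by (simp add: abs_mult)
      also have "\<dots> \<le> \<bar>t\<bar> * (a * c) * (\<nu> * s * r ^ m)"
        using u1 \<nu> s r by (intro mult_right_mono mult_left_mono) auto
      also have "\<dots> = (s * a * p) * \<bar>t\<bar> * Sm * \<nu>\<^sup>2 * r ^ m" by (simp add: c(2) power2_eq_square)
      finally have "\<bar>Y - Y0\<bar> powr (3/4) \<le> ((s * a * p) * \<bar>t\<bar> * Sm * \<nu>\<^sup>2 * r ^ m) powr (3/4)"
        by (intro powr_mono2) auto
      also have "\<dots> = (s * a * p) powr (3/4) * W * Sm powr (3/4) * e * R"
        using s a p S \<nu> r by (simp add: powr_mult W_def R_def flip: e(2))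
      finally have "norm (iexp Y - iexp Y0) \<le> K1 * (W * Sm powr (3/4) * e * R)"
        using norm_iexp_diff_powr_le[of Y Y0] by (simp add: K1_def)
      also have "Sm powr (3/4) \<le> Sm\<^sup>2" using S powr_mono[of "3/4" 2 Sm] by simp
      then have "K1 * (W * Sm powr (3/4) * e * R) \<le> K1 * (W * Sm\<^sup>2 * e * R)"
        using nonneg W e R by (intro mult_left_mono mult_right_mono) auto
      also have "\<dots> \<le> K1 * (W * Sm\<^sup>2 * e * R) * Sn\<^sup>2"
        using nonneg W e R S by (intro mult_le_cancel_left1[THEN iffD2]) (auto simp: mult_less_0_iff)
      finally show ?thesis by (simp add: mult_ac)
    qed

    have R2: "norm ((iexp Y - 1) * (exp (- A) - 1)) \<le> K2 * ?B"
    proof -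
      have "\<bar>Y\<bar> = \<bar>t\<bar> * u * (\<nu> * s * r ^ m)" using u \<nu> s r by (simp add: Y_def abs_mult)
      also have "\<dots> \<le> \<bar>t\<bar> * 1 * (\<nu> * s * r ^ m)"
        using u \<nu> s r by (intro mult_right_mono mult_left_mono) auto
      finally have "\<bar>Y\<bar> powr (3/4) \<le> (\<bar>t\<bar> * 1 * (\<nu> * s * r ^ m)) powr (3/4)"
        by (intro powr_mono2) auto
      also have "\<dots> = W * \<nu> powr (3/4) * s powr (3/4) * R" using \<nu> s r by (simp add: powr_mult W_def R_def)
      also have "\<dots> \<le> \<Theta> * \<nu> powr (3/4) * s powr (3/4) * R"
        using W R by (intro mult_right_mono) auto
      finally have 1: "norm (iexp Y - 1) \<le> 2 * (\<Theta> * \<nu> powr (3/4) * s powr (3/4) * R)"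
        using norm_iexp_diff_powr_le[of Y 0] by simp
      have "norm (exp (- A) - 1) \<le> exp \<Lambda> * norm (- A)" using ReA nonneg by (intro norm_exp_minus_1_le) auto
      also have "\<dots> \<le> exp \<Lambda> * ((D + CG) * Sn * W * (Sm * \<nu>))" using A by (simp add: mult_left_mono)
      finally have 2: "norm (exp (- A) - 1) \<le> exp \<Lambda> * ((D + CG) * Sn * W * (Sm * \<nu>))" .
      have "norm ((iexp Y - 1) * (exp (- A) - 1))
        \<le> 2 * (\<Theta> * \<nu> powr (3/4) * s powr (3/4) * R) * (exp \<Lambda> * ((D + CG) * Sn * W * (Sm * \<nu>)))"
        unfolding norm_mult using 1 2 nonneg R by (intro mult_mono) auto
      also have "\<dots> = K2 * (W * Sn * (\<nu> * \<nu> powr (3/4)) * (Sm * R))" by (simp add: K2_def mult_ac)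
      also have "\<dots> \<le> K2 * ?B"
        using nonneg W R S sq e \<nu> by (intro mult_left_mono mult_mono) auto
      finally show ?thesis .
    qed

    have R3: "norm (exp (- A) - 1 - (- A)) \<le> K3 * ?B"
    proof -
      have "norm (exp (- A) - 1 - (- A)) \<le> exp \<Lambda> * (norm (- A))\<^sup>2"
        using ReA nonneg by (intro norm_exp_minus_1_minus_le) auto
      also have "\<dots> \<le> exp \<Lambda> * ((D + CG) * Sn * W * (Sm * \<nu>))\<^sup>2"
        using A by (intro mult_left_mono power_mono) auto
      also have "\<dots> = exp \<Lambda> * (D + CG)\<^sup>2 * W * (W * Sn\<^sup>2 * \<nu>\<^sup>2 * (Sm\<^sup>2 * 1))"
        by (simp add: power2_eq_square mult_ac)
      also have "\<dots> \<le> exp \<Lambda> * (D + CG)\<^sup>2 * \<Theta> * (W * Sn\<^sup>2 * e * (Sm\<^sup>2 * R))"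
        using W R e nonneg by (intro mult_mono) auto
      finally show ?thesis by (simp add: K3_def)
    qed

    have R4: "norm (A - c * (g t + \<i> * of_real (n * t * s * p))) \<le> K4 * ?B"
    proof -
      \<comment> \<open>As \<open>a * drift n = s * p * n\<close>, the linearized centering
        \<open>t * drift n * a * c\<close> is exactly \<open>c\<close> times the linear term of the
        scaling relation; only the curvature of \<open>\<phi>\<close> remains.\<close>
      have spl: "A - c * (g t + \<i> * of_real (n * t * s * p))
        = \<i> * of_real (t * drift n * ((1 - u) - a * c)) + (G t c - c * g t)"
        using a by (simp add: A_def drift_def field_simps)
      have "norm (\<i> * of_real (t * drift n * ((1 - u) - a * c))) = \<bar>t * drift n\<bar> * \<bar>(1 - u) - a * c\<bar>"
        by (simp only: norm_mult norm_ii norm_of_real abs_mult mult_1)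
      also have "\<dots> \<le> \<bar>t * drift n\<bar> * (a * c)\<^sup>2" using u1 by (intro mult_left_mono) auto
      also have "\<dots> = (\<bar>t * drift n\<bar> * a) * a * c\<^sup>2" by (simp add: power2_eq_square)
      also have "\<dots> \<le> (D * Sn * W) * a * c\<^sup>2" using drift a by (intro mult_right_mono) auto
      also have "\<dots> \<le> (D * Sn * W) * a * (Sm * \<nu>)\<^sup>2"
        using c c_le a nonneg S W by (intro mult_left_mono power_mono) auto
      also have "\<dots> = D * a * (W * Sn * \<nu>\<^sup>2 * (Sm\<^sup>2 * 1))" by (simp add: power2_eq_square mult_ac)
      also have "\<dots> \<le> D * a * ?B"
        using nonneg a W R S sq e by (intro mult_left_mono mult_mono) auto
      finally have 1: "norm (\<i> * of_real (t * drift n * ((1 - u) - a * c))) \<le> D * a * ?B" .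
      have "c * c powr (3/4) \<le> (Sm * \<nu>) * (Sm * \<nu>) powr (3/4)"
        using c c_le S \<nu> by (intro mult_mono powr_mono2) auto
      also have "\<dots> = (Sm * Sm powr (3/4)) * (\<nu> * \<nu> powr (3/4))" using S \<nu> by (simp add: powr_mult)
      also have "\<dots> \<le> (Sm * Sm) * e"
        using S e \<nu> powr_mono[of "3/4" 1 Sm] by (intro mult_mono) auto
      finally have cc: "c * c powr (3/4) \<le> Sm\<^sup>2 * e" by (simp add: power2_eq_square)
      have "norm (G t c - c * g t) \<le> CE * W * (c * c powr (3/4))"
        using CE(2)[OF t c(1)] by (simp add: W_def)
      also have "\<dots> \<le> CE * W * (Sm\<^sup>2 * e)" using cc CE W by (intro mult_left_mono) auto
      also have "\<dots> = CE * (W * 1 * e * (Sm\<^sup>2 * 1))" by simp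
      also have "\<dots> \<le> CE * ?B"
        using CE W R S e one_le_power[OF S(1), of 2] by (intro mult_left_mono mult_mono) auto
      finally have 2: "norm (G t c - c * g t) \<le> CE * ?B" .
      show ?thesis unfolding spl K4_def distrib_right by (intro norm_triangle_le add_mono 1 2)
    qed

    have "step_factor n t m * exp (- G t c) = iexp Y * exp (- A)"
    proof -
      have "\<i> * of_real (t * u * (\<nu> * s * r ^ m) - t * drift n * (1 - u)) + - G t c = \<i> * of_real Y + - A"
        by (simp add: Y_def A_def algebra_simps)
      then show ?thesis
        unfolding step_factor_def c_def[symmetric] u_def[symmetric] \<nu>_def[symmetric] exp_add[symmetric] by simp
    qed
    then have "step_factor n t m * exp (- G t c) - 1 - (iexp Y0 - 1) + c * (g t + \<i> * of_real (n * t * s * p))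
      = (iexp Y - iexp Y0) + (iexp Y - 1) * (exp (- A) - 1) + (exp (- A) - 1 - (- A))
        + - (A - c * (g t + \<i> * of_real (n * t * s * p)))"
      by (simp add: algebra_simps)
    also have "norm \<dots> \<le> K1 * ?B + K2 * ?B + K3 * ?B + K4 * ?B"
      by (intro norm_triangle_le add_mono R1 R2 R3) (simp only: norm_minus_cancel R4)
    finally show "norm (step_factor n t m * exp (- G t (lag n m)) - 1 - (iexp (q ^ n * t * s * r ^ m) - 1)
        + lag n m * (g t + \<i> * of_real (n * t * s * p)))
     \<le> (K1 + K2 + K3 + K4) * \<bar>t\<bar> powr (3/4) * (real (Suc n))\<^sup>2 * (q ^ n * sqrt (q ^ n)) * ((real (Suc m))\<^sup>2 * (r ^ m) powr (3/4))"
      by (simp add: W_def Sn_def Sm_def R_def e_def c_def Y0_def \<nu>_def algebra_simps)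
  qed (use nonneg in auto)
qed

section \<open>Averaging one renewal over the geometric law\<close>

lemma weights_sums: "(\<lambda>m. p * q ^ m) sums 1"
proof -
  have "(\<lambda>m. p * q ^ m) sums (p * (1 / (1 - q)))" using q by (intro sums_mult geometric_sums) simp
  then show ?thesis using p by (simp add: q_def)
qed

text \<open>A waiting time has mean \<open>1 / p\<close>, so a lag has mean
  \<open>q ^ n = 1 / N\<close>: rescaled time advances by \<open>1 / N\<close> per renewal on
  average.\<close>

lemma weights_lag_sums: "(\<lambda>m. p * q ^ m * lag n m) sums q ^ n"
proof -
  have "(\<lambda>m. (p * p * q ^ n) * (real (Suc m) * q ^ m)) sums ((p * p * q ^ n) * (1 / (1 - q)\<^sup>2))"
    using q by (intro sums_mult geometric_deriv_sums) simp
  moreover have "(p * p * q ^ n) * (1 / (1 - q)\<^sup>2) = q ^ n" using p by (simp add: q_def power2_eq_square)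
  ultimately show ?thesis by (simp add: lag_def mult_ac)
qed

text \<open>After averaging, the payoff phases add up to \<open>pos_part (q ^ n * t)\<close>, and
  the lag terms to \<open>q ^ n * (g t + \<i> * of_real (n * t * s * p))\<close>, which is
  \<open>g (q ^ n * t)\<close> by the scaling relation. What remains is
  \<open>neg_part (q ^ n * t)\<close>; it is quadratic in \<open>q ^ n * t\<close> and joins the
  error.\<close>

lemma limit_recursion_error:
  "\<exists>K\<ge>0. \<forall>t n. \<bar>t\<bar> \<le> T \<longrightarrow>
     (\<exists>E. (\<lambda>m. of_real (p * q ^ m) * (step_factor n t m * exp (H (t * \<phi> (lag n m))))) sums (exp (H t) + E) \<and>
       norm E \<le> K * \<bar>t\<bar> powr (3/4) * ((real (Suc n))\<^sup>2 * (q ^ n * sqrt (q ^ n))))"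
proof -
  obtain KE where KE: "KE \<ge> 0" "\<And>t n m. \<bar>t\<bar> \<le> T \<Longrightarrow>
     norm (step_factor n t m * exp (- G t (lag n m)) - 1 - (iexp (q ^ n * t * s * r ^ m) - 1)
        + lag n m * (g t + \<i> * of_real (n * t * s * p)))
     \<le> KE * \<bar>t\<bar> powr (3/4) * (real (Suc n))\<^sup>2 * (q ^ n * sqrt (q ^ n)) * ((real (Suc m))\<^sup>2 * (r ^ m) powr (3/4))"
    using step_expansion[of T] by blast
  obtain CN where CN: "CN \<ge> 0" "\<And>y. norm (neg_part y) \<le> CN * y\<^sup>2" using neg_part_le by blast
  obtain CH where CH: "CH \<ge> 0" "\<And>t. \<bar>t\<bar> \<le> T \<Longrightarrow> norm (H t) \<le> CH * \<bar>t\<bar> powr (3/4)"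
    using norm_H_le[of T] by blast
  define \<Sigma> where "\<Sigma> = (\<Sum>m. (real (Suc m))\<^sup>2 * \<beta> ^ m)"
  have \<Sigma>: "0 \<le> \<Sigma>" unfolding \<Sigma>_def using \<beta> by (intro suminf_nonneg summable_square_times_power) auto
  define D where "D = \<bar>T\<bar> powr (1/4) * \<bar>T\<bar>"
  define L where "L = exp (CH * \<bar>T\<bar> powr (3/4))"
  show ?thesis
  proof (intro exI[of _ "L * (KE * p * \<Sigma> + CN * D)"] conjI allI impI)
    show "0 \<le> L * (KE * p * \<Sigma> + CN * D)" using KE p \<Sigma> CN by (simp add: L_def D_def)
    fix t n assume t: "\<bar>t\<bar> \<le> T"
    define W where "W = \<bar>t\<bar> powr (3/4)"
    define e where "e = (real (Suc n))\<^sup>2 * (q ^ n * sqrt (q ^ n))"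
    define X where "X = g t + \<i> * of_real (n * t * s * p)"
    define R where "R m = step_factor n t m * exp (- G t (lag n m)) - 1 - (iexp (q ^ n * t * s * r ^ m) - 1)
        + lag n m * X" for m
    have W: "0 \<le> W" by (simp add: W_def)
    have e: "0 \<le> e" using q by (simp add: e_def)
    have nR: "norm (of_real (p * q ^ m) * R m) \<le> (KE * W * e * p) * ((real (Suc m))\<^sup>2 * \<beta> ^ m)" for m
    proof -
      have "norm (of_real (p * q ^ m) * R m) = p * q ^ m * norm (R m)"
        unfolding norm_mult norm_of_real using p q by simp
      also have "\<dots> \<le> p * q ^ m * (KE * W * e * ((real (Suc m))\<^sup>2 * (r ^ m) powr (3/4)))"
        using KE(2)[OF t, of n m] p q unfolding R_def X_def W_def e_def
        by (intro mult_left_mono) (simp_all only: mult.assoc, auto)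
      also have "\<dots> = (KE * W * e * p) * ((real (Suc m))\<^sup>2 * (q ^ m * (r ^ m) powr (3/4)))" by (simp add: mult_ac)
      finally show ?thesis by (simp only: q_r_powr)
    qed
    have sumb: "summable (\<lambda>m. (KE * W * e * p) * ((real (Suc m))\<^sup>2 * \<beta> ^ m))"
      using \<beta> by (intro summable_mult summable_square_times_power)
    define SR where "SR = (\<Sum>m. of_real (p * q ^ m) * R m)"
    have "norm SR \<le> (\<Sum>m. (KE * W * e * p) * ((real (Suc m))\<^sup>2 * \<beta> ^ m))"
      unfolding SR_def by (rule norm_suminf_le[OF nR sumb])
    also have "\<dots> = (KE * W * e * p) * \<Sigma>"
      unfolding \<Sigma>_def by (rule suminf_mult[OF summable_square_times_power[OF \<beta>]])
    finally have SR_le: "norm SR \<le> (KE * W * e * p) * \<Sigma>" .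
    have SR: "(\<lambda>m. of_real (p * q ^ m) * R m) sums SR"
      unfolding SR_def
      by (rule summable_sums, rule summable_norm_cancel, rule summable_comparison_test'[OF sumb, of 0])
        (use nR in simp)
    have sums0: "(\<lambda>m. of_real (p * q ^ m) * R m + of_real (p * q ^ m) + pos_term (q ^ n * t) m - of_real (p * q ^ m * lag n m) * X)
      sums (SR + of_real 1 + pos_part (q ^ n * t) - of_real (q ^ n) * X)"
      unfolding pos_part_def
      by (intro sums_add sums_diff sums_mult2 SR sums_of_real weights_sums weights_lag_sums summable_sums summable_pos)
    have term_eq: "of_real (p * q ^ m) * R m + of_real (p * q ^ m) + pos_term (q ^ n * t) m - of_real (p * q ^ m * lag n m) * X
      = of_real (p * q ^ m) * (step_factor n t m * exp (- G t (lag n m)))" for m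
      unfolding R_def pos_term_def by (simp add: algebra_simps)
    have "SR + of_real 1 + pos_part (q ^ n * t) - of_real (q ^ n) * X = 1 + (SR - neg_part (q ^ n * t))"
      using levy_exponent_eq[of "q ^ n * t"] levy_exponent_scale_power[of n t] by (simp add: X_def)
    with sums0 have "(\<lambda>m. of_real (p * q ^ m) * (step_factor n t m * exp (- G t (lag n m)))) sums (1 + (SR - neg_part (q ^ n * t)))"
      by (simp only: term_eq)
    \<comment> \<open>Multiplying by \<open>exp (H t)\<close> turns each factor
      \<open>exp (- G t (lag n m))\<close> into \<open>exp (H (t * \<phi> (lag n m)))\<close>, by
      the shift property of \<open>H\<close>.\<close>
    then have sums1: "(\<lambda>m. exp (H t) * (of_real (p * q ^ m) * (step_factor n t m * exp (- G t (lag n m)))))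
      sums (exp (H t) * (1 + (SR - neg_part (q ^ n * t))))"
      by (rule sums_mult)
    have term_eq1: "exp (H t) * (of_real (p * q ^ m) * (step_factor n t m * exp (- G t (lag n m))))
      = of_real (p * q ^ m) * (step_factor n t m * exp (H (t * \<phi> (lag n m))))" for m
      unfolding H_scale[OF lag_nonneg] by (simp add: exp_diff exp_minus divide_inverse mult_ac)
    from sums1 have sums: "(\<lambda>m. of_real (p * q ^ m) * (step_factor n t m * exp (H (t * \<phi> (lag n m)))))
      sums (exp (H t) + exp (H t) * (SR - neg_part (q ^ n * t)))"
      by (simp only: term_eq1 distrib_left mult_1_right)
    have "norm (neg_part (q ^ n * t)) \<le> CN * (D * W * e)"
    proof -
      have "\<bar>t\<bar> \<le> \<bar>T\<bar> powr (1/4) * W" unfolding W_def using t by (intro powr_le_on_bounded) auto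
      then have "\<bar>t\<bar> * \<bar>t\<bar> \<le> (\<bar>T\<bar> powr (1/4) * W) * \<bar>T\<bar>" using t W by (intro mult_mono) auto
      then have t2: "t\<^sup>2 \<le> D * W" by (simp add: D_def power2_eq_square mult_ac)
      have "(q ^ n)\<^sup>2 \<le> q ^ n * sqrt (q ^ n)"
        using q_power_le_1[of n] real_sqrt_le_mono[of "(q ^ n)\<^sup>2" "q ^ n"]
        by (simp add: power2_eq_square mult_left_le)
      also have "\<dots> \<le> e"
        using mult_right_mono[OF one_le_power[of "real (Suc n)" 2], of "q ^ n * sqrt (q ^ n)"] q_power_le_1[of n]
        by (simp add: e_def)
      finally have "(q ^ n)\<^sup>2 * t\<^sup>2 \<le> e * (D * W)" using t2 e by (intro mult_mono) auto
      then have "CN * (q ^ n * t)\<^sup>2 \<le> CN * (D * W * e)"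
        using CN(1) by (intro mult_left_mono) (simp_all add: power_mult_distrib mult_ac)
      with CN(2)[of "q ^ n * t"] show ?thesis by linarith
    qed
    then have diff: "norm (SR - neg_part (q ^ n * t)) \<le> (KE * p * \<Sigma> + CN * D) * (W * e)"
      using SR_le norm_triangle_ineq4[of SR "neg_part (q ^ n * t)"] by (simp add: algebra_simps)
    have "norm (exp (H t)) \<le> L"
    proof -
      have "Re (H t) \<le> norm (H t)" by (rule complex_Re_le_cmod)
      also have "\<dots> \<le> CH * \<bar>t\<bar> powr (3/4)" by (rule CH(2)[OF t])
      also have "\<dots> \<le> CH * \<bar>T\<bar> powr (3/4)" using t CH(1) by (intro mult_left_mono powr_mono2) auto
      finally show ?thesis by (simp add: L_def)
    qed
    with diff have "norm (exp (H t) * (SR - neg_part (q ^ n * t))) \<le> L * ((KE * p * \<Sigma> + CN * D) * (W * e))"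
      unfolding norm_mult by (intro mult_mono) (auto simp: L_def)
    then have "norm (exp (H t) * (SR - neg_part (q ^ n * t))) \<le> L * (KE * p * \<Sigma> + CN * D) * W * e"
      by (simp only: mult.assoc)
    with sums show "\<exists>E. (\<lambda>m. of_real (p * q ^ m) * (step_factor n t m * exp (H (t * \<phi> (lag n m))))) sums (exp (H t) + E) \<and>
       norm E \<le> L * (KE * p * \<Sigma> + CN * D) * \<bar>t\<bar> powr (3/4) * ((real (Suc n))\<^sup>2 * (q ^ n * sqrt (q ^ n)))"
      unfolding W_def e_def by blast
  qed
qed

section \<open>Comparison of the two recursions\<close>

definition discount :: "nat \<Rightarrow> real" where "discount n = exp (- a * p / r ^ n)"

definition h :: "nat \<Rightarrow> real \<Rightarrow> complex" where
  "h n t = iexp (- (t * drift n)) * \<theta> (discount n) (t * q ^ n)"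

lemma inverse_r_power: "1 / r ^ n = q ^ n"
  by (simp add: r_def power_one_over)

lemma discount_power: "discount n ^ Suc m = \<phi> (lag n m)"
proof -
  have "discount n = exp (- (a * p * q ^ n))"
    using inverse_r_power[of n] by (simp add: discount_def divide_inverse)
  then have "discount n ^ Suc m = exp (real (Suc m) * - (a * p * q ^ n))" by (simp only: exp_of_nat_mult)
  then show ?thesis by (simp add: lag_def mult_ac)
qed

lemma discount: "0 < discount n" "discount n < 1"
  using a p r by (auto simp: discount_def)

text \<open>The contracted argument needs only the phase
  \<open>- (t * \<phi> (lag n m) * drift n)\<close> for its own centering. The rest of the centering
  phase is absorbed by \<open>step_factor\<close>.\<close>

lemma h_recursion:
  "(\<lambda>m. of_real (p * q ^ m) * (step_factor n t m * h n (t * \<phi> (lag n m)))) sums h n t"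
proof -
  have *: "(\<lambda>m. iexp (- (t * drift n)) * (of_real (p * q ^ m) * (iexp (t * q ^ n * discount n ^ Suc m * (s * r ^ m))
      * \<theta> (discount n) (t * q ^ n * discount n ^ Suc m)))) sums h n t"
    unfolding h_def by (intro sums_mult \<theta>_recursion discount)
  have eq: "iexp (- (t * drift n)) * (of_real (p * q ^ m) * (iexp (t * q ^ n * discount n ^ Suc m * (s * r ^ m))
      * \<theta> (discount n) (t * q ^ n * discount n ^ Suc m)))
    = of_real (p * q ^ m) * (step_factor n t m * h n (t * \<phi> (lag n m)))" for m
  proof -
    have 1: "t * q ^ n * discount n ^ Suc m = t * \<phi> (lag n m) * q ^ n" by (simp only: discount_power mult_ac)
    have 2: "iexp (- (t * drift n)) * iexp (t * \<phi> (lag n m) * q ^ n * (s * r ^ m))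
      = step_factor n t m * iexp (- (t * \<phi> (lag n m) * drift n))"
      unfolding step_factor_def exp_add[symmetric] by (simp add: algebra_simps)
    have "iexp (- (t * drift n)) * (of_real (p * q ^ m) * (iexp (t * q ^ n * discount n ^ Suc m * (s * r ^ m))
        * \<theta> (discount n) (t * q ^ n * discount n ^ Suc m)))
      = of_real (p * q ^ m) * ((iexp (- (t * drift n)) * iexp (t * \<phi> (lag n m) * q ^ n * (s * r ^ m)))
        * \<theta> (discount n) (t * \<phi> (lag n m) * q ^ n))"
      unfolding 1 by (simp only: mult.assoc mult.left_commute)
    then show ?thesis unfolding 2 h_def by (simp only: mult.assoc)
  qed
  show ?thesis using * by (simp only: eq)
qed

lemma norm_h_le_1: "norm (h n t) \<le> 1"
  unfolding h_def norm_mult \<theta>_def using real_distribution.cmod_char_le_1[OF real_distribution_seq_sum]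
  by (simp only: norm_exp_i_times mult_1)

lemma isCont_h: "isCont (h n) 0"
proof -
  have "isCont (\<theta> (discount n)) (0 * q ^ n)"
    unfolding \<theta>_def by (rule real_distribution.isCont_char[OF real_distribution_seq_sum])
  then have "isCont (\<lambda>t. \<theta> (discount n) (t * q ^ n)) 0"
    by (intro isCont_o2[where g = "\<theta> (discount n)" and f = "\<lambda>t. t * q ^ n"] continuous_intros)
  then show ?thesis unfolding h_def[abs_def] by (intro continuous_intros)
qed

lemma h_0: "h n 0 = 1"
  by (simp add: h_def \<theta>_def real_distribution.char_zero[OF real_distribution_seq_sum])

lemma H_0: "H 0 = 0"
proof -
  obtain C where "\<And>t. \<bar>t\<bar> \<le> 0 \<Longrightarrow> norm (H t) \<le> C * \<bar>t\<bar> powr (3/4)" using norm_H_le[of 0] by blast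
  from this[of 0] show ?thesis by simp
qed

lemma isCont_H: "isCont H 0"
proof -
  obtain C where C: "C \<ge> 0" "\<And>t. \<bar>t\<bar> \<le> 1 \<Longrightarrow> norm (H t) \<le> C * \<bar>t\<bar> powr (3/4)"
    using norm_H_le[of 1] by blast
  have "((\<lambda>t. C * \<bar>t\<bar> powr (3/4)) \<longlongrightarrow> C * \<bar>0\<bar> powr (3/4)) (at 0)"
    by (intro tendsto_intros tendsto_powr') auto
  then have lim: "((\<lambda>t. C * \<bar>t\<bar> powr (3/4)) \<longlongrightarrow> 0) (at (0::real))" by simp
  have "\<forall>\<^sub>F t in at 0. norm (H t) \<le> C * \<bar>t\<bar> powr (3/4)"
    unfolding eventually_at by (intro exI[of _ 1]) (use C(2) in \<open>auto simp: dist_real_def\<close>)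
  then have "(H \<longlongrightarrow> 0) (at 0)" by (rule Lim_null_comparison) (rule lim)
  then show ?thesis by (simp add: isCont_def H_0)
qed

text \<open>The maximum principle leaves no room for an error term, so it is applied to the distance
  minus the barrier \<open>K' * e * \<bar>t\<bar> powr (3/4)\<close>. One step lowers the barrier by
  at least the fraction \<open>1 - \<rho>\<close>, of order \<open>1 / N\<close>, and this decrease
  pays for the error of the step.\<close>

lemma norm_h_minus_limit_le:
  "\<exists>K\<ge>0. \<forall>t n. \<bar>t\<bar> \<le> T \<longrightarrow>
     norm (h n t - exp (H t)) \<le> K * \<bar>t\<bar> powr (3/4) * ((real (Suc n))\<^sup>2 * sqrt (q ^ n))"
proof -
  obtain K where K: "K \<ge> 0" "\<And>t n. \<bar>t\<bar> \<le> T \<Longrightarrow>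
     (\<exists>E. (\<lambda>m. of_real (p * q ^ m) * (step_factor n t m * exp (H (t * \<phi> (lag n m))))) sums (exp (H t) + E) \<and>
       norm E \<le> K * \<bar>t\<bar> powr (3/4) * ((real (Suc n))\<^sup>2 * (q ^ n * sqrt (q ^ n))))"
    using limit_recursion_error[of T] by blast
  obtain CH where CH: "CH \<ge> 0" "\<And>t. \<bar>t\<bar> \<le> T \<Longrightarrow> norm (H t) \<le> CH * \<bar>t\<bar> powr (3/4)"
    using norm_H_le[of T] by blast
  \<comment> \<open>Chosen so that \<open>K * q ^ n = K' * x / (1 + \<kappa> * p)\<close> for
    \<open>x = \<kappa> * p * q ^ n\<close>. Since \<open>x \<le> \<kappa> * p\<close>, the
    right-hand side is at most \<open>K' * x / (1 + x)\<close>, hence at most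
    \<open>K' * (1 - exp (- x))\<close>.\<close>
  define K' where "K' = K * (1 + \<kappa> * p) / (\<kappa> * p)"
  have K': "K' \<ge> 0" using K p \<kappa> by (simp add: K'_def)
  show ?thesis
  proof (intro exI[of _ K'] conjI allI impI K')
    fix t0 n assume t0: "\<bar>t0\<bar> \<le> T"
    define e where "e = (real (Suc n))\<^sup>2 * sqrt (q ^ n)"
    define \<rho> where "\<rho> = exp (- \<kappa> * (p * q ^ n))"
    have e: "0 \<le> e" using q by (simp add: e_def)
    define \<Delta> where "\<Delta> t = norm (h n t - exp (H t))" for t
    define f where "f t = \<Delta> t - K' * e * \<bar>t\<bar> powr (3/4)" for t
    define w where "w m = p * q ^ m" for m
    have w: "0 \<le> w m" "w sums 1" for m using p q weights_sums by (auto simp: w_def[abs_def])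
    have \<rho>: "K * (q ^ n * e) \<le> K' * e * (1 - \<rho>)"
    proof -
      define x where "x = \<kappa> * p * q ^ n"
      have x: "0 \<le> x" "x \<le> \<kappa> * p" using \<kappa> p q_power_le_1[of n] by (auto simp: x_def mult_left_le)
      have "K * (b * e) = K * (1 + y) / y * e * (y * b / (1 + y))" if "0 < y" for y b
        using that by (simp add: divide_simps)
      from this[OF mult_pos_pos[OF \<kappa> p(1)]]
      have "K * (q ^ n * e) = K' * e * (x / (1 + \<kappa> * p))"
        unfolding K'_def x_def .
      also have "\<dots> \<le> K' * e * (x / (1 + x))"
        using x K' e by (intro mult_left_mono divide_left_mono mult_pos_pos) auto
      also have "\<dots> \<le> K' * e * (1 - exp (- x))"
        using exp_minus_bounds(2)[OF x(1)] K' e by (intro mult_left_mono) auto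
      finally show ?thesis by (simp add: \<rho>_def x_def mult_ac)
    qed
    have \<Delta>_le: "\<Delta> t \<le> 1 + exp (CH * \<bar>T\<bar> powr (3/4))" if t: "\<bar>t\<bar> \<le> T" for t
    proof -
      have "Re (H t) \<le> norm (H t)" by (rule complex_Re_le_cmod)
      also have "\<dots> \<le> CH * \<bar>t\<bar> powr (3/4)" by (rule CH(2)[OF t])
      also have "\<dots> \<le> CH * \<bar>T\<bar> powr (3/4)" using t CH(1) by (intro mult_left_mono powr_mono2) auto
      finally have "norm (exp (H t)) \<le> exp (CH * \<bar>T\<bar> powr (3/4))" by simp
      then show ?thesis
        unfolding \<Delta>_def using norm_h_le_1[of n t] norm_triangle_ineq4[of "h n t" "exp (H t)"] by linarith
    qed
    have shrink: "\<bar>t * \<phi> (lag n m)\<bar> \<le> T" if "\<bar>t\<bar> \<le> T" for t m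
    proof -
      have "\<bar>t * \<phi> (lag n m)\<bar> \<le> \<bar>t\<bar>" using \<phi>_bounds[OF lag_nonneg[of n m]] by (simp add: abs_mult mult_left_le)
      with that show ?thesis by simp
    qed
    have sum_\<Delta>: "summable (\<lambda>m. w m * \<Delta> (t * \<phi> (lag n m)))" if t: "\<bar>t\<bar> \<le> T" for t
    proof (rule summable_comparison_test'[of "\<lambda>m. w m * (1 + exp (CH * \<bar>T\<bar> powr (3/4)))" 0])
      show "summable (\<lambda>m. w m * (1 + exp (CH * \<bar>T\<bar> powr (3/4))))"
        using w by (intro summable_mult2) (auto simp: sums_iff)
      show "norm (w m * \<Delta> (t * \<phi> (lag n m))) \<le> w m * (1 + exp (CH * \<bar>T\<bar> powr (3/4)))" for m
        using w(1)[of m] \<Delta>_le[OF shrink[OF t, of m]] by (simp add: \<Delta>_def abs_mult mult_left_mono)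
    qed
    \<comment> \<open>The shortest lag, at \<open>m = 0\<close>, is \<open>p * q ^ n\<close>; the
      factor \<open>\<rho>\<close> belongs to it and therefore bounds the contraction for every
      \<open>m\<close>.\<close>
    have powr_term: "\<bar>t * \<phi> (lag n m)\<bar> powr (3/4) \<le> \<bar>t\<bar> powr (3/4) * \<rho>" for t m
    proof -
      have "p * q ^ n \<le> lag n m" using p q by (simp add: lag_def mult_le_cancel_right1)
      then have "exp (- \<kappa> * lag n m) \<le> \<rho>" using \<kappa> by (simp add: \<rho>_def)
      moreover have "\<bar>t * \<phi> (lag n m)\<bar> powr (3/4) = \<bar>t\<bar> powr (3/4) * exp (- \<kappa> * lag n m)"
        by (simp only: abs_mult abs_exp_cancel) (simp only: powr_mult \<phi>_powr)
      ultimately show ?thesis by (simp add: mult_left_mono)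
    qed
    have sum_powr: "summable (\<lambda>m. w m * (K' * e * \<bar>t * \<phi> (lag n m)\<bar> powr (3/4)))" for t
    proof (rule summable_comparison_test'[of "\<lambda>m. w m * (K' * e * (\<bar>t\<bar> powr (3/4) * \<rho>))" 0])
      show "summable (\<lambda>m. w m * (K' * e * (\<bar>t\<bar> powr (3/4) * \<rho>)))"
        using w by (intro summable_mult2) (auto simp: sums_iff)
      show "norm (w m * (K' * e * \<bar>t * \<phi> (lag n m)\<bar> powr (3/4))) \<le> w m * (K' * e * (\<bar>t\<bar> powr (3/4) * \<rho>))" for m
        using w(1)[of m] K' e powr_term[of t m] by (simp add: abs_mult mult_left_mono)
    qed
    have sum_f: "summable (\<lambda>m. w m * f (t * \<phi> (lag n m)))" if t: "\<bar>t\<bar> \<le> T" for t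
      unfolding f_def right_diff_distrib by (intro summable_diff sum_\<Delta>[OF t] sum_powr)
    have "f t0 \<le> 0"
    proof (rule average_maximum_principle[where f = f and t = t0 and T = T, OF discount[of n] w])
      fix t assume t: "\<bar>t\<bar> \<le> T"
      show "summable (\<lambda>m. w m * f (t * discount n ^ Suc m))"
        using sum_f[OF t] by (simp only: discount_power)
      obtain E where E: "(\<lambda>m. of_real (p * q ^ m) * (step_factor n t m * exp (H (t * \<phi> (lag n m))))) sums (exp (H t) + E)"
        "norm E \<le> K * \<bar>t\<bar> powr (3/4) * ((real (Suc n))\<^sup>2 * (q ^ n * sqrt (q ^ n)))"
        using K(2)[OF t] by blast
      \<comment> \<open>Both recursions carry the same unimodular factors, so their difference is an
        average of the values \<open>?d m\<close> up to the error \<open>E\<close>.\<close>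
      let ?d = "\<lambda>m. h n (t * \<phi> (lag n m)) - exp (H (t * \<phi> (lag n m)))"
      have "(\<lambda>m. of_real (w m) * (step_factor n t m * ?d m)) sums (h n t - (exp (H t) + E))"
        using sums_diff[OF h_recursion[of n t] E(1)] by (simp add: w_def algebra_simps)
      moreover have "norm (\<Sum>m. of_real (w m) * (step_factor n t m * ?d m)) \<le> (\<Sum>m. w m * \<Delta> (t * \<phi> (lag n m)))"
        using w by (intro norm_suminf_le sum_\<Delta>[OF t]) (simp add: norm_mult \<Delta>_def)
      ultimately have "norm (h n t - (exp (H t) + E)) \<le> (\<Sum>m. w m * \<Delta> (t * \<phi> (lag n m)))"
        by (simp add: sums_iff)
      then have 1: "\<Delta> t \<le> (\<Sum>m. w m * \<Delta> (t * \<phi> (lag n m))) + K * (q ^ n * e) * \<bar>t\<bar> powr (3/4)"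
        using E(2) norm_triangle_ineq[of "h n t - (exp (H t) + E)" E] by (simp add: \<Delta>_def e_def mult_ac)
      have "(\<Sum>m. w m * (K' * e * \<bar>t * \<phi> (lag n m)\<bar> powr (3/4))) \<le> (\<Sum>m. w m * (K' * e * (\<bar>t\<bar> powr (3/4) * \<rho>)))"
        using w K' e powr_term sum_powr
        by (intro suminf_le mult_left_mono summable_mult2) (auto simp: sums_iff)
      also have "\<dots> = K' * e * (\<bar>t\<bar> powr (3/4) * \<rho>)"
        using sums_mult2[OF w(2), of "K' * e * (\<bar>t\<bar> powr (3/4) * \<rho>)"] by (simp add: sums_iff)
      finally have 2: "(\<Sum>m. w m * (K' * e * \<bar>t * \<phi> (lag n m)\<bar> powr (3/4))) \<le> K' * e * \<rho> * \<bar>t\<bar> powr (3/4)"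
        by (simp add: mult_ac)
      have 3: "K * (q ^ n * e) * \<bar>t\<bar> powr (3/4) \<le> K' * e * (1 - \<rho>) * \<bar>t\<bar> powr (3/4)"
        using \<rho> by (rule mult_right_mono) simp
      have "(\<Sum>m. w m * f (t * \<phi> (lag n m)))
        = (\<Sum>m. w m * \<Delta> (t * \<phi> (lag n m))) - (\<Sum>m. w m * (K' * e * \<bar>t * \<phi> (lag n m)\<bar> powr (3/4)))"
        unfolding f_def right_diff_distrib by (rule suminf_diff[symmetric, OF sum_\<Delta>[OF t] sum_powr])
      then have "f t \<le> (\<Sum>m. w m * f (t * \<phi> (lag n m)))"
        using 1 2 3 by (simp add: f_def algebra_simps)
      then show "f t \<le> (\<Sum>m. w m * f (t * discount n ^ Suc m))" by (simp only: discount_power)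
    next
      fix \<epsilon> :: real assume "0 < \<epsilon>"
      \<comment> \<open>Near \<open>0\<close> both functions are close to their common value
        \<open>1\<close>, and the barrier is only subtracted.\<close>
      moreover have "isCont \<Delta> 0"
        unfolding \<Delta>_def[abs_def] by (intro continuous_intros isCont_h isCont_H)
      ultimately obtain \<delta> where \<delta>: "\<delta> > 0" "\<And>t. dist t 0 < \<delta> \<Longrightarrow> dist (\<Delta> t) (\<Delta> 0) < \<epsilon>"
        unfolding continuous_at_eps_delta by blast
      have "f t \<le> \<epsilon>" if "\<bar>t\<bar> < \<delta>" for t
      proof -
        have "\<Delta> t < \<epsilon>" using \<delta>(2)[of t] that by (simp add: \<Delta>_def h_0 H_0 dist_real_def)
        moreover have "0 \<le> K' * e * \<bar>t\<bar> powr (3/4)" using K' e by simp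
        ultimately show ?thesis by (simp add: f_def)
      qed
      with \<delta>(1) show "\<exists>\<delta>>0. \<forall>t. \<bar>t\<bar> < \<delta> \<longrightarrow> f t \<le> \<epsilon>" by blast
    qed (rule t0)
    then show "norm (h n t0 - exp (H t0)) \<le> K' * \<bar>t0\<bar> powr (3/4) * ((real (Suc n))\<^sup>2 * sqrt (q ^ n))"
      by (simp add: f_def \<Delta>_def e_def mult_ac)
  qed
qed

lemma h_tendsto: "(\<lambda>n. h n t) \<longlonglongrightarrow> exp (H t)"
proof -
  obtain K where K: "\<And>n. norm (h n t - exp (H t)) \<le> K * \<bar>t\<bar> powr (3/4) * ((real (Suc n))\<^sup>2 * sqrt (q ^ n))"
    using norm_h_minus_limit_le[of "\<bar>t\<bar>"] by blast
  have "(\<lambda>n. (real (Suc n))\<^sup>2 * sqrt q ^ n) \<longlonglongrightarrow> 0"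
    using q by (intro summable_LIMSEQ_zero summable_square_times_power) auto
  then have "(\<lambda>n. K * \<bar>t\<bar> powr (3/4) * ((real (Suc n))\<^sup>2 * sqrt (q ^ n))) \<longlonglongrightarrow> 0"
    unfolding real_sqrt_power by (rule tendsto_mult_right_zero)
  then have "(\<lambda>n. h n t - exp (H t)) \<longlonglongrightarrow> 0"
    by (rule Lim_null_comparison[rotated]) (use K in \<open>auto intro: always_eventually\<close>)
  then show ?thesis by (rule LIM_zero_cancel)
qed

lemma char_discounted_sum:
  assumes "prob_space N" and "(\<lambda>\<omega> i. \<tau> (Suc i) \<omega>) \<in> measurable N \<S>"
    and "distr N \<S> (\<lambda>\<omega> i. \<tau> (Suc i) \<omega>) = \<S>"
  shows "(\<lambda>\<omega>. 1 / r ^ n * discounted_sum s r \<tau> (discount n) \<omega> - s * p * real n / a) \<in> borel_measurable N"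
    and "char (distr N borel (\<lambda>\<omega>. 1 / r ^ n * discounted_sum s r \<tau> (discount n) \<omega> - s * p * real n / a)) t = h n t"
proof -
  interpret N: prob_space N by fact
  note [measurable] = assms(2) seq_sum_measurable
  have [measurable]: "(\<lambda>\<omega>. seq_sum (discount n) (\<lambda>i. \<tau> (Suc i) \<omega>)) \<in> borel_measurable N"
    by (rule measurable_compose[OF assms(2) seq_sum_measurable])
  show meas: "(\<lambda>\<omega>. 1 / r ^ n * discounted_sum s r \<tau> (discount n) \<omega> - s * p * real n / a) \<in> borel_measurable N"
    unfolding discounted_sum_eq by measurable
  have "char (distr N borel (\<lambda>\<omega>. 1 / r ^ n * discounted_sum s r \<tau> (discount n) \<omega> - s * p * real n / a)) t
    = (CLINT \<omega>|N. iexp (- (t * drift n)) * iexp (t * q ^ n * seq_sum (discount n) (\<lambda>i. \<tau> (Suc i) \<omega>)))"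
    unfolding N.char_distr[OF meas] unfolding discounted_sum_eq inverse_r_power drift_def exp_add[symmetric]
    by (simp add: algebra_simps)
  also have "\<dots> = iexp (- (t * drift n)) * (CLINT \<omega>|N. iexp (t * q ^ n * seq_sum (discount n) (\<lambda>i. \<tau> (Suc i) \<omega>)))"
    by (rule integral_mult_right_zero)
  also have "(CLINT \<omega>|N. iexp (t * q ^ n * seq_sum (discount n) (\<lambda>i. \<tau> (Suc i) \<omega>)))
    = (CLINT x|distr N \<S> (\<lambda>\<omega> i. \<tau> (Suc i) \<omega>). iexp (t * q ^ n * seq_sum (discount n) x))"
    by (rule integral_distr[symmetric, OF assms(2)]) measurable
  finally show "char (distr N borel (\<lambda>\<omega>. 1 / r ^ n * discounted_sum s r \<tau> (discount n) \<omega> - s * p * real n / a)) t = h n t"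
    unfolding assms(3) by (simp add: h_def \<theta>_eq)
qed

end

section \<open>The limit theorem\<close>

theorem mainTheorem4:
  fixes p q r s a :: real
    and M :: "'a measure" and \<tau> :: "nat \<Rightarrow> 'a \<Rightarrow> nat"
    and M' :: "'b measure" and Z :: "real \<Rightarrow> 'b \<Rightarrow> real"
  assumes "0 < p" and "p < 1" and "q = 1 - p" and "r = 1 / q" and "0 < s" and "0 < a"
    and "prob_space M"
    and "prob_space.indep_vars M (\<lambda>_. count_space UNIV) \<tau> {1..}"
    and "\<And>k j. 1 \<le> k \<Longrightarrow> 1 \<le> j \<Longrightarrow> \<P>(\<omega> in M. \<tau> k \<omega> = j) = p * q ^ (j - 1)"
    and "levy_process M' Z"
    and "\<And>u t. 0 \<le> u \<Longrightarrow>
           char (distr M' borel (Z u)) t = exp (complex_of_real u * levy_exponent p q r s t)"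
  shows "(\<forall>\<gamma>. 0 < \<gamma> \<and> \<gamma> < 1 \<longrightarrow>
            (AE \<omega> in M. summable (\<lambda>k. discounted_term s r \<tau> \<gamma> (Suc k) \<omega>)))
       \<and> (\<exists>I. has_wiener_integral_0_infty M' Z (\<lambda>u. exp (- a * u)) I)
       \<and> (\<forall>I. has_wiener_integral_0_infty M' Z (\<lambda>u. exp (- a * u)) I \<longrightarrow>
            weak_conv_m
              (\<lambda>n. distr M borel (\<lambda>\<omega>.
                 1 / r ^ n * discounted_sum s r \<tau> (exp (- a * p / r ^ n)) \<omega> - s * p * real n / a))
              (distr M' borel I))"
proof -
  interpret st_petersburg p q r s a by (rule st_petersburg.intro) fact+
  interpret M: prob_space M by fact
  interpret levy_process M' Z by fact
  interpret Z: levy_process_exponent M' Z "levy_exponent p q r s"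
    by unfold_locales
      (auto simp: assms(11) continuous_on_eq_continuous_at isCont_levy_exponent)
  have rv: "\<tau> k \<in> measurable M (count_space UNIV)" if "1 \<le> k" for k
    using assms(8) that by (auto simp: M.indep_vars_def)
  have law: "distr M (count_space UNIV) (\<tau> k) = measure_pmf \<tau>_pmf" if "1 \<le> k" for k
    using assms(9) that by (intro distr_\<tau> rv assms(7)) auto
  have seq: "(\<lambda>\<omega> i. \<tau> (Suc i) \<omega>) \<in> measurable M \<S>" "distr M \<S> (\<lambda>\<omega> i. \<tau> (Suc i) \<omega>) = \<S>"
    by (rule distr_sequence[OF assms(7,8) law]; assumption)+
  have summable: "AE \<omega> in M. summable (\<lambda>k. discounted_term s r \<tau> \<gamma> (Suc k) \<omega>)"
    if "0 < \<gamma>" "\<gamma> < 1" for \<gamma>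
    using AE_summable_seq_term[OF assms(7) rv law that, of "\<lambda>k. Suc k"]
    by (simp add: discounted_term_eq)
  have cont: "continuous_on {0..} \<phi>" by (intro continuous_intros)
  have G: "((\<lambda>A. integral {0..A} (\<lambda>u. levy_exponent p q r s (y * \<phi> u))) \<longlongrightarrow> H y) at_top" for y
    using G_tendsto_H by (simp add: G_def[abs_def])
  have conv: "weak_conv_m (\<lambda>n. distr M borel (\<lambda>\<omega>.
      1 / r ^ n * discounted_sum s r \<tau> (exp (- a * p / r ^ n)) \<omega> - s * p * real n / a)) (distr M' borel I)"
    if I: "has_wiener_integral_0_infty M' Z \<phi> I" for I
  proof (rule levy_continuity)
    note ds = char_discounted_sum[where \<tau> = \<tau>, OF assms(7) seq, unfolded discount_def]
    show "real_distribution (distr M borel (\<lambda>\<omega>.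
      1 / r ^ n * discounted_sum s r \<tau> (exp (- a * p / r ^ n)) \<omega> - s * p * real n / a))" for n
      by (rule M.real_distribution_distr[OF ds(1)])
    show "real_distribution (distr M' borel I)"
      using I by (intro real_distribution_distr) (simp add: has_wiener_integral_0_infty_def)
    show "(\<lambda>n. char (distr M borel (\<lambda>\<omega>.
      1 / r ^ n * discounted_sum s r \<tau> (exp (- a * p / r ^ n)) \<omega> - s * p * real n / a)) t)
      \<longlonglongrightarrow> char (distr M' borel I) t" for t
      unfolding ds(2) Z.char_wiener_integral_0_infty[OF cont G I] by (rule h_tendsto)
  qed
  show ?thesis
    using summable Z.wiener_integral_0_infty_exists[OF cont G] conv by blast
qed

end
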